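(* Let $H\cong U_3(2){:}2$ be a maximal subgroup of $M_{11}$ and let $A_{12}$ be the subalgebra of $A_{286}$ generated by the $9$ axes corresponding to the $H$-conjugacy class of involutions of $H$ of length $9$. Then $A_{12}$ has dimension $12$ and its full automorphism group is $\mathrm{Aut}(A_{12})\cong AGL(2,3)$.
   Context: All algebras are commutative, not necessarily associative, over $\mathbb{Q}$. For an algebra $B$, $a\in B$ and a scalar $\lambda$, put $B_\lambda(a)=\{u\in B: au=\lambda u\}$. A nonzero idempotent $a\in B$ is a primitive axis with Monster fusion law $\mathcal{M}(\frac14,\frac1{32})$ if $B=B_1(a)\oplus B_0(a)\oplus B_{1/4}(a)\oplus B_{1/32}(a)$, $B_1(a)=\mathbb{Q}a$, and $B_\lambda(a)B_\mu(a)\subseteq\bigoplus_{\nu\in\lambda\ast\mu}B_\nu(a)$, where $\ast$ is symmetric with $1\ast1=\{1\}$, $1\ast0=\emptyset$, $0\ast0=\{0\}$, $1\ast\frac14=0\ast\frac14=\{\frac14\}$, $1\ast\frac1{32}=0\ast\frac1{32}=\frac14\ast\frac1{32}=\{\frac1{32}\}$, $\frac14\ast\frac14=\{1,0\}$, $\frac1{32}\ast\frac1{32}=\{1,0,\frac14\}$. The Miyamoto involution $\tau_a\in\mathrm{Aut}(B)$ acts as $-1$ on $B_{1/32}(a)$ and as $1$ on the other eigenspaces. $A_{286}$ is the algebra (constructed by Seress) of dimension $286$ generated by a set $X$ of $165$ primitive axes with fusion law $\mathcal{M}(\frac14,\frac1{32})$ such that the Miyamoto group $\langle\tau_a: a\in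 X\rangle$ is isomorphic to the Mathieu group $M_{11}$, $X$ is invariant under it, and $a\mapsto\tau_a$ is a bijection from $X$ onto the set of all $165$ involutions of $M_{11}$. It carries a positive definite symmetric bilinear Frobenius form ($(uv,w)=(u,vw)$ for all $u,v,w$) with $(a,a)=1$ for $a\in X$; for distinct $a,b\in X$ with $|\tau_a\tau_b|=2,3,4,5,6$ the value $(a,b)$ is $\frac18,\frac{13}{256},\frac1{64},\frac3{128},\frac5{256}$ respectively (the subalgebra generated by $a,b$ is the Norton–Sakuma algebra of type 2A, 3A, 4B, 5A, 6A respectively). The maximal subgroup $H\cong U_3(2){:}2$ of $M_{11}$ has order $144$ and contains $21$ involutions, in two $H$-classes of lengths $9$ and $12$. The Miyamoto group of $A_{12}$ (generated by the $9$ Miyamoto involutions) is $3^2{:}2$. An axis $a\in X$ corresponds to the involution $\tau_a$. *)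

theory Defs
  imports
    "HOL-Algebra.Algebra"
    "HOL-Combinatorics.Cycles"
    "HOL-Analysis.Determinants"
begin

locale comm_rat_algebra = vector_space scale
  for scale :: "rat \<Rightarrow> 'a::ab_group_add \<Rightarrow> 'a" (infixr "*\<^sub>Q" 75) +
  fixes prod :: "'a \<Rightarrow> 'a \<Rightarrow> 'a" (infixl "\<star>" 70)
  assumes prod_commute: "u \<star> v = v \<star> u"
    and prod_linear: "Vector_Spaces.linear scale scale (\<lambda>u. u \<star> v)"
begin

definition subalgebra :: "'a set \<Rightarrow> bool" where
  "subalgebra S \<longleftrightarrow> subspace S \<and> (\<forall>u\<in>S. \<forall>v\<in>S. u \<star> v \<in> S)"

definition alg_generated :: "'a set \<Rightarrow> 'a set" where
  "alg_generated A = subalgebra hull A"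

text \<open>As in \<^const>\<open>BijGroup\<close>, automorphisms are \<^const>\<open>undefined\<close> outside of \<open>S\<close>,
  so that distinct functions are distinct automorphisms.\<close>

definition alg_aut_group :: "'a set \<Rightarrow> ('a \<Rightarrow> 'a) monoid" where
  "alg_aut_group S = (BijGroup S)
     \<lparr>carrier := {f \<in> Bij S.
        (\<forall>u\<in>S. \<forall>v\<in>S. f (u + v) = f u + f v) \<and>
        (\<forall>c. \<forall>u\<in>S. f (c *\<^sub>Q u) = c *\<^sub>Q f u) \<and>
        (\<forall>u\<in>S. \<forall>v\<in>S. f (u \<star> v) = f u \<star> f v)}\<rparr>"

definition eigenspace :: "'a \<Rightarrow> rat \<Rightarrow> 'a set" where
  "eigenspace a l = {u. a \<star> u = l *\<^sub>Q u}"

end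

definition monster_eigenvalues :: "rat set" where
  "monster_eigenvalues = {1, 0, 1/4, 1/32}"

text \<open>Matching on the set \<open>{l, m}\<close> makes the law symmetric.\<close>

definition monster_fusion :: "rat \<Rightarrow> rat \<Rightarrow> rat set" where
  "monster_fusion l m =
    (if {l, m} = {1} then {1}
     else if {l, m} = {1, 0} then {}
     else if {l, m} = {0} then {0}
     else if {l, m} = {1, 1/4} \<or> {l, m} = {0, 1/4} then {1/4}
     else if {l, m} = {1, 1/32} \<or> {l, m} = {0, 1/32} \<or> {l, m} = {1/4, 1/32} then {1/32}
     else if {l, m} = {1/4} then {1, 0}
     else if {l, m} = {1/32} then {1, 0, 1/4}
     else {})"

context comm_rat_algebra
begin

text \<open>Existence and uniqueness of the family \<open>c\<close> of components says that the algebra is the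
  direct sum of the four eigenspaces.\<close>

definition primitive_axis :: "'a \<Rightarrow> bool" where
  "primitive_axis a \<longleftrightarrow>
     a \<noteq> 0 \<and> a \<star> a = a \<and>
     (\<forall>u. \<exists>!c. c \<in> PiE monster_eigenvalues (eigenspace a) \<and>
                u = (\<Sum>l\<in>monster_eigenvalues. c l)) \<and>
     eigenspace a 1 = span {a} \<and>
     (\<forall>l\<in>monster_eigenvalues. \<forall>m\<in>monster_eigenvalues.
        \<forall>u\<in>eigenspace a l. \<forall>v\<in>eigenspace a m.
          u \<star> v \<in> span (\<Union>n\<in>monster_fusion l m. eigenspace a n))"

definition miyamoto :: "'a \<Rightarrow> 'a \<Rightarrow> 'a" where
  "miyamoto a = (THE f. Vector_Spaces.linear scale scale f \<and>
     (\<forall>u\<in>eigenspace a (1/32). f u = - u) \<and>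
     (\<forall>l\<in>monster_eigenvalues - {1/32}. \<forall>u\<in>eigenspace a l. f u = u))"

definition miyamoto_group :: "'a set \<Rightarrow> ('a \<Rightarrow> 'a) monoid" where
  "miyamoto_group Axs = (alg_aut_group UNIV)
     \<lparr>carrier := generate (alg_aut_group UNIV) (miyamoto ` Axs)\<rparr>"

end

text \<open>
  \<open>norton_sakuma_NX x y\<close> says that the subalgebra generated by \<open>x\<close> and \<open>y\<close> is the
  Norton--Sakuma algebra of type NX, with \<open>x\<close> and \<open>y\<close> the generators \<open>a\<^sub>0\<close> and \<open>a\<^sub>1\<close>.
  It is given by the standard basis and structure constants of Ivanov, Pasechnik, Seress and
  Shpectorov. The axes \<open>a\<^sub>i\<close> are indexed by the integers modulo N, so that each
  equation for \<open>a i\<close> stands for all its translates under the dihedral group.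
\<close>

context comm_rat_algebra
begin

definition basis_of :: "'a list \<Rightarrow> 'a set \<Rightarrow> bool" where
  "basis_of bs S \<longleftrightarrow> distinct bs \<and> independent (set bs) \<and> span (set bs) = S"

definition norton_sakuma_2A :: "'a \<Rightarrow> 'a \<Rightarrow> bool" where
  "norton_sakuma_2A x y \<longleftrightarrow> (\<exists>z.
     basis_of [x, y, z] (alg_generated {x, y}) \<and>
     x \<star> x = x \<and> y \<star> y = y \<and> z \<star> z = z \<and>
     x \<star> y = (1/8) *\<^sub>Q (x + y - z) \<and>
     x \<star> z = (1/8) *\<^sub>Q (x + z - y) \<and>
     y \<star> z = (1/8) *\<^sub>Q (y + z - x))"

definition norton_sakuma_3A :: "'a \<Rightarrow> 'a \<Rightarrow> bool" where
  "norton_sakuma_3A x y \<longleftrightarrow> (\<exists>(a :: int \<Rightarrow> 'a) u.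
     a 0 = x \<and> a 1 = y \<and> (\<forall>i. a (i + 3) = a i) \<and>
     basis_of [a (-1), a 0, a 1, u] (alg_generated {x, y}) \<and>
     (\<forall>i. a i \<star> a i = a i \<and>
          a i \<star> a (i + 1) =
            (1/32) *\<^sub>Q (2 *\<^sub>Q a i + 2 *\<^sub>Q a (i + 1) + a (i - 1)) - (135/2048) *\<^sub>Q u \<and>
          a i \<star> u = (1/9) *\<^sub>Q (2 *\<^sub>Q a i - a (i + 1) - a (i - 1)) + (5/32) *\<^sub>Q u) \<and>
     u \<star> u = u)"

definition norton_sakuma_4B :: "'a \<Rightarrow> 'a \<Rightarrow> bool" where
  "norton_sakuma_4B x y \<longleftrightarrow> (\<exists>(a :: int \<Rightarrow> 'a) z.
     a 0 = x \<and> a 1 = y \<and> (\<forall>i. a (i + 4) = a i) \<and>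
     basis_of [a (-1), a 0, a 1, a 2, z] (alg_generated {x, y}) \<and>
     (\<forall>i. a i \<star> a i = a i \<and>
          a i \<star> a (i + 1) = (1/64) *\<^sub>Q (a i + a (i + 1) - a (i - 1) - a (i + 2) + z) \<and>
          a i \<star> a (i + 2) = (1/8) *\<^sub>Q (a i + a (i + 2) - z) \<and>
          a i \<star> z = (1/8) *\<^sub>Q (a i + z - a (i + 2))) \<and>
     z \<star> z = z)"

definition norton_sakuma_5A :: "'a \<Rightarrow> 'a \<Rightarrow> bool" where
  "norton_sakuma_5A x y \<longleftrightarrow> (\<exists>(a :: int \<Rightarrow> 'a) w.
     a 0 = x \<and> a 1 = y \<and> (\<forall>i. a (i + 5) = a i) \<and>
     basis_of [a (-2), a (-1), a 0, a 1, a 2, w] (alg_generated {x, y}) \<and>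
     (\<forall>i. a i \<star> a i = a i \<and>
          a i \<star> a (i + 1) =
            (1/128) *\<^sub>Q (3 *\<^sub>Q a i + 3 *\<^sub>Q a (i + 1) - a (i + 2) - a (i - 1) - a (i - 2)) + w \<and>
          a i \<star> a (i + 2) =
            (1/128) *\<^sub>Q (3 *\<^sub>Q a i + 3 *\<^sub>Q a (i + 2) - a (i + 1) - a (i - 1) - a (i - 2)) - w \<and>
          a i \<star> w =
            (7/4096) *\<^sub>Q (a (i + 1) + a (i - 1) - a (i + 2) - a (i - 2)) + (7/32) *\<^sub>Q w) \<and>
     w \<star> w = (175/524288) *\<^sub>Q (a (-2) + a (-1) + a 0 + a 1 + a 2))"

definition norton_sakuma_6A :: "'a \<Rightarrow> 'a \<Rightarrow> bool" where
  "norton_sakuma_6A x y \<longleftrightarrow> (\<exists>(a :: int \<Rightarrow> 'a) z u.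
     a 0 = x \<and> a 1 = y \<and> (\<forall>i. a (i + 6) = a i) \<and>
     basis_of [a (-2), a (-1), a 0, a 1, a 2, a 3, z, u] (alg_generated {x, y}) \<and>
     (\<forall>i. a i \<star> a i = a i \<and>
          a i \<star> a (i + 1) =
            (1/64) *\<^sub>Q (a i + a (i + 1) - a (i - 2) - a (i - 1) - a (i + 2) - a (i + 3) + z)
            + (45/2048) *\<^sub>Q u \<and>
          a i \<star> a (i + 2) =
            (1/32) *\<^sub>Q (2 *\<^sub>Q a i + 2 *\<^sub>Q a (i + 2) + a (i - 2)) - (135/2048) *\<^sub>Q u \<and>
          a i \<star> a (i + 3) = (1/8) *\<^sub>Q (a i + a (i + 3) - z) \<and>
          a i \<star> z = (1/8) *\<^sub>Q (a i + z - a (i + 3)) \<and>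
          a i \<star> u = (1/9) *\<^sub>Q (2 *\<^sub>Q a i - a (i + 2) - a (i - 2)) + (5/32) *\<^sub>Q u) \<and>
     z \<star> z = z \<and> u \<star> u = u \<and> z \<star> u = 0)"

end

definition maximal_subgroup :: "'g set \<Rightarrow> ('g, 'm) monoid_scheme \<Rightarrow> bool" where
  "maximal_subgroup H G \<longleftrightarrow> subgroup H G \<and> H \<noteq> carrier G \<and>
     (\<forall>K. subgroup K G \<and> H \<subseteq> K \<longrightarrow> K = H \<or> K = carrier G)"

definition involutions :: "('g, 'm) monoid_scheme \<Rightarrow> 'g set" where
  "involutions G = {g \<in> carrier G. group.ord G g = 2}"

definition conj_class :: "('g, 'm) monoid_scheme \<Rightarrow> 'g \<Rightarrow> 'g set" where
  "conj_class G t = {g \<otimes>\<^bsub>G\<^esub> t \<otimes>\<^bsub>G\<^esub> inv\<^bsub>G\<^esub> g |g. g \<in> carrier G}"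

definition group_center :: "('g, 'm) monoid_scheme \<Rightarrow> 'g set" where
  "group_center G = {z \<in> carrier G. \<forall>g\<in>carrier G. z \<otimes>\<^bsub>G\<^esub> g = g \<otimes>\<^bsub>G\<^esub> z}"

text \<open>The standard generators of the Mathieu group of degree 11.\<close>

definition mathieu_11 :: "(nat \<Rightarrow> nat) monoid" where
  "mathieu_11 = (sym_group 11)
     \<lparr>carrier := generate (sym_group 11)
        {cycle_of_list [1,2,3,4,5,6,7,8,9,10,11],
         cycle_of_list [3,7,11,8] \<circ> cycle_of_list [4,10,5,6]}\<rparr>"

text \<open>The numeral type \<^typ>\<open>3\<close> carries arithmetic modulo 3, i.e. it is the field with 3 elements.\<close>

definition AGL_2_3 :: "(3 ^ 2 \<Rightarrow> 3 ^ 2) monoid" where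
  "AGL_2_3 = \<lparr>carrier = {\<lambda>x. A *v x + b |(A :: 3 ^ 2 ^ 2) b. invertible A},
     monoid.mult = (\<circ>), one = id\<rparr>"

text \<open>The field with 4 elements; \<open>Om\<close> is a root of \<open>x\<^sup>2 + x + 1\<close> and \<open>Om2\<close> is its square.\<close>

datatype gf4 = Ze | On | Om | Om2

instantiation gf4 :: field
begin

definition "zero_gf4 = Ze"
definition "one_gf4 = On"
definition plus_gf4 :: "gf4 \<Rightarrow> gf4 \<Rightarrow> gf4" where
  "plus_gf4 x y = (case x of
      Ze \<Rightarrow> y
    | On \<Rightarrow> (case y of Ze \<Rightarrow> On | On \<Rightarrow> Ze | Om \<Rightarrow> Om2 | Om2 \<Rightarrow> Om)
    | Om \<Rightarrow> (case y of Ze \<Rightarrow> Om | On \<Rightarrow> Om2 | Om \<Rightarrow> Ze | Om2 \<Rightarrow> On)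
    | Om2 \<Rightarrow> (case y of Ze \<Rightarrow> Om2 | On \<Rightarrow> Om | Om \<Rightarrow> On | Om2 \<Rightarrow> Ze))"
definition times_gf4 :: "gf4 \<Rightarrow> gf4 \<Rightarrow> gf4" where
  "times_gf4 x y = (case x of
      Ze \<Rightarrow> Ze
    | On \<Rightarrow> y
    | Om \<Rightarrow> (case y of Ze \<Rightarrow> Ze | On \<Rightarrow> Om | Om \<Rightarrow> Om2 | Om2 \<Rightarrow> On)
    | Om2 \<Rightarrow> (case y of Ze \<Rightarrow> Ze | On \<Rightarrow> Om2 | Om \<Rightarrow> On | Om2 \<Rightarrow> Om))"
definition uminus_gf4 :: "gf4 \<Rightarrow> gf4" where "uminus_gf4 x = x"
definition minus_gf4 :: "gf4 \<Rightarrow> gf4 \<Rightarrow> gf4" where "minus_gf4 x y = x + y"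
definition inverse_gf4 :: "gf4 \<Rightarrow> gf4" where
  "inverse_gf4 x = (case x of Ze \<Rightarrow> Ze | On \<Rightarrow> On | Om \<Rightarrow> Om2 | Om2 \<Rightarrow> Om)"
definition divide_gf4 :: "gf4 \<Rightarrow> gf4 \<Rightarrow> gf4" where "divide_gf4 x y = x * inverse y"

instance
  by standard
    (auto simp: zero_gf4_def one_gf4_def plus_gf4_def times_gf4_def uminus_gf4_def
      minus_gf4_def inverse_gf4_def divide_gf4_def split: gf4.splits)

end

text \<open>Entrywise squaring is the conjugation of the quadratic extension, so this is the conjugate
  transpose.\<close>

definition gf4_adjoint :: "gf4 ^ 3 ^ 3 \<Rightarrow> gf4 ^ 3 ^ 3" where
  "gf4_adjoint A = (\<chi> i j. (A $ j $ i)\<^sup>2)"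

definition SU_3_2 :: "(gf4 ^ 3 ^ 3) monoid" where
  "SU_3_2 = \<lparr>carrier = {A. gf4_adjoint A ** A = mat 1 \<and> det A = 1}, monoid.mult = (**), one = mat 1\<rparr>"

definition U_3_2 :: "(gf4 ^ 3 ^ 3) set monoid" where
  "U_3_2 = SU_3_2 Mod (group_center SU_3_2)"

text \<open>\<open>N:2\<close>, i.e. a split extension of a normal subgroup \<open>N\<close> isomorphic to \<open>U\<^sub>3(2)\<close> by a group
  of order 2.\<close>

definition is_U_3_2_split_2 :: "('g, 'm) monoid_scheme \<Rightarrow> bool" where
  "is_U_3_2_split_2 G \<longleftrightarrow> group G \<and> (\<exists>N K.
     N \<lhd> G \<and> G\<lparr>carrier := N\<rparr> \<cong> U_3_2 \<and>
     subgroup K G \<and> card K = 2 \<and> N \<inter> K = {\<one>\<^bsub>G\<^esub>} \<and> N <#>\<^bsub>G\<^esub> K = carrier G)"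

text \<open>The algebra constructed by Seress, given by its properties instead of by its construction; it
  occupies the whole type.\<close>

locale A286 = comm_rat_algebra scale prod
  for scale :: "rat \<Rightarrow> 'a::ab_group_add \<Rightarrow> 'a" (infixr "*\<^sub>Q" 75)
    and prod :: "'a \<Rightarrow> 'a \<Rightarrow> 'a" (infixl "\<star>" 70) +
  fixes Axs :: "'a set"
    and form :: "'a \<Rightarrow> 'a \<Rightarrow> rat"
  assumes dim_286: "dim UNIV = 286"
    and card_X: "card Axs = 165"
    and X_axes: "a \<in> Axs \<Longrightarrow> primitive_axis a"
    and X_generates: "alg_generated Axs = UNIV"
    and miyamoto_group_iso: "miyamoto_group Axs \<cong> mathieu_11"
    and X_invariant: "g \<in> carrier (miyamoto_group Axs) \<Longrightarrow> g ` Axs = Axs"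
    and miyamoto_bij: "bij_betw miyamoto Axs (involutions (miyamoto_group Axs))"
    and form_sym: "form u v = form v u"
    and form_linear: "Vector_Spaces.linear scale (*) (\<lambda>u. form u v)"
    and form_pos_def: "u \<noteq> 0 \<Longrightarrow> form u u > 0"
    and form_frobenius: "form (u \<star> v) w = form u (v \<star> w)"
    and form_axis: "a \<in> Axs \<Longrightarrow> form a a = 1"
    and dihedral_2: "\<lbrakk>a \<in> Axs; b \<in> Axs; a \<noteq> b;
        group.ord (miyamoto_group Axs) (miyamoto a \<otimes>\<^bsub>miyamoto_group Axs\<^esub> miyamoto b) = 2\<rbrakk>
      \<Longrightarrow> form a b = 1/8 \<and> norton_sakuma_2A a b"
    and dihedral_3: "\<lbrakk>a \<in> Axs; b \<in> Axs; a \<noteq> b;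
        group.ord (miyamoto_group Axs) (miyamoto a \<otimes>\<^bsub>miyamoto_group Axs\<^esub> miyamoto b) = 3\<rbrakk>
      \<Longrightarrow> form a b = 13/256 \<and> norton_sakuma_3A a b"
    and dihedral_4: "\<lbrakk>a \<in> Axs; b \<in> Axs; a \<noteq> b;
        group.ord (miyamoto_group Axs) (miyamoto a \<otimes>\<^bsub>miyamoto_group Axs\<^esub> miyamoto b) = 4\<rbrakk>
      \<Longrightarrow> form a b = 1/64 \<and> norton_sakuma_4B a b"
    and dihedral_5: "\<lbrakk>a \<in> Axs; b \<in> Axs; a \<noteq> b;
        group.ord (miyamoto_group Axs) (miyamoto a \<otimes>\<^bsub>miyamoto_group Axs\<^esub> miyamoto b) = 5\<rbrakk>
      \<Longrightarrow> form a b = 3/128 \<and> norton_sakuma_5A a b"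
    and dihedral_6: "\<lbrakk>a \<in> Axs; b \<in> Axs; a \<noteq> b;
        group.ord (miyamoto_group Axs) (miyamoto a \<otimes>\<^bsub>miyamoto_group Axs\<^esub> miyamoto b) = 6\<rbrakk>
      \<Longrightarrow> form a b = 5/256 \<and> norton_sakuma_6A a b"

end

theory Submission
  imports Defs
begin

text \<open>
  The class of length 9 is a coset \<open>t P\<close> of the normal subgroup \<open>P = 3\<^sup>2\<close> of \<open>H\<close>, with \<open>t\<close> inverting \<open>P\<close>,
  so its axes \<open>a v\<close> are the points of the affine plane over the field with 3 elements, and any two
  of them generate a 3A algebra. The parity and the orbits of \<open>M\<^sub>1\<^sub>1\<close> on 11 points show that no
  involution of \<open>H\<close> centralizes \<open>P\<close>. Therefore \<open>H\<close> contains reflections of the plane, and the 6A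
  algebras generated by the axis of a reflection and an axis \<open>a v\<close> show that parallel lines share
  the additional vector \<open>u d\<close> of their 3A algebras. Orthogonality of eigenvectors, the fusion law and
  positive definiteness of the form yield \<open>u d \<star> u k = 0\<close> for different directions and that
  the sum of the four \<open>u d\<close> is an identity \<open>e\<close>, proportional to the sum of the nine axes. So the
  algebra is spanned by nine axes and four vectors \<open>u d\<close> with one linear relation.

  An automorphism is an isometry, hence commutes with the Casimir operator \<open>\<Sum> e\<^sub>i (e\<^sub>i x)\<close>. The
  eigenspaces of that operator single out the span of the \<open>u d\<close>, whose primitive idempotents are
  permuted. The line sums are then recognized as idempotents in the joint eigenspaces of
  the \<open>u d\<close>, and the product of two crossing line sums isolates their common point. So automorphisms
  permute the axes and preserve lines, i.e. they are affine maps.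
\<close>

text \<open>The obstacle is that an automorphism of the subalgebra is given only by its action on
  products: neither the form nor the set of nine axes is preserved by assumption, and another
  idempotent could be the image of an axis. So form, directions, lines and points have to be
  recovered from the product in this order. The Casimir operator helps because it does not depend on
  the chosen pair of dual bases, so every isometric automorphism commutes with it. Instead of dual
  bases, a redundant weighted frame is used: all nine axes, all eight \<open>u d\<close> (each
  direction twice, as \<open>d\<close> and \<open>- d\<close>) and \<open>e\<close>. It keeps the
  symmetry of the plane in every computation, and it also extends an affine map linearly without a
  choice of basis, so the linear relation among the generators needs no separate consistency check.
  Modulo \<open>e\<close> the axes have eigenvalue 115/108 and the \<open>u d\<close> have 55/72;
  that these differ is what separates the two kinds of vectors. The 3A relations by themselves
  attach a vector to each of the twelve lines; involutions outside the class of length 9 reduce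
  these to four.\<close>

lemmas lin_simps = of_rat_divide add_divide_distrib diff_divide_distrib

section \<open>Bilinear calculus for the product and a Frobenius form\<close>

context comm_rat_algebra
begin

lemma prod_left_linear_simps [simp]:
  "(x + y) \<star> z = x \<star> z + y \<star> z"
  "(x - y) \<star> z = x \<star> z - y \<star> z"
  "(- x) \<star> z = - (x \<star> z)"
  "0 \<star> z = 0"
  "(c *\<^sub>Q x) \<star> z = c *\<^sub>Q (x \<star> z)"
  "(\<Sum>i\<in>I. g i) \<star> z = (\<Sum>i\<in>I. g i \<star> z)"
proof -
  interpret L: Vector_Spaces.linear scale scale "\<lambda>u. u \<star> z"
    by (rule prod_linear)
  show "(x + y) \<star> z = x \<star> z + y \<star> z" "(x - y) \<star> z = x \<star> z - y \<star> z"
    "(- x) \<star> z = - (x \<star> z)" "0 \<star> z = 0" "(c *\<^sub>Q x) \<star> z = c *\<^sub>Q (x \<star> z)"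
    "(\<Sum>i\<in>I. g i) \<star> z = (\<Sum>i\<in>I. g i \<star> z)"
    using L.add L.diff L.neg L.zero L.scale L.sum by auto
qed

lemma prod_right_linear_simps [simp]:
  "z \<star> (x + y) = z \<star> x + z \<star> y"
  "z \<star> (x - y) = z \<star> x - z \<star> y"
  "z \<star> (- x) = - (z \<star> x)"
  "z \<star> 0 = 0"
  "z \<star> (c *\<^sub>Q x) = c *\<^sub>Q (z \<star> x)"
  "z \<star> (\<Sum>i\<in>I. g i) = (\<Sum>i\<in>I. z \<star> g i)"
  by (simp_all add: prod_commute [of z])

lemma span_closed_under_prod:
  assumes "\<And>x y. x \<in> A \<Longrightarrow> y \<in> A \<Longrightarrow> x \<star> y \<in> span A" "x \<in> span A" "y \<in> span A"
  shows "x \<star> y \<in> span A"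
  using assms(2)
proof (induction rule: span_induct_alt)
  case base
  show ?case by (simp add: span_zero)
next
  case (step c x z)
  have "x \<star> y \<in> span A"
    using assms(3)
  proof (induction rule: span_induct_alt)
    case base
    show ?case by (simp add: span_zero)
  next
    case (step d v w)
    then show ?case using assms(1) \<open>x \<in> A\<close> by (simp add: span_add span_scale)
  qed
  then show ?case using step by (simp add: span_add span_scale)
qed

end

locale frobenius_algebra = comm_rat_algebra scale prod
  for scale :: "rat \<Rightarrow> 'a::ab_group_add \<Rightarrow> 'a" (infixr "*\<^sub>Q" 75)
    and prod :: "'a \<Rightarrow> 'a \<Rightarrow> 'a" (infixl "\<star>" 70) +
  fixes form :: "'a \<Rightarrow> 'a \<Rightarrow> rat"
  assumes form_sym: "form u v = form v u"
    and form_linear: "Vector_Spaces.linear scale (*) (\<lambda>u. form u v)"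
    and form_pos_def: "u \<noteq> 0 \<Longrightarrow> form u u > 0"
    and form_frobenius: "form (u \<star> v) w = form u (v \<star> w)"
begin

lemma form_left_linear_simps [simp]:
  "form (x + y) z = form x z + form y z"
  "form (x - y) z = form x z - form y z"
  "form (- x) z = - form x z"
  "form 0 z = 0"
  "form (c *\<^sub>Q x) z = c * form x z"
  "form (\<Sum>i\<in>I. g i) z = (\<Sum>i\<in>I. form (g i) z)"
proof -
  interpret L: Vector_Spaces.linear scale "(*)" "\<lambda>u. form u z"
    by (rule form_linear)
  show "form (x + y) z = form x z + form y z"
    "form (x - y) z = form x z - form y z"
    "form (- x) z = - form x z" "form 0 z = 0" "form (c *\<^sub>Q x) z = c * form x z"
    "form (\<Sum>i\<in>I. g i) z = (\<Sum>i\<in>I. form (g i) z)"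
    using L.add L.diff L.neg L.zero L.scale L.sum by auto
qed

lemma form_right_linear_simps [simp]:
  "form z (x + y) = form z x + form z y"
  "form z (x - y) = form z x - form z y"
  "form z (- x) = - form z x"
  "form z 0 = 0"
  "form z (c *\<^sub>Q x) = c * form z x"
  "form z (\<Sum>i\<in>I. g i) = (\<Sum>i\<in>I. form z (g i))"
  by (simp_all add: form_sym [of z])

lemma form_eqI:
  assumes "\<And>w. form w x = form w y"
  shows "x = y"
proof -
  have "form (x - y) (x - y) = 0"
    using assms[of "x - y"] by (simp only: form_right_linear_simps)
  then show ?thesis using form_pos_def[of "x - y"] by auto
qed

text \<open>Arithmetic decides linear identities with fractional coefficients over the reals, not over
  the rationals. Hence linear identities between vectors are reduced to identities between values
  of the real functionals \<open>rform w\<close>.\<close>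

definition rform :: "'a \<Rightarrow> 'a \<Rightarrow> real" where
  "rform w x = of_rat (form w x)"

lemma rform_linear_simps [simp]:
  "rform z (x + y) = rform z x + rform z y"
  "rform z (x - y) = rform z x - rform z y"
  "rform z (- x) = - rform z x"
  "rform z 0 = 0"
  "rform z (c *\<^sub>Q x) = of_rat c * rform z x"
  "rform z (\<Sum>i\<in>I. g i) = (\<Sum>i\<in>I. rform z (g i))"
  by (simp_all add: rform_def of_rat_add of_rat_diff of_rat_minus of_rat_mult of_rat_sum)

lemma vec_eqI:
  assumes "\<And>w. rform w x = rform w y"
  shows "x = y"
  by (rule form_eqI) (use assms in \<open>simp add: rform_def\<close>)

lemma rform_cong: "x = y \<Longrightarrow> rform w x = rform w y"
  by simp

lemma form_eq_0_iff: "form x x = 0 \<longleftrightarrow> x = 0"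
  using form_pos_def[of x] by (cases "x = 0") auto

text \<open>The Frobenius property makes multiplication by \<open>a\<close> self-adjoint.\<close>

lemma eigenvectors_orthogonal:
  assumes "a \<star> x = l *\<^sub>Q x" "a \<star> y = m *\<^sub>Q y" "l \<noteq> m"
  shows "form x y = 0"
proof -
  have "l * form x y = form (x \<star> a) y" using assms(1) by (simp add: prod_commute[of x])
  also have "\<dots> = m * form x y" using assms(2) by (simp add: form_frobenius)
  finally show ?thesis using assms(3) by simp
qed

end

section \<open>The algebra of an affine plane of axes\<close>

lemma F3_double: "(x::3) + x = - x"
  using exhaust_3[of x] by auto

lemma F3_vec_double: "(d::3^2) + d = - d"
  unfolding vec_eq_iff
  by (simp only: vector_add_component vector_uminus_component F3_double) simp

lemma F3_vec_double_minus: "- d - d = (d::3^2)"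
  using F3_vec_double[of "- d"] by simp

lemma F3_vec_distinct:
  fixes d :: "3^2"
  assumes "d \<noteq> 0"
  shows "v + d \<noteq> v" "v - d \<noteq> v" "v + d \<noteq> v - d"
proof -
  show "v + d \<noteq> v" "v - d \<noteq> v" using assms by auto
  have *: "- d \<noteq> d" using assms F3_vec_double[of d] by (metis add.right_inverse add_0)
  show "v + d \<noteq> v - d"
  proof
    assume "v + d = v - d"
    then have "d = - d" by (metis add_diff_cancel_left' diff_conv_add_uminus)
    with * show False by simp
  qed
qed

lemma F3_vec_add_add: "v + d + d = v - (d::3^2)"
  by (simp add: add.assoc F3_vec_double)

lemma F3_vec_diff_diff: "v - d - d = v + (d::3^2)"
proof -
  have "v - d - d = v + (- d - d)" by simp
  then show ?thesis by (simp only: F3_vec_double_minus)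
qed

lemma F3_directions_distinct:
  fixes d k v :: "3^2"
  assumes "d \<noteq> 0" "k \<noteq> 0" "k \<noteq> d" "k \<noteq> - d"
  shows "v + d \<noteq> v + k" "v + d \<noteq> v - k" "v - d \<noteq> v + k" "v - d \<noteq> v - k"
  using assms by (auto simp: minus_equation_iff)

lemma F3_vec_add_cancel: "d + (d + x) = x - (d::3^2)"
  by (simp add: F3_vec_double flip: add.assoc)

context comm_rat_algebra
begin

lemma subspace_eigenspace: "subspace (eigenspace a l)"
  by (rule subspaceI) (auto simp: eigenspace_def scale_right_distrib scale_left_commute)

lemma axis_fusion_singleton:
  assumes "primitive_axis a" "l \<in> monster_eigenvalues" "m \<in> monster_eigenvalues"
    "monster_fusion l m = {n}" "a \<star> x = l *\<^sub>Q x" "a \<star> y = m *\<^sub>Q y"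
  shows "a \<star> (x \<star> y) = n *\<^sub>Q (x \<star> y)"
proof -
  have "x \<star> y \<in> span (\<Union>k\<in>monster_fusion l m. eigenspace a k)"
    using assms unfolding primitive_axis_def eigenspace_def by blast
  then have "x \<star> y \<in> eigenspace a n"
    using assms(4) span_subspace[OF subset_refl span_superset subspace_eigenspace]
    by (simp add: span_eq_iff[THEN iffD2, OF subspace_eigenspace])
  then show ?thesis by (simp add: eigenspace_def)
qed

end

text \<open>Indexing \<open>u\<close> by a direction instead of a line builds in that parallel lines
  share their vector; only \<open>affine_plane_of_class\<close> has to justify this. The value
  \<open>u 0\<close> carries no meaning, hence the guards \<open>d \<noteq> 0\<close>.\<close>

locale affine_plane_algebra = frobenius_algebra scale prod form
  for scale :: "rat \<Rightarrow> 'a::ab_group_add \<Rightarrow> 'a" (infixr "*\<^sub>Q" 75)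
    and prod :: "'a \<Rightarrow> 'a \<Rightarrow> 'a" (infixl "\<star>" 70)
    and form :: "'a \<Rightarrow> 'a \<Rightarrow> rat" +
  fixes a u :: "3^2 \<Rightarrow> 'a"
  assumes axis: "primitive_axis (a v)"
    and form_a_self: "form (a v) (a v) = 1"
    and form_a_a: "v \<noteq> w \<Longrightarrow> form (a v) (a w) = 13/256"
    and prod_a_a: "d \<noteq> 0 \<Longrightarrow> a v \<star> a (v + d) =
      (1/32) *\<^sub>Q (2 *\<^sub>Q a v + 2 *\<^sub>Q a (v + d) + a (v - d)) - (135/2048) *\<^sub>Q u d"
    and prod_a_u: "d \<noteq> 0 \<Longrightarrow> a v \<star> u d =
      (1/9) *\<^sub>Q (2 *\<^sub>Q a v - a (v + d) - a (v - d)) + (5/32) *\<^sub>Q u d"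
    and u_idem: "d \<noteq> 0 \<Longrightarrow> u d \<star> u d = u d"
    and u_minus: "u (- d) = u d"
begin

lemma a_idem: "a v \<star> a v = a v"
  using axis[of v] by (simp add: primitive_axis_def)

lemma prod_a_a_minus: "d \<noteq> 0 \<Longrightarrow> a v \<star> a (v - d) =
      (1/32) *\<^sub>Q (2 *\<^sub>Q a v + 2 *\<^sub>Q a (v - d) + a (v + d)) - (135/2048) *\<^sub>Q u d"
  using prod_a_a[of "- d" v] by (simp add: u_minus)

text \<open>Moving the idempotent \<open>a v\<close> across the form gives (a,u) = (a, a u), a
  linear equation for the unknown value.\<close>

lemma form_a_u: "d \<noteq> 0 \<Longrightarrow> form (a v) (u d) = 1/4"
  using form_frobenius[of "a v" "a v" "u d"]
  by (simp add: a_idem prod_a_u form_a_self form_a_a F3_vec_distinct[symmetric])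

lemma form_u_self: "d \<noteq> 0 \<Longrightarrow> form (u d) (u d) = 8/5"
  using form_frobenius[of "a 0" "u d" "u d"]
  by (simp add: prod_a_u u_idem form_a_u)

text \<open>The standard eigenvectors of \<open>a v\<close> in the 3A algebra of a line through
  \<open>v\<close>: \<open>alpha\<close> for the eigenvalue 0 and \<open>beta\<close> for 1/4. Both
  are scaled to contain \<open>u d\<close> with coefficient 1, so that \<open>u d\<close> cancels in
  their difference.\<close>

abbreviation alpha :: "3^2 \<Rightarrow> 3^2 \<Rightarrow> 'a" where
  "alpha v d \<equiv> u d - (10/27) *\<^sub>Q a v + (32/27) *\<^sub>Q (a (v + d) + a (v - d))"

abbreviation beta :: "3^2 \<Rightarrow> 3^2 \<Rightarrow> 'a" where
  "beta v d \<equiv> u d - (8/45) *\<^sub>Q a v - (32/45) *\<^sub>Q (a (v + d) + a (v - d))"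

lemma alpha_eigen: "d \<noteq> 0 \<Longrightarrow> a v \<star> alpha v d = 0"
  by (rule vec_eqI) (simp add: prod_a_u prod_a_a prod_a_a_minus a_idem lin_simps)

lemma beta_eigen: "d \<noteq> 0 \<Longrightarrow> a v \<star> beta v d = (1/4) *\<^sub>Q beta v d"
  by (rule vec_eqI) (simp add: prod_a_u prod_a_a prod_a_a_minus a_idem lin_simps)

abbreviation line_product :: "3^2 \<Rightarrow> 3^2 \<Rightarrow> 3^2 \<Rightarrow> 3^2 \<Rightarrow> 'a" where
  "line_product v w x d \<equiv>
    (1/32) *\<^sub>Q (2 *\<^sub>Q a v + 2 *\<^sub>Q a w + a x) - (135/2048) *\<^sub>Q u d"

text \<open>Eigenvectors of \<open>a v\<close> taken from two different lines through
  \<open>v\<close> are orthogonal; after expansion \<open>form (u d) (u k)\<close> is the only value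
  not yet known.\<close>

lemma form_u_u:
  assumes "d \<noteq> 0" "k \<noteq> 0" "k \<noteq> d" "k \<noteq> - d"
  shows "form (u d) (u k) = 0"
proof -
  fix v :: "3^2"
  have "form (alpha v d) (beta v k) = 0"
    by (rule eigenvectors_orthogonal[of "a v" _ 0 _ "1/4"])
       (use alpha_eigen[of d v] beta_eigen[of k v] assms in \<open>auto simp del: prod_right_linear_simps\<close>)
  moreover have "form (u d) (a w) = 1/4" "form (u k) (a w) = 1/4" for w
    using form_a_u assms by (simp_all add: form_sym[of _ "a w"])
  ultimately show ?thesis
    using F3_directions_distinct[OF assms, of v] F3_vec_distinct[of d v] F3_vec_distinct[of k v] assms
      F3_vec_distinct[of k v, symmetric] F3_vec_distinct[of d v, symmetric]
    by (simp add: form_a_self form_a_a form_a_u form_sym[of "a _" "u d"])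
qed

text \<open>Three distinct points are collinear exactly when their sum is zero, so the third point
  of a line has a formula symmetric in the other two.\<close>

lemma prod_a_a_third:
  assumes "w \<noteq> w'" "w' - w = d \<or> w - w' = d" "x = - (w + w')"
  shows "a w \<star> a w' = line_product w w' x d"
proof -
  have "x = w - (w' - w)"
    using assms(3) F3_vec_double[of w] by (simp add: algebra_simps)
  moreover have "u (w' - w) = u d" using assms(2) u_minus[of d] by (auto simp: minus_equation_iff)
  moreover have "w + (w' - w) = w'" by simp
  ultimately show ?thesis using prod_a_a[of "w' - w" w] assms(1) by (metis right_minus_eq)
qed

lemma prod_a_u_points:
  assumes "d \<noteq> 0" "w + d = x" "w - d = y"
  shows "a w \<star> u d = (1/9) *\<^sub>Q (2 *\<^sub>Q a w - a x - a y) + (5/32) *\<^sub>Q u d"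
  using prod_a_u[OF assms(1), of w] assms(2,3) by simp

text \<open>Both \<open>alpha v d \<star> alpha v k\<close> and \<open>alpha v d \<star> beta v k\<close> are eigenvectors of \<open>a v\<close>
  with the same unknown part \<open>u d \<star> u k\<close>; comparing the two eigenvalue equations determines it.\<close>

lemma u_prod_u:
  assumes d: "d \<noteq> 0" and k: "k \<noteq> 0" and dk: "k \<noteq> d" "k \<noteq> - d"
  shows "u d \<star> u k = 0"
proof -
  fix v :: "3^2"
  have ev: "monster_eigenvalues = {1, 0, 1/4, 1/32}" by (simp add: monster_eigenvalues_def)
  have fus: "monster_fusion 0 (1/4) = {1/4}" "monster_fusion 0 0 = {0}"
    by (auto simp: monster_fusion_def doubleton_eq_iff)
  have 1: "a v \<star> (alpha v d \<star> alpha v k) = 0 *\<^sub>Q (alpha v d \<star> alpha v k)"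
    by (rule axis_fusion_singleton[OF axis, where l = 0 and m = 0])
       (use alpha_eigen[OF d, of v] alpha_eigen[OF k, of v] in \<open>auto simp: ev fus simp del: prod_right_linear_simps\<close>)
  have 2: "a v \<star> (alpha v d \<star> beta v k) = (1/4) *\<^sub>Q (alpha v d \<star> beta v k)"
    by (rule axis_fusion_singleton[OF axis, where l = 0 and m = "1/4"])
       (use alpha_eigen[OF d, of v] beta_eigen[OF k, of v] in \<open>auto simp: ev fus simp del: prod_right_linear_simps\<close>)
  \<comment> \<open>\<open>p\<close> and \<open>q\<close> represent the two remaining directions;
    they enter through products of an axis on one line with an axis on the other.\<close>
  obtain p where p: "p = d + k" by blast
  obtain q where q: "q = d - k" by blast
  have nz: "p \<noteq> 0" "q \<noteq> 0" using dk p q by (auto simp: add_eq_0_iff)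
  have pts: "v + d + k = v + p" "v + d - k = v + q" "v - d + k = v - q" "v - d - k = v - p"
    "v + k + d = v + p" "v + k - d = v - q" "v - k + d = v + q" "v - k - d = v - p"
    by (simp_all add: p q)
  note Au = prod_a_u_points[OF k, of "v + d", OF pts(1,2)] prod_a_u_points[OF k, of "v - d", OF pts(3,4)]
     prod_a_u_points[OF d, of "v + k", OF pts(5,6)] prod_a_u_points[OF d, of "v - k", OF pts(7,8)]
  note ds = F3_directions_distinct[OF d k dk]
  have AA: "a (v + d) \<star> a (v + k) = line_product (v + d) (v + k) (v - p) q"
    "a (v + d) \<star> a (v - k) = line_product (v + d) (v - k) (v - q) p"
    "a (v - d) \<star> a (v + k) = line_product (v - d) (v + k) (v + q) p"
    "a (v - d) \<star> a (v - k) = line_product (v - d) (v - k) (v + p) q"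
    by (rule prod_a_a_third[OF ds(1)] prod_a_a_third[OF ds(2)] prod_a_a_third[OF ds(3)] prod_a_a_third[OF ds(4)];
        simp add: p q algebra_simps F3_vec_double F3_vec_add_cancel)+
  note C = prod_commute[of "u _" "a _"] prod_commute[of "a (v + d)" "a v"] prod_commute[of "a (v - d)" "a v"]
  note R = C AA Au prod_a_u[OF d, of v] prod_a_u[OF k, of v] prod_a_u[OF nz(1), of v] prod_a_u[OF nz(2), of v]
    prod_a_a[OF d, of v] prod_a_a[OF k, of v] prod_a_a[OF nz(1), of v] prod_a_a[OF nz(2), of v]
    prod_a_a_minus[OF d, of v] prod_a_a_minus[OF k, of v] prod_a_a_minus[OF nz(1), of v] prod_a_a_minus[OF nz(2), of v]
    a_idem
  show ?thesis
  proof -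
    \<comment> \<open>The difference \<open>g\<close> of \<open>beta v k\<close> and
      \<open>alpha v k\<close> is a combination of axes only. Subtracting the two eigenvalue
      equations expresses \<open>alpha v d \<star> beta v k\<close> as four times
      \<open>a v \<star> (alpha v d \<star> g)\<close>, which involves known products only, while
      the left side contains \<open>u d \<star> u k\<close> once.\<close>
    define g where "g = (26/135) *\<^sub>Q a v - (256/135) *\<^sub>Q (a (v + k) + a (v - k))"
    have g: "beta v k - alpha v k = g"
      unfolding g_def by (rule vec_eqI) (simp add: lin_simps)
    have "alpha v d \<star> beta v k = 4 *\<^sub>Q (a v \<star> (alpha v d \<star> (beta v k - alpha v k)))"
      using 1 2 by (simp only: prod_right_linear_simps(2)) (simp del: prod_right_linear_simps)
    then have *: "alpha v d \<star> beta v k - 4 *\<^sub>Q (a v \<star> (alpha v d \<star> g)) = 0"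
      by (simp only: g) simp
    have "alpha v d \<star> beta v k - 4 *\<^sub>Q (a v \<star> (alpha v d \<star> g)) = u d \<star> u k"
      unfolding g_def by (rule vec_eqI) (simp add: R lin_simps)
    with * show ?thesis by simp
  qed
qed

end

section \<open>Sums over the plane, the identity element and the frame\<close>

abbreviation F3_nonzero :: "(3^2) set" where
  "F3_nonzero \<equiv> UNIV - {0}"

lemma card_F3_plane: "CARD(3^2) = 9" "card F3_nonzero = 8"
  by (simp_all add: card_Diff_singleton)

lemma sum_nonzero_shift:
  fixes g :: "3^2 \<Rightarrow> 'b::ab_group_add"
  shows "(\<Sum>d\<in>F3_nonzero. g (v + d)) = (\<Sum>w\<in>UNIV. g w) - g v"
    and "(\<Sum>d\<in>F3_nonzero. g (v - d)) = (\<Sum>w\<in>UNIV. g w) - g v"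
proof -
  have "(\<Sum>d\<in>UNIV. g (v + d)) = (\<Sum>w\<in>UNIV. g w)"
    by (rule sum.reindex_bij_witness[of _ "\<lambda>w. w - v" "\<lambda>d. v + d"]) auto
  moreover have "(\<Sum>d\<in>UNIV. g (v + d)) = g v + (\<Sum>d\<in>F3_nonzero. g (v + d))"
    using sum.remove[of UNIV "0::3^2" "\<lambda>d. g (v + d)"] by simp
  ultimately show "(\<Sum>d\<in>F3_nonzero. g (v + d)) = (\<Sum>w\<in>UNIV. g w) - g v"
    by (simp add: algebra_simps)
  have "(\<Sum>d\<in>UNIV. g (v - d)) = (\<Sum>w\<in>UNIV. g w)"
    by (rule sum.reindex_bij_witness[of _ "\<lambda>w. v - w" "\<lambda>d. v - d"]) auto
  moreover have "(\<Sum>d\<in>UNIV. g (v - d)) = g v + (\<Sum>d\<in>F3_nonzero. g (v - d))"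
    using sum.remove[of UNIV "0::3^2" "\<lambda>d. g (v - d)"] by simp
  ultimately show "(\<Sum>d\<in>F3_nonzero. g (v - d)) = (\<Sum>w\<in>UNIV. g w) - g v"
    by (simp add: algebra_simps)
qed

lemma sum_translate:
  fixes g :: "3^2 \<Rightarrow> 'b::comm_monoid_add"
  shows "(\<Sum>w\<in>UNIV. g (w + d)) = (\<Sum>w\<in>UNIV. g w)" "(\<Sum>w\<in>UNIV. g (w - d)) = (\<Sum>w\<in>UNIV. g w)"
   by (rule sum.reindex_bij_witness[of _ "\<lambda>w. w - d" "\<lambda>w. w + d"]; simp)
      (rule sum.reindex_bij_witness[of _ "\<lambda>w. w + d" "\<lambda>w. w - d"]; simp)

text \<open>A direction is represented by both \<open>k\<close> and \<open>- k\<close>, so sums over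
  \<open>F3_nonzero\<close> count each direction twice.\<close>

lemma sum_nonzero_supported:
  fixes g :: "3^2 \<Rightarrow> 'b::comm_monoid_add"
  assumes "k \<noteq> 0" "\<And>d. d \<noteq> 0 \<Longrightarrow> d \<noteq> k \<Longrightarrow> d \<noteq> - k \<Longrightarrow> g d = 0"
  shows "(\<Sum>d\<in>F3_nonzero. g d) = g k + g (- k)"
proof -
  have "(\<Sum>d\<in>F3_nonzero. g d) = (\<Sum>d\<in>{k, - k}. g d)"
    by (rule sum.mono_neutral_right) (use assms in auto)
  moreover have "k \<noteq> - k" using F3_vec_distinct(3)[OF assms(1), of 0] by simp
  ultimately show ?thesis by simp
qed

context affine_plane_algebra
begin

text \<open>The factor is forced: an identity must satisfy (a,e) = (a,a) = 1, and an axis pairs with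
  the sum of all nine to 1 + 8 * 13/256 = 45/32.\<close>

definition e :: 'a where
  "e = (32/45) *\<^sub>Q (\<Sum>v\<in>UNIV. a v)"

lemma sum_a: "(\<Sum>v\<in>UNIV. a v) = (45/32) *\<^sub>Q e"
  by (simp add: e_def)

lemma form_a_a_if: "form (a v) (a w) = 13/256 + (if w = v then 243/256 else 0)"
  using form_a_a[of v w] by (auto simp: form_a_self)

lemma form_u_a: "d \<noteq> 0 \<Longrightarrow> form (u d) (a v) = 1/4"
  using form_a_u form_sym by metis

lemma form_u_u_sum:
  assumes "k \<noteq> 0"
  shows "(\<Sum>d\<in>F3_nonzero. form (u k) (u d) *\<^sub>Q g d) = (8/5) *\<^sub>Q (g k + g (- k))"
    "(\<Sum>d\<in>F3_nonzero. form (u k) (u d)) = 16/5"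
proof -
  have "(\<Sum>d\<in>F3_nonzero. form (u k) (u d) *\<^sub>Q g d) =
      form (u k) (u k) *\<^sub>Q g k + form (u k) (u (- k)) *\<^sub>Q g (- k)"
    by (rule sum_nonzero_supported[OF assms]) (use form_u_u[of k] assms in auto)
  then show "(\<Sum>d\<in>F3_nonzero. form (u k) (u d) *\<^sub>Q g d) = (8/5) *\<^sub>Q (g k + g (- k))"
    using assms by (simp add: form_u_self u_minus scale_right_distrib)
  have "(\<Sum>d\<in>F3_nonzero. form (u k) (u d)) = form (u k) (u k) + form (u k) (u (- k))"
    by (rule sum_nonzero_supported[OF assms]) (use form_u_u[of k] assms in auto)
  then show "(\<Sum>d\<in>F3_nonzero. form (u k) (u d)) = 16/5"
    using assms by (simp add: form_u_self u_minus)
qed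

text \<open>The only linear relation among the generators comes from a degenerate Gram matrix: with
  \<open>U\<close> and \<open>T\<close> the two sums, the values 128/5, 18 and 405/32 make the norm
  of \<open>U - (64/45) *\<^sub>Q T\<close> vanish.\<close>

lemma sum_u: "(\<Sum>d\<in>F3_nonzero. u d) = 2 *\<^sub>Q e"
proof -
  define U where "U = (\<Sum>d\<in>F3_nonzero. u d)"
  define T where "T = (\<Sum>v\<in>UNIV. a v)"
  have "form U U = 128/5"
  proof -
    have "form U U = (\<Sum>k\<in>F3_nonzero. \<Sum>d\<in>F3_nonzero. form (u k) (u d))"
      unfolding U_def form_left_linear_simps form_right_linear_simps by (rule sum.swap)
    also have "\<dots> = (\<Sum>k\<in>F3_nonzero. 16/5)"
      by (rule sum.cong) (simp_all add: form_u_u_sum)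
    finally show ?thesis by (simp add: card_F3_plane)
  qed
  moreover have "form U T = 18"
  proof -
    have "form U T = (\<Sum>v\<in>UNIV. \<Sum>d\<in>F3_nonzero. form (u d) (a v))"
      by (simp add: U_def T_def)
    also have "\<dots> = (\<Sum>v\<in>(UNIV :: (3^2) set). \<Sum>d\<in>F3_nonzero. 1/4)"
      by (intro sum.cong) (simp_all add: form_u_a)
    finally show ?thesis by (simp add: card_F3_plane)
  qed
  moreover have "form T T = 405/32"
    unfolding T_def by (simp add: form_a_a_if sum.distrib card_F3_plane)
  moreover have "form T U = form U T" by (rule form_sym)
  ultimately have "form (U - (64/45) *\<^sub>Q T) (U - (64/45) *\<^sub>Q T) = 0"
    by simp
  then have "U = (64/45) *\<^sub>Q T" by (simp only: form_eq_0_iff) simp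
  then show ?thesis by (simp add: U_def T_def e_def)
qed

lemma rform_sum_a:
  "(\<Sum>v\<in>UNIV. rform w (a v)) = (45/32) * rform w e"
  "(\<Sum>d\<in>F3_nonzero. rform w (a (v + d))) = (45/32) * rform w e - rform w (a v)"
  "(\<Sum>d\<in>F3_nonzero. rform w (a (v - d))) = (45/32) * rform w e - rform w (a v)"
  "(\<Sum>v\<in>UNIV. rform w (a (v + d))) = (45/32) * rform w e"
  "(\<Sum>v\<in>UNIV. rform w (a (v - d))) = (45/32) * rform w e"
proof -
  show *: "(\<Sum>v\<in>UNIV. rform w (a v)) = (45/32) * rform w e"
    using rform_cong[OF sum_a, of w] by (simp add: lin_simps)
  show "(\<Sum>d\<in>F3_nonzero. rform w (a (v + d))) = (45/32) * rform w e - rform w (a v)"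
    "(\<Sum>d\<in>F3_nonzero. rform w (a (v - d))) = (45/32) * rform w e - rform w (a v)"
    "(\<Sum>v\<in>UNIV. rform w (a (v + d))) = (45/32) * rform w e"
    "(\<Sum>v\<in>UNIV. rform w (a (v - d))) = (45/32) * rform w e"
    using sum_nonzero_shift[of "\<lambda>x. rform w (a x)" v] sum_translate[of "\<lambda>x. rform w (a x)" d] *
    by simp_all
qed

lemma rform_sum_u: "(\<Sum>d\<in>F3_nonzero. rform w (u d)) = 2 * rform w e"
  using rform_cong[OF sum_u, of w] by simp

lemmas sum_simps = rform_sum_a rform_sum_u sum.distrib sum_subtractf sum_distrib_left[symmetric]
  sum_divide_distrib[symmetric] card_F3_plane lin_simps

lemma form_e: "form (a v) e = 1" "d \<noteq> 0 \<Longrightarrow> form (u d) e = 8/5"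
proof -
  have 2: "e = (1/2) *\<^sub>Q (\<Sum>d\<in>F3_nonzero. u d)" by (simp add: sum_u)
  have "(\<Sum>d\<in>F3_nonzero. form (a v) (u d)) = (\<Sum>d\<in>F3_nonzero. 1/4)"
    by (rule sum.cong) (auto simp: form_a_u)
  then show "form (a v) e = 1" by (simp add: 2 card_F3_plane)
  show "d \<noteq> 0 \<Longrightarrow> form (u d) e = 8/5" by (simp add: 2 form_u_u_sum)
qed

definition B :: "'a set" where
  "B = span (range a \<union> u ` F3_nonzero)"

lemma B_induct [consumes 1, case_names zero a u]:
  assumes "x \<in> B" "P 0" "\<And>v c y. y \<in> B \<Longrightarrow> P y \<Longrightarrow> P (c *\<^sub>Q a v + y)"
    "\<And>d c y. y \<in> B \<Longrightarrow> d \<noteq> 0 \<Longrightarrow> P y \<Longrightarrow> P (c *\<^sub>Q u d + y)"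
  shows "P x"
proof -
  have "x \<in> B \<and> P x"
    using assms(1) unfolding B_def
  proof (induction rule: span_induct_alt)
    case base
    then show ?case using assms(2) by (simp add: span_zero)
  next
    case (step c x y)
    then show ?case using assms(3,4)[of y] span_base[of x]
      by (auto simp: B_def intro!: span_add span_scale)
  qed
  then show ?thesis ..
qed

lemma a_in_B: "a v \<in> B" and u_in_B: "d \<noteq> 0 \<Longrightarrow> u d \<in> B"
  by (auto simp: B_def intro: span_base)

lemma B_linear: "x \<in> B \<Longrightarrow> y \<in> B \<Longrightarrow> x + y \<in> B" "x \<in> B \<Longrightarrow> y \<in> B \<Longrightarrow> x - y \<in> B"
   "x \<in> B \<Longrightarrow> c *\<^sub>Q x \<in> B" "0 \<in> B" "(\<And>i. i \<in> I \<Longrightarrow> g i \<in> B) \<Longrightarrow> sum g I \<in> B"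
  by (auto simp: B_def intro: span_add span_diff span_scale span_zero span_sum)

lemma e_in_B: "e \<in> B"
  unfolding e_def by (intro B_linear a_in_B)

lemma prod_u_a: "d \<noteq> 0 \<Longrightarrow> u d \<star> a v =
      (1/9) *\<^sub>Q (2 *\<^sub>Q a v - a (v + d) - a (v - d)) + (5/32) *\<^sub>Q u d"
  using prod_a_u[of d v] prod_commute[of "u d" "a v"] by simp

lemma u_prod_u_sum:
  assumes "k \<noteq> 0"
  shows "(\<Sum>d\<in>F3_nonzero. u d \<star> u k) = 2 *\<^sub>Q u k"
proof -
  note k = assms
  have "(\<Sum>d\<in>F3_nonzero. u d \<star> u k) = u k \<star> u k + u (- k) \<star> u k"
    by (rule sum_nonzero_supported[OF k]) (metis u_prod_u k minus_minus)
  then show ?thesis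
    by (simp add: u_minus u_idem k) (rule vec_eqI, simp)
qed

text \<open>Half the sum of the \<open>u d\<close> is the convenient form of \<open>e\<close>: its
  products with axes stay within single lines, and those with \<open>u k\<close> vanish except in
  the direction of \<open>k\<close>.\<close>

lemma e_prod_generators: "e \<star> a v = a v" "k \<noteq> 0 \<Longrightarrow> e \<star> u k = u k"
proof -
  have e2: "e = (1/2) *\<^sub>Q (\<Sum>d\<in>F3_nonzero. u d)" by (simp add: sum_u)
  have "e \<star> a v = (1/2) *\<^sub>Q (\<Sum>d\<in>F3_nonzero. u d \<star> a v)"
    by (simp add: e2)
  also have "(\<Sum>d\<in>F3_nonzero. u d \<star> a v) =
      (\<Sum>d\<in>F3_nonzero. (1/9) *\<^sub>Q (2 *\<^sub>Q a v - a (v + d) - a (v - d)) + (5/32) *\<^sub>Q u d)"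
    by (rule sum.cong) (auto simp: prod_u_a)
  also have "\<dots> = (1/9) *\<^sub>Q (16 *\<^sub>Q a v - 2 *\<^sub>Q ((45/32) *\<^sub>Q e - a v)) + (5/16) *\<^sub>Q e"
    by (rule vec_eqI) (simp add: sum_simps)
  finally show "e \<star> a v = a v" by (simp add: vec_eqI lin_simps)
  show "k \<noteq> 0 \<Longrightarrow> e \<star> u k = u k" by (simp add: e2 u_prod_u_sum)
qed

lemma e_prod: "x \<in> B \<Longrightarrow> e \<star> x = x"
  by (induction rule: B_induct) (simp_all add: e_prod_generators)

text \<open>For \<open>g = h = id\<close> this is the identity operator on \<open>B\<close> written in the frame of all
  \<open>a v\<close> and \<open>u d\<close>; in general it is the extension of \<open>a v \<mapsto> a (g v)\<close>, \<open>u d \<mapsto> u (h d)\<close>.\<close>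

definition frame_map :: "(3^2 \<Rightarrow> 3^2) \<Rightarrow> (3^2 \<Rightarrow> 3^2) \<Rightarrow> 'a \<Rightarrow> 'a" where
  "frame_map g h x =
     (256/243) *\<^sub>Q (\<Sum>v\<in>UNIV. form x (a v) *\<^sub>Q a (g v)) +
     (5/16) *\<^sub>Q (\<Sum>d\<in>F3_nonzero. form x (u d) *\<^sub>Q u (h d)) -
     (25/108) *\<^sub>Q (form x e *\<^sub>Q e)"

lemma frame_map_linear:
  "frame_map g h (x + y) = frame_map g h x + frame_map g h y"
  "frame_map g h (c *\<^sub>Q x) = c *\<^sub>Q frame_map g h x"
  by (rule vec_eqI; simp add: frame_map_def lin_simps of_rat_add of_rat_mult algebra_simps sum.distrib sum_distrib_left)+

text \<open>Here the weights of the frame are determined. The Gram matrix of the axes is 13/256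
  everywhere plus 243/256 on the diagonal, whence 256/243; the norm 8/5, met at \<open>d\<close> and
  \<open>- d\<close>, gives 5/16. All other terms sum to multiples of \<open>e\<close>, and the
  single correction 25/108 cancels them for axes and \<open>u k\<close> alike. Bijections do not
  change the sums.\<close>

lemma frame_map_generators:
  assumes g: "bij g" and h: "bij_betw h F3_nonzero F3_nonzero"
    and h_minus: "\<And>d. h (- d) = - h d"
  shows "frame_map g h (a v) = a (g v)" "k \<noteq> 0 \<Longrightarrow> frame_map g h (u k) = u (h k)"
proof -
  have sa: "(\<Sum>v\<in>UNIV. a (g v)) = (45/32) *\<^sub>Q e"
    using sum.reindex_bij_betw[OF g, of a] sum_a by simp
  have su: "(\<Sum>d\<in>F3_nonzero. u (h d)) = 2 *\<^sub>Q e"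
    using sum.reindex_bij_betw[OF h, of u] sum_u by simp
  have "(\<Sum>w\<in>UNIV. form (a v) (a w) *\<^sub>Q a (g w)) =
    (\<Sum>w\<in>UNIV. (13/256) *\<^sub>Q a (g w) + (if w = v then (243/256) *\<^sub>Q a (g w) else 0))"
    by (rule sum.cong) (auto simp: form_a_a_if scale_left_distrib)
  also have "\<dots> = (13/256) *\<^sub>Q ((45/32) *\<^sub>Q e) + (243/256) *\<^sub>Q a (g v)"
    by (simp add: sum.distrib scale_sum_right[symmetric] sa del: scale_scale)
  finally have 1: "(\<Sum>w\<in>UNIV. form (a v) (a w) *\<^sub>Q a (g w)) = (13/256) *\<^sub>Q ((45/32) *\<^sub>Q e) + (243/256) *\<^sub>Q a (g v)" .
  have "(\<Sum>d\<in>F3_nonzero. form (a v) (u d) *\<^sub>Q u (h d)) = (\<Sum>d\<in>F3_nonzero. (1/4) *\<^sub>Q u (h d))"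
    by (rule sum.cong) (auto simp: form_a_u)
  also have "\<dots> = (1/4) *\<^sub>Q (2 *\<^sub>Q e)"
    by (simp add: scale_sum_right[symmetric] su del: scale_scale)
  finally show "frame_map g h (a v) = a (g v)"
    unfolding frame_map_def 1 by (simp only: form_e) (rule vec_eqI, simp add: lin_simps)
  assume k: "k \<noteq> 0"
  have "(\<Sum>w\<in>UNIV. form (u k) (a w) *\<^sub>Q a (g w)) = (\<Sum>w\<in>UNIV. (1/4) *\<^sub>Q a (g w))"
    by (rule sum.cong) (auto simp: form_u_a k)
  also have "\<dots> = (1/4) *\<^sub>Q ((45/32) *\<^sub>Q e)"
    by (simp add: scale_sum_right[symmetric] sa del: scale_scale)
  finally show "frame_map g h (u k) = u (h k)"
    using k by (simp only: frame_map_def form_u_u_sum(1)[OF k] form_e h_minus u_minus)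
      (rule vec_eqI, simp add: lin_simps form_e)
qed

lemma frame_map_id: "x \<in> B \<Longrightarrow> frame_map (\<lambda>v. v) (\<lambda>d. d) x = x"
proof (induction rule: B_induct)
  case zero
  show ?case by (simp add: frame_map_def)
qed (simp_all add: frame_map_linear frame_map_generators[OF bij_id bij_betw_id, unfolded id_def])

text \<open>The sum of squares of multiplications over the frame of \<open>frame_map\<close>, which
  replaces a pair of dual bases.\<close>

definition casimir :: "'a \<Rightarrow> 'a" where
  "casimir x =
     (256/243) *\<^sub>Q (\<Sum>v\<in>UNIV. a v \<star> (a v \<star> x)) +
     (5/16) *\<^sub>Q (\<Sum>d\<in>F3_nonzero. u d \<star> (u d \<star> x)) -
     (25/108) *\<^sub>Q (e \<star> (e \<star> x))"

lemma casimir_linear: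
  "casimir (x + y) = casimir x + casimir y"
  "casimir (x - y) = casimir x - casimir y"
  "casimir (c *\<^sub>Q x) = c *\<^sub>Q casimir x"
  "casimir 0 = 0"
  by (simp add: casimir_def; rule vec_eqI;
      simp add: of_rat_mult lin_simps algebra_simps sum.distrib sum_subtractf sum_distrib_left del: scale_scale)+

lemma casimir_u:
  assumes "k \<noteq> 0"
  shows "\<exists>c. casimir (u k) = (55/72) *\<^sub>Q u k + c *\<^sub>Q e"
proof -
  have 1: "a v \<star> (a v \<star> u k) = (35/144) *\<^sub>Q a v - (1/36) *\<^sub>Q (a (v + k) + a (v - k)) + (5/128) *\<^sub>Q u k" for v
    by (rule vec_eqI) (simp add: assms prod_a_u prod_a_a prod_a_a_minus a_idem lin_simps)
  have "(\<Sum>d\<in>F3_nonzero. u d \<star> (u d \<star> u k)) = u k \<star> (u k \<star> u k) + u (- k) \<star> (u (- k) \<star> u k)"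
    by (rule sum_nonzero_supported[OF assms]) (metis prod_right_linear_simps(4) u_prod_u assms minus_minus)
  then have 2: "(\<Sum>d\<in>F3_nonzero. u d \<star> (u d \<star> u k)) = 2 *\<^sub>Q u k"
    by (simp add: assms u_minus u_idem) (rule vec_eqI, simp)
  have "casimir (u k) = (55/72) *\<^sub>Q u k + (5/18) *\<^sub>Q e"
    unfolding casimir_def 1 2
    by (rule vec_eqI) (simp add: sum_simps assms e_prod_generators)
  then show ?thesis ..
qed

text \<open>Each \<open>a w \<star> (a w \<star> a v)\<close> lies in the 3A algebra of the line
  through \<open>v\<close> and \<open>w\<close>; summed over all lines through \<open>v\<close>,
  only \<open>a v\<close> and \<open>e\<close> survive.\<close>

lemma casimir_a: "\<exists>c. casimir (a v) = (115/108) *\<^sub>Q a v + c *\<^sub>Q e"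
proof -
  have 1: "a (v + d) \<star> (a (v + d) \<star> a v) = (55/1024) *\<^sub>Q a (v + d) + (25/2048) *\<^sub>Q a v
      + (23/2048) *\<^sub>Q a (v - d) - (135/8192) *\<^sub>Q u d" if "d \<noteq> 0" for d
    using prod_a_a_minus[OF that, of "v + d"] prod_a_a[OF that, of "v + d"]
    by (intro vec_eqI) (simp add: that F3_vec_add_add prod_a_u a_idem lin_simps)
  have "(\<Sum>w\<in>UNIV. a w \<star> (a w \<star> a v)) - a v = (\<Sum>d\<in>F3_nonzero. a (v + d) \<star> (a (v + d) \<star> a v))"
    using sum_nonzero_shift(1)[of "\<lambda>w. a w \<star> (a w \<star> a v)" v] by (simp add: a_idem)
  also have "\<dots> = (\<Sum>d\<in>F3_nonzero. (55/1024) *\<^sub>Q a (v + d) + (25/2048) *\<^sub>Q a v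
      + (23/2048) *\<^sub>Q a (v - d) - (135/8192) *\<^sub>Q u d)"
    by (rule sum.cong) (simp_all add: 1)
  finally have A: "(\<Sum>w\<in>UNIV. a w \<star> (a w \<star> a v)) = a v + (\<Sum>d\<in>F3_nonzero. (55/1024) *\<^sub>Q a (v + d) + (25/2048) *\<^sub>Q a v
      + (23/2048) *\<^sub>Q a (v - d) - (135/8192) *\<^sub>Q u d)"
    by (simp add: algebra_simps)
  have 2: "u d \<star> (u d \<star> a v) = (1/27) *\<^sub>Q (2 *\<^sub>Q a v - a (v + d) - a (v - d)) + (5/32) *\<^sub>Q u d" if "d \<noteq> 0" for d
    by (rule vec_eqI) (simp add: prod_u_a that F3_vec_add_add F3_vec_diff_diff u_idem lin_simps)
  have U: "(\<Sum>d\<in>F3_nonzero. u d \<star> (u d \<star> a v)) =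
    (\<Sum>d\<in>F3_nonzero. (1/27) *\<^sub>Q (2 *\<^sub>Q a v - a (v + d) - a (v - d)) + (5/32) *\<^sub>Q u d)"
    by (rule sum.cong) (simp_all add: 2)
  have "casimir (a v) = (115/108) *\<^sub>Q a v + (875/6912) *\<^sub>Q e"
    unfolding casimir_def A U
    by (rule vec_eqI) (simp add: sum_simps e_prod_generators)
  then show ?thesis ..
qed

end

text \<open>Two independent directions \<open>k\<close>, \<open>m\<close> and their sum and
  difference represent all four directions, so the lines through \<open>v\<close> exhaust the plane.
  Distinctness gives nine points, and counting gives the rest.\<close>

lemma F3_plane_enum:
  fixes k m v :: "3^2"
  assumes k: "k \<noteq> 0" and m: "m \<noteq> 0" and km: "m \<noteq> k" "m \<noteq> - k" and p: "p = k + m" and q: "q = k - m"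
  shows "distinct [v, v + k, v - k, v + m, v - m, v + p, v - p, v + q, v - q]" (is "distinct ?l")
    and "set [v, v + k, v - k, v + m, v - m, v + p, v - p, v + q, v - q] = UNIV"
proof -
  have dd: "k + k = - k" "m + m = - m" by (rule F3_vec_double)+
  have mk: "k \<noteq> m" "k \<noteq> - m" using km by auto
  have nz: "p \<noteq> 0" "q \<noteq> 0" using km p q by (auto simp: add_eq_0_iff)
  have pk: "p \<noteq> k" "p \<noteq> - k" "p \<noteq> m" "p \<noteq> - m" "q \<noteq> k" "q \<noteq> - k" "q \<noteq> m" "q \<noteq> - m"
    "q \<noteq> p" "q \<noteq> - p"
  proof -
    show "p \<noteq> k" "p \<noteq> m" using k m p by auto
    show "q \<noteq> k" using m q by auto
    have "k = 0" if "k - m = - m" using that by (simp add: algebra_simps)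
    then show "q \<noteq> - m" using k q by auto
    have "m = - k - k" if "k + m = - k" using that add_implies_diff[of m k "- k"] by (simp add: add.commute)
    then show "p \<noteq> - k" using km p by (auto simp: F3_vec_double_minus)
    have "k = - m - m" if "k + m = - m" using that add_implies_diff[of k m "- m"] by simp
    then show "p \<noteq> - m" using km p by (auto simp: F3_vec_double_minus)
    have "k + k = m" if "k - m = - k" using that by (simp add: algebra_simps)
    then show "q \<noteq> - k" using km q dd by auto
    have "k = m + m" if "k - m = m" using that by (simp add: algebra_simps)
    then show "q \<noteq> m" using mk q dd by auto
    have "m + m = 0" if "k - m = k + m" using that by (simp add: algebra_simps)
    then show "q \<noteq> p" using m p q dd by auto
    have "k = - k" if "k - m = - (k + m)"
      using that by (simp only: minus_add_distrib diff_conv_add_uminus add_right_cancel)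
    then show "q \<noteq> - p" using F3_vec_distinct(3)[OF k, of 0] p q by auto
  qed
  note F = F3_directions_distinct[OF k m km, of v] F3_directions_distinct[OF k nz(1) pk(1,2), of v]
    F3_directions_distinct[OF k nz(2) pk(5,6), of v] F3_directions_distinct[OF m nz(1) pk(3,4), of v]
    F3_directions_distinct[OF m nz(2) pk(7,8), of v] F3_directions_distinct[OF nz pk(9,10), of v]
    F3_vec_distinct[OF k, of v] F3_vec_distinct[OF m, of v] F3_vec_distinct[OF nz(1), of v] F3_vec_distinct[OF nz(2), of v]
  show d: "distinct ?l"
    by (simp only: distinct.simps list.set insert_iff empty_iff F F[symmetric] simp_thms)
  show "set ?l = UNIV"
    by (rule card_subset_eq) (use distinct_card[OF d] in \<open>simp_all add: card_F3_plane\<close>)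
qed

context frobenius_algebra
begin

text \<open>The frame version of independence of the basis: one factor \<open>q k\<close> is
  expanded in the \<open>p l\<close>, the symmetry of the form transposes the coefficients, and the
  inner sum over \<open>k\<close> collapses to \<open>p l\<close>.\<close>

lemma frame_casimir_unique:
  fixes p q :: "'i \<Rightarrow> 'a"
  assumes P: "\<And>k. k \<in> I \<Longrightarrow> q k = (\<Sum>l\<in>I. c l *\<^sub>Q form (q k) (p l) *\<^sub>Q p l)"
    and Q: "\<And>l. l \<in> I \<Longrightarrow> p l = (\<Sum>k\<in>I. c k *\<^sub>Q form (p l) (q k) *\<^sub>Q q k)"
  shows "(\<Sum>k\<in>I. c k *\<^sub>Q (q k \<star> (q k \<star> x))) = (\<Sum>l\<in>I. c l *\<^sub>Q (p l \<star> (p l \<star> x)))"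
proof -
  have "(\<Sum>k\<in>I. c k *\<^sub>Q (q k \<star> (q k \<star> x))) =
    (\<Sum>k\<in>I. c k *\<^sub>Q ((\<Sum>l\<in>I. c l *\<^sub>Q form (q k) (p l) *\<^sub>Q p l) \<star> (q k \<star> x)))"
    using P by (intro sum.cong) auto
  also have "\<dots> = (\<Sum>k\<in>I. \<Sum>l\<in>I. c l *\<^sub>Q (p l \<star> ((c k *\<^sub>Q form (p l) (q k) *\<^sub>Q q k) \<star> x)))"
    by (intro sum.cong) (simp_all add: scale_sum_right mult_ac form_sym)
  also have "\<dots> = (\<Sum>l\<in>I. c l *\<^sub>Q (p l \<star> ((\<Sum>k\<in>I. c k *\<^sub>Q form (p l) (q k) *\<^sub>Q q k) \<star> x)))"
    by (subst sum.swap) (simp add: scale_sum_right del: scale_scale)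
  also have "\<dots> = (\<Sum>l\<in>I. c l *\<^sub>Q (p l \<star> (p l \<star> x)))"
    using Q by (intro sum.cong) auto
  finally show ?thesis .
qed

end

context affine_plane_algebra
begin

text \<open>Axes, \<open>u d\<close> and \<open>e\<close> are packed into one indexed family, the
  shape that \<open>frame_casimir_unique\<close> expects.\<close>

definition frame_index :: "(3^2 + 3^2 + unit) set" where
  "frame_index = UNIV <+> (F3_nonzero <+> {()})"

definition frame_weight :: "3^2 + 3^2 + unit \<Rightarrow> rat" where
  "frame_weight = case_sum (\<lambda>_. 256/243) (case_sum (\<lambda>_. 5/16) (\<lambda>_. -25/108))"

definition frame :: "3^2 + 3^2 + unit \<Rightarrow> 'a" where
  "frame = case_sum a (case_sum u (\<lambda>_. e))"

lemma frame_in_B: "i \<in> frame_index \<Longrightarrow> frame i \<in> B"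
  unfolding frame_index_def frame_def
  by (elim PlusE) (simp_all add: a_in_B u_in_B e_in_B)

lemma frame_expansion:
  assumes "x \<in> B"
  shows "x = (\<Sum>i\<in>frame_index. frame_weight i *\<^sub>Q form x (frame i) *\<^sub>Q frame i)"
proof -
  have "x = frame_map (\<lambda>v. v) (\<lambda>d. d) x" using frame_map_id[OF assms] by simp
  also have "\<dots> = (\<Sum>i\<in>frame_index. frame_weight i *\<^sub>Q form x (frame i) *\<^sub>Q frame i)"
    by (simp add: frame_index_def frame_weight_def frame_def sum.Plus o_def frame_map_def
        scale_sum_right del: scale_scale)
  finally show ?thesis .
qed

lemma casimir_frame:
  "casimir x = (\<Sum>i\<in>frame_index. frame_weight i *\<^sub>Q (frame i \<star> (frame i \<star> x)))"
  by (simp add: frame_index_def frame_weight_def frame_def sum.Plus o_def casimir_def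
        scale_sum_right del: scale_scale)

abbreviation U :: "'a set" where
  "U \<equiv> span (u ` F3_nonzero)"

lemma U_subset_B: "U \<subseteq> B"
  by (simp add: B_def span_mono)

lemma e_in_U: "e \<in> U"
proof -
  have "(\<Sum>d\<in>F3_nonzero. u d) \<in> U" by (intro span_sum span_base) auto
  then have "(1/2) *\<^sub>Q (\<Sum>d\<in>F3_nonzero. u d) \<in> U" by (rule span_scale)
  then show ?thesis by (simp add: sum_u)
qed

lemma B_decompose:
  assumes "x \<in> B"
  obtains p q where "p \<in> span (range a)" "q \<in> U" "x = p + q"
  using assms unfolding B_def span_Un by blast

lemma casimir_span_a:
  assumes "p \<in> span (range a)"
  shows "\<exists>c. casimir p = (115/108) *\<^sub>Q p + c *\<^sub>Q e"
  using assms
proof (induction rule: span_induct_alt)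
  case base
  then show ?case by (auto simp: casimir_linear intro: exI[of _ 0])
next
  case (step c x y)
  then obtain d where d: "casimir y = (115/108) *\<^sub>Q y + d *\<^sub>Q e" by blast
  obtain d' where d': "casimir x = (115/108) *\<^sub>Q x + d' *\<^sub>Q e" using step casimir_a by blast
  show ?case
    by (rule exI[of _ "c * d' + d"], rule vec_eqI)
       (simp add: casimir_linear d d' algebra_simps of_rat_add of_rat_mult)
qed

lemma casimir_U:
  assumes "p \<in> U"
  shows "\<exists>c. casimir p = (55/72) *\<^sub>Q p + c *\<^sub>Q e"
  using assms
proof (induction rule: span_induct_alt)
  case base
  then show ?case by (auto simp: casimir_linear intro: exI[of _ 0])
next
  case (step c x y)
  then obtain d where d: "casimir y = (55/72) *\<^sub>Q y + d *\<^sub>Q e" by blast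
  obtain d' where d': "casimir x = (55/72) *\<^sub>Q x + d' *\<^sub>Q e" using step casimir_u by blast
  show ?case
    by (rule exI[of _ "c * d' + d"], rule vec_eqI)
       (simp add: casimir_linear d d' algebra_simps of_rat_add of_rat_mult)
qed

text \<open>Modulo \<open>e\<close> the operator has different eigenvalues on the two summands, so
  the part in the span of the axes must be a multiple of \<open>e\<close>, which lies in
  \<open>U\<close>.\<close>

lemma casimir_eigenvector_in_U:
  assumes "x \<in> B" and x: "casimir x = (55/72) *\<^sub>Q x + c *\<^sub>Q e"
  shows "x \<in> U"
proof -
  obtain p q where pq: "p \<in> span (range a)" "q \<in> U" "x = p + q"
    using B_decompose[OF assms(1)] by blast
  obtain d where d: "casimir p = (115/108) *\<^sub>Q p + d *\<^sub>Q e" using casimir_span_a pq by blast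
  obtain d' where d': "casimir q = (55/72) *\<^sub>Q q + d' *\<^sub>Q e" using casimir_U pq by blast
  have "casimir p + casimir q - casimir x = 0" by (simp add: pq casimir_linear)
  then have *: "(115/108) *\<^sub>Q p + d *\<^sub>Q e + ((55/72) *\<^sub>Q q + d' *\<^sub>Q e) - ((55/72) *\<^sub>Q (p + q) + c *\<^sub>Q e) = 0"
    using d d' x unfolding pq(3) by (simp only:)
  \<comment> \<open>The factor is the inverse of 115/108 - 55/72 = 65/216.\<close>
  have "p = ((216/65) * (c - d - d')) *\<^sub>Q e"
  proof (rule vec_eqI)
    fix w
    show "rform w p = rform w (((216/65) * (c - d - d')) *\<^sub>Q e)"
      using rform_cong[OF *, of w]
      by (simp add: of_rat_mult of_rat_diff lin_simps) (simp add: algebra_simps)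
  qed
  then show ?thesis using pq e_in_U by (simp add: span_add span_scale)
qed

text \<open>\<open>U\<close> is a product of copies of the rationals with orthogonal idempotents
  \<open>u d\<close> of norm 8/5, so \<open>5/8 * form x (u d)\<close> is the coordinate of
  \<open>x\<close> at \<open>u d\<close>.\<close>

lemma U_prod_u:
  assumes "x \<in> U" "d \<noteq> 0"
  shows "x \<star> u d = (5/8 * form x (u d)) *\<^sub>Q u d"
  using assms(1)
proof (induction rule: span_induct_alt)
  case base
  then show ?case by simp
next
  case (step c x y)
  then obtain k where k: "x = u k" "k \<noteq> 0" by auto
  have "u k \<star> u d = (5/8 * form (u k) (u d)) *\<^sub>Q u d"
  proof (cases "d = k \<or> d = - k")
    case True
    then have "u d = u k" by (auto simp: u_minus)
    then show ?thesis using k by (simp add: u_idem form_u_self)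
  next
    case False
    then show ?thesis using u_prod_u[of k d] form_u_u[of k d] k assms(2) by simp
  qed
  then have "(c *\<^sub>Q x + y) \<star> u d = c *\<^sub>Q ((5/8 * form x (u d)) *\<^sub>Q u d) + (5/8 * form y (u d)) *\<^sub>Q u d"
    using step k by simp
  also have "\<dots> = (5/8 * form (c *\<^sub>Q x + y) (u d)) *\<^sub>Q u d"
    by (simp add: algebra_simps)
  finally show ?case .
qed

lemma U_eqI:
  assumes "x \<in> U" "y \<in> U" "\<And>d. d \<noteq> 0 \<Longrightarrow> form x (u d) = form y (u d)"
  shows "x = y"
proof -
  have "(\<Sum>d\<in>F3_nonzero. u d \<star> x) = (\<Sum>d\<in>F3_nonzero. u d \<star> y)"
    using assms by (intro sum.cong refl) (simp add: U_prod_u prod_commute[of "u _" x] prod_commute[of "u _" y])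
  then have "e \<star> x = e \<star> y"
    unfolding prod_left_linear_simps(6)[symmetric] sum_u by simp
  moreover have "x \<in> B" "y \<in> B" using U_subset_B assms by blast+
  ultimately show ?thesis by (simp add: e_prod)
qed

text \<open>Coordinates of an idempotent are 0 or 1, and the pairing with \<open>e\<close> is 8/5
  times the number of directions with coordinate 1. The sum of \<open>t\<close> below is 2 because
  each direction is counted twice.\<close>

lemma U_idempotent:
  assumes y: "y \<in> U" "y \<star> y = y" and ye: "form y e = 8/5"
  obtains d where "d \<noteq> 0" "y = u d"
proof -
  define t where "t d = 5/8 * form y (u d)" for d
  have t01: "t d = 0 \<or> t d = 1" if "d \<noteq> 0" for d
  proof -
    have "form y (u d) = form y (y \<star> u d)" using form_frobenius[of y y "u d"] y by simp
    also have "\<dots> = t d * form y (u d)" using that by (simp add: U_prod_u y t_def)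
    finally show ?thesis by (auto simp: t_def)
  qed
  have ts: "(\<Sum>d\<in>F3_nonzero. t d) = 2"
  proof -
    have "(\<Sum>d\<in>F3_nonzero. t d) = 5/8 * form y (\<Sum>d\<in>F3_nonzero. u d)"
      by (simp add: t_def sum_distrib_left)
    then show ?thesis by (simp add: sum_u ye)
  qed
  then obtain d where d: "d \<noteq> 0" "t d \<noteq> 0"
    using sum.neutral[of F3_nonzero t] by fastforce
  then have td: "t d = 1" "t (- d) = 1" using t01[of d] by (auto simp: t_def u_minus)
  have dd: "d \<noteq> - d" using F3_vec_distinct(3)[OF d(1), of 0] by simp
  have "(\<Sum>k\<in>F3_nonzero. t k) = (\<Sum>k\<in>F3_nonzero - {d, - d}. t k) + (\<Sum>k\<in>{d, - d}. t k)"
    by (rule sum.subset_diff) (use d in auto)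
  then have "(\<Sum>k\<in>F3_nonzero - {d, - d}. t k) = 0" using ts td dd by simp
  then have z: "t k = 0" if "k \<in> F3_nonzero - {d, - d}" for k
  proof -
    have "\<forall>k\<in>F3_nonzero - {d, - d}. 0 \<le> t k" using t01 by force
    then have "sum t (F3_nonzero - {d, - d}) = 0 \<longleftrightarrow> (\<forall>k\<in>F3_nonzero - {d, - d}. t k = 0)"
      by (intro sum_nonneg_eq_0_iff) auto
    then show ?thesis using that \<open>sum t (F3_nonzero - {d, - d}) = 0\<close> by blast
  qed
  have "y = u d"
  proof (rule U_eqI)
    show "u d \<in> U" using d by (auto intro: span_base)
    fix k :: "3^2" assume k: "k \<noteq> 0"
    show "form y (u k) = form (u d) (u k)"
    proof (cases "k = d \<or> k = - d")
      case True
      then show ?thesis using td d by (auto simp: u_minus form_u_self t_def)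
    next
      case False
      then show ?thesis using z[of k] k form_u_u[of d k] d by (auto simp: t_def)
    qed
  qed (rule y)
  then show ?thesis using that d by blast
qed

end

section \<open>Line sums and their products\<close>

lemma F3_plane_sum:
  fixes k m v :: "3^2" and g :: "3^2 \<Rightarrow> 'b::comm_monoid_add"
  assumes k: "k \<noteq> 0" and m: "m \<noteq> 0" and km: "m \<noteq> k" "m \<noteq> - k" and p: "p = k + m" and q: "q = k - m"
  shows "(\<Sum>w\<in>UNIV. g w) = g v + g (v + k) + g (v - k) + g (v + m) + g (v - m) +
     g (v + p) + g (v - p) + g (v + q) + g (v - q)"
proof -
  have "(\<Sum>w\<in>UNIV. g w) = sum g (set [v, v + k, v - k, v + m, v - m, v + p, v - p, v + q, v - q])"
    by (simp only: F3_plane_enum(2)[OF assms])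
  also have "\<dots> = sum_list (map g [v, v + k, v - k, v + m, v - m, v + p, v - p, v + q, v - q])"
    by (rule sum.distinct_set_conv_list) (rule F3_plane_enum(1)[OF assms])
  finally show ?thesis by (simp add: add.assoc)
qed

lemma F3_plane_sum_nonzero:
  fixes k m :: "3^2" and g :: "3^2 \<Rightarrow> 'b::ab_group_add"
  assumes k: "k \<noteq> 0" and m: "m \<noteq> 0" and km: "m \<noteq> k" "m \<noteq> - k" and p: "p = k + m" and q: "q = k - m"
  shows "(\<Sum>d\<in>F3_nonzero. g d) = g k + g (- k) + g m + g (- m) +
     g p + g (- p) + g q + g (- q)"
  using sum_nonzero_shift(1)[of g 0] F3_plane_sum[OF assms, of g 0] by simp

lemma F3_vec_independent_exists:
  fixes k :: "3^2"
  obtains m where "m \<noteq> 0" "m \<noteq> k" "m \<noteq> - k"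
proof -
  have "card {0, k, - k} \<le> 3" by (simp add: card_insert_le_m1)
  then have "{0, k, - k} \<noteq> UNIV" using card_F3_plane(1) by force
  then show ?thesis using that by blast
qed

context affine_plane_algebra
begin

abbreviation S :: "3^2 \<Rightarrow> 3^2 \<Rightarrow> 'a" where
  "S v k \<equiv> a v + a (v + k) + a (v - k)"

text \<open>By \<open>u_prod_S\<close>, subtracting this multiple of \<open>u k\<close> makes the
  vector annihilated by \<open>u k\<close>; by \<open>z_prod_z\<close> it is then 21/16 times an
  idempotent.\<close>

abbreviation z :: "3^2 \<Rightarrow> 3^2 \<Rightarrow> 'a" where
  "z v k \<equiv> S v k - (15/32) *\<^sub>Q u k"

lemma S_shift: "S (v + k) k = S v k" "S (v - k) k = S v k"
  by (simp_all add: F3_vec_add_add F3_vec_diff_diff)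

lemma S_in_B: "S v k \<in> B"
  by (intro B_linear a_in_B)

lemma prod_line:
  assumes "k \<noteq> 0"
  shows "a (v + k) \<star> a (v - k) = line_product (v + k) (v - k) v k"
  using prod_a_a[OF assms, of "v + k"] by (simp add: F3_vec_add_add)

lemma u_prod_S: "k \<noteq> 0 \<Longrightarrow> u k \<star> S v k = (15/32) *\<^sub>Q u k"
  by (rule vec_eqI) (simp add: prod_u_a F3_vec_add_add F3_vec_diff_diff lin_simps)

lemma S_prod_S: "k \<noteq> 0 \<Longrightarrow> S v k \<star> S v k = (21/16) *\<^sub>Q S v k - (405/1024) *\<^sub>Q u k"
  by (rule vec_eqI)
     (simp add: prod_commute[of "a (v + k)" "a v"] prod_commute[of "a (v - k)" "a v"]
       prod_commute[of "a (v - k)" "a (v + k)"] prod_line a_idem prod_a_a prod_a_a_minus lin_simps)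

lemma z_prod_z:
  assumes "k \<noteq> 0"
  shows "z v k \<star> z v k = (21/16) *\<^sub>Q z v k"
proof -
  have "z v k \<star> z v k = S v k \<star> S v k - (15/16) *\<^sub>Q (u k \<star> S v k) + (225/1024) *\<^sub>Q (u k \<star> u k)"
    by (rule vec_eqI) (simp add: prod_commute[of "a _" "u k"] lin_simps)
  then show ?thesis
    unfolding S_prod_S[OF assms] u_prod_S[OF assms] u_idem[OF assms] by (auto intro: vec_eqI simp: lin_simps)
qed

lemma form_S_e: "form (S v k) e = 3" and form_S_u: "d \<noteq> 0 \<Longrightarrow> form (S v k) (u d) = 3/4"
  by (simp_all add: form_e form_a_u)

lemma form_z_e: "k \<noteq> 0 \<Longrightarrow> form (z v k) e = 9/4"
  by (simp add: form_e)

context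
  fixes k m p q :: "3^2"
  assumes k: "k \<noteq> 0" and m: "m \<noteq> 0" and km: "m \<noteq> k" "m \<noteq> - k" and p: "p = k + m" and q: "q = k - m"
begin

lemma e_eq_sum_u: "e = u k + u m + u p + u q"
proof (rule vec_eqI)
  fix w
  have "2 *\<^sub>Q e = u k + u k + u m + u m + u p + u p + u q + u q"
    using F3_plane_sum_nonzero[OF k m km p q, of u] by (simp only: sum_u u_minus)
  from rform_cong[OF this, of w] show "rform w e = rform w (u k + u m + u p + u q)"
    by simp
qed

lemma e_eq_sum_S: "e = (32/45) *\<^sub>Q (S v k + S (v + m) k + S (v - m) k)"
proof -
  have pts: "v + m + k = v + p" "v + m - k = v - q" "v - m + k = v + q" "v - m - k = v - p"
    by (simp_all add: p q)
  show ?thesis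
    unfolding e_def F3_plane_sum[OF k m km p q, of a v] pts by (simp add: ac_simps)
qed

lemma products_of_parallels:
  "a v \<star> a (v + m) = line_product v (v + m) (v - m) m"
  "a v \<star> a (v + p) = line_product v (v + p) (v - p) p"
  "a v \<star> a (v - q) = line_product v (v - q) (v + q) q"
  "a (v + k) \<star> a (v + m) = line_product (v + k) (v + m) (v - p) q"
  "a (v + k) \<star> a (v + p) = line_product (v + k) (v + p) (v + q) m"
  "a (v + k) \<star> a (v - q) = line_product (v + k) (v - q) (v - m) p"
  "a (v - k) \<star> a (v + m) = line_product (v - k) (v + m) (v + q) p"
  "a (v - k) \<star> a (v + p) = line_product (v - k) (v + p) (v - m) q"
  "a (v - k) \<star> a (v - q) = line_product (v - k) (v - q) (v - p) m"
  "a (v + k) \<star> a (v - m) = line_product (v + k) (v - m) (v - q) p"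
  "a (v - k) \<star> a (v - m) = line_product (v - k) (v - m) (v + p) q"
  by (rule prod_a_a_third;
      use F3_plane_enum(1)[OF k m km p q, of v] in
        \<open>simp add: p q algebra_simps F3_vec_double F3_vec_add_cancel; fail\<close>)+

text \<open>Among the nine products of axes on two parallel lines, each of the three other
  directions occurs three times, so their vectors enter only through \<open>u m + u p + u q\<close>,
  that is \<open>e - u k\<close>. As \<open>e\<close> is also a combination of three parallel line
  sums, the product stays in the span of the \<open>z\<close>.\<close>

lemma z_prod_z_parallel:
  "z v k \<star> z (v + m) k = (3/64) *\<^sub>Q (z v k + z (v + m) k - z (v - m) k)"
proof -
  have pts: "v + m + k = v + p" "v + m - k = v - q" "v - m + k = v + q" "v - m - k = v - p"
    by (simp_all add: p q)
  have "z v k \<star> z (v + m) k = S v k \<star> S (v + m) k - (15/32) *\<^sub>Q (u k \<star> S v k + u k \<star> S (v + m) k) + (225/1024) *\<^sub>Q (u k \<star> u k)"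
    by (rule vec_eqI) (simp add: prod_commute[of "a _" "u k"] lin_simps)
  also have "S v k \<star> S (v + m) k = (3/32) *\<^sub>Q (2 *\<^sub>Q S v k + 2 *\<^sub>Q S (v + m) k + S (v - m) k) - (405/2048) *\<^sub>Q (u m + u p + u q)"
    unfolding pts by (rule vec_eqI) (simp add: products_of_parallels lin_simps)
  also have "u m + u p + u q = e - u k" by (simp add: e_eq_sum_u)
  finally show ?thesis
    unfolding u_prod_S[OF k] u_idem[OF k] e_eq_sum_S[of v] by (auto intro: vec_eqI simp: lin_simps)
qed

lemma S_prod_S_crossing:
  "S v k \<star> S v m = (27/32) *\<^sub>Q a v + (3/16) *\<^sub>Q (S v k + S v m) - (45/512) *\<^sub>Q e"
proof -
  have T: "e = (32/45) *\<^sub>Q (a v + a (v + k) + a (v - k) + a (v + m) + a (v - m) + a (v + p) + a (v - p) + a (v + q) + a (v - q))"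
    unfolding e_def F3_plane_sum[OF k m km p q, of a v] ..
  \<comment> \<open>In the nine products every direction occurs twice, which produces the sum of all
    four \<open>u\<close>. The four products not involving \<open>a v\<close> have the points off
    the two lines as third points, which completes the sum over the plane.\<close>
  have "S v k \<star> S v m = (27/32) *\<^sub>Q a v + (3/16) *\<^sub>Q (S v k + S v m) + (1/32) *\<^sub>Q (a v + a (v + k) + a (v - k) + a (v + m) + a (v - m) + a (v + p) + a (v - p) + a (v + q) + a (v - q))
    - (135/1024) *\<^sub>Q (u k + u m + u p + u q)"
    by (rule vec_eqI) (simp add: products_of_parallels prod_a_a_minus[OF m] prod_commute[of "a (v + k)" "a v"]
     prod_commute[of "a (v - k)" "a v"] prod_a_a[OF k] prod_a_a_minus[OF k] a_idem lin_simps)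
  also have "u k + u m + u p + u q = e" by (simp add: e_eq_sum_u)
  finally show ?thesis unfolding T by (auto intro: vec_eqI simp: lin_simps)
qed

end
end

section \<open>Automorphisms\<close>

context affine_plane_algebra
begin

lemma form_prod_e: "x \<in> B \<Longrightarrow> y \<in> B \<Longrightarrow> form (x \<star> y) e = form x y"
  using e_prod[of y] by (simp add: form_frobenius prod_commute[of y e])

lemma B_prod: "x \<in> B \<Longrightarrow> y \<in> B \<Longrightarrow> x \<star> y \<in> B"
  unfolding B_def
proof (rule span_closed_under_prod, goal_cases)
  case (1 x y)
  have aa: "a v \<star> a w \<in> B" for v w
  proof (cases "v = w")
    case False
    then show ?thesis using prod_a_a[of "w - v" v] by (simp add: B_linear a_in_B u_in_B)
  qed (simp add: a_idem a_in_B)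
  have au: "a v \<star> u d \<in> B" if "d \<noteq> 0" for v d
    using that by (simp add: prod_a_u B_linear a_in_B u_in_B)
  have uu: "u k \<star> u d \<in> B" if "k \<noteq> 0" "d \<noteq> 0" for k d
    using u_prod_u[of k d] that u_idem u_minus by (cases "d = k \<or> d = - k") (auto simp: B_linear u_in_B)
  have ua: "u d \<star> a v \<in> B" if "d \<noteq> 0" for v d
    using au[OF that, of v] by (simp add: prod_commute)
  have "x \<star> y \<in> B"
  proof (cases "x \<in> range a")
    case True
    then obtain v where x: "x = a v" by blast
    show ?thesis
    proof (cases "y \<in> range a")
      case True
      then show ?thesis using aa x by blast
    next
      case False
      then have "y \<in> u ` F3_nonzero" using 1(4) by blast
      then show ?thesis using au x by blast
    qed
  next
    case False
    then have "x \<in> u ` F3_nonzero" using 1(3) by blast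
    then obtain k where x: "x = u k" "k \<noteq> 0" by blast
    show ?thesis
    proof (cases "y \<in> range a")
      case True
      then show ?thesis using ua x by blast
    next
      case False
      then have "y \<in> u ` F3_nonzero" using 1(4) by blast
      then show ?thesis using uu x by blast
    qed
  qed
  then show ?case by (simp only: B_def)
qed

end

text \<open>Everything is relative to \<open>B\<close>, since members of
  \<open>alg_aut_group B\<close> have no prescribed algebraic behaviour outside
  \<open>B\<close>.\<close>

locale affine_plane_automorphism = affine_plane_algebra scale prod form a u
  for scale :: "rat \<Rightarrow> 'a::ab_group_add \<Rightarrow> 'a" (infixr "*\<^sub>Q" 75)
    and prod :: "'a \<Rightarrow> 'a \<Rightarrow> 'a" (infixl "\<star>" 70)
    and form :: "'a \<Rightarrow> 'a \<Rightarrow> rat"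
    and a u :: "3^2 \<Rightarrow> 'a" +
  fixes f :: "'a \<Rightarrow> 'a"
  assumes f_bij: "bij_betw f B B"
    and f_add: "x \<in> B \<Longrightarrow> y \<in> B \<Longrightarrow> f (x + y) = f x + f y"
    and f_scale: "x \<in> B \<Longrightarrow> f (c *\<^sub>Q x) = c *\<^sub>Q f x"
    and f_prod: "x \<in> B \<Longrightarrow> y \<in> B \<Longrightarrow> f (x \<star> y) = f x \<star> f y"
begin

lemma f_in_B: "x \<in> B \<Longrightarrow> f x \<in> B"
  using f_bij by (auto simp: bij_betw_def)

lemma f_surj:
  assumes "x \<in> B"
  obtains y where "y \<in> B" "x = f y"
  using f_bij assms by (auto simp: bij_betw_def)

lemma f_inj: "x \<in> B \<Longrightarrow> y \<in> B \<Longrightarrow> f x = f y \<Longrightarrow> x = y"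
  using f_bij by (auto simp: bij_betw_def inj_on_def)

lemma f_zero: "f 0 = 0"
  using f_scale[of 0 0] by (simp add: B_linear)

lemma f_diff:
  assumes xy: "x \<in> B" "y \<in> B"
  shows "f (x - y) = f x - f y"
proof -
  have "f (x + (-1) *\<^sub>Q y) = f x + (-1) *\<^sub>Q f y"
    by (simp only: f_add[OF xy(1) B_linear(3)[OF xy(2)]] f_scale[OF xy(2)])
  moreover have "v + (-1) *\<^sub>Q w = v - w" for v w by simp
  ultimately show ?thesis by (simp only:)
qed

lemma f_sum: "(\<And>i. i \<in> I \<Longrightarrow> g i \<in> B) \<Longrightarrow> f (sum g I) = (\<Sum>i\<in>I. f (g i))"
  by (induction I rule: infinite_finite_induct) (simp_all add: f_zero f_add B_linear)

lemmas f_linear = f_add f_scale f_diff f_zero a_in_B u_in_B e_in_B B_linear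

text \<open>By surjectivity \<open>f e\<close> is again an identity of \<open>B\<close>, and
  identities are unique.\<close>

lemma f_e: "f e = e"
proof -
  obtain y where y: "y \<in> B" "e = f y" using f_surj e_in_B by blast
  have "f e \<star> f y = f y" using f_prod[of e y] y e_in_B e_prod by simp
  then have "e \<star> f e = e" by (simp add: y(2)[symmetric] prod_commute)
  then show ?thesis using e_prod[OF f_in_B[OF e_in_B]] by simp
qed

lemma f_prod_a_a: "d \<noteq> 0 \<Longrightarrow> f (a v) \<star> f (a (v + d)) =
      (1/32) *\<^sub>Q (2 *\<^sub>Q f (a v) + 2 *\<^sub>Q f (a (v + d)) + f (a (v - d))) - (135/2048) *\<^sub>Q f (u d)"
  by (simp add: f_prod[symmetric] a_in_B prod_a_a) (simp add: f_linear)

lemma f_prod_a_a_minus: "d \<noteq> 0 \<Longrightarrow> f (a v) \<star> f (a (v - d)) =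
      (1/32) *\<^sub>Q (2 *\<^sub>Q f (a v) + 2 *\<^sub>Q f (a (v - d)) + f (a (v + d))) - (135/2048) *\<^sub>Q f (u d)"
  using f_prod_a_a[of "- d" v] by (simp add: u_minus)

lemma f_prod_a_u: "d \<noteq> 0 \<Longrightarrow> f (a v) \<star> f (u d) =
      (1/9) *\<^sub>Q (2 *\<^sub>Q f (a v) - f (a (v + d)) - f (a (v - d))) + (5/32) *\<^sub>Q f (u d)"
  by (simp add: f_prod[symmetric] a_in_B u_in_B prod_a_u) (simp add: f_linear)

lemma f_idem: "f (a v) \<star> f (a v) = f (a v)" "d \<noteq> 0 \<Longrightarrow> f (u d) \<star> f (u d) = f (u d)"
  using f_prod[of "a v" "a v"] f_prod[of "u d" "u d"] by (simp_all add: a_in_B u_in_B a_idem u_idem)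

text \<open>The pullback of the form along \<open>f\<close> is again a Frobenius form, hence proportional to
  the form; comparing the values at \<open>e\<close> shows that \<open>f\<close> is an isometry.\<close>

lemma pullback_form_a:
  assumes "d \<noteq> 0"
  shows "form (f (a v)) (f (a (v + d))) = 13/256 * form (f (a v)) (f (a v))"
    "form (f (a v)) (f (u d)) = 1/4 * form (f (a v)) (f (a v))"
proof -
  define r where "r = form (f (a v)) (f (a v))"
  define s where "s = form (f (a v)) (f (a (v + d)))"
  define s' where "s' = form (f (a v)) (f (a (v - d)))"
  define t where "t = form (f (a v)) (f (u d))"
  have *: "form (f (a v)) y = form (f (a v)) (f (a v) \<star> y)" for y
    using form_frobenius[of "f (a v)" "f (a v)" y] by (simp add: f_idem)
  \<comment> \<open>The Frobenius property with the idempotent \<open>f (a v)\<close> gives one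
    linear equation for each of the other three vectors of a 3A algebra. Together they determine
    \<open>s\<close>, \<open>s'\<close>, \<open>t\<close> as multiples of \<open>r\<close>.\<close>
  have 1: "s = (1/32) * (2 * r + 2 * s + s') - (135/2048) * t"
    using *[of "f (a (v + d))"] unfolding f_prod_a_a[OF assms] r_def s_def s'_def t_def by simp
  have 2: "s' = (1/32) * (2 * r + 2 * s' + s) - (135/2048) * t"
    using *[of "f (a (v - d))"] unfolding f_prod_a_a_minus[OF assms] r_def s_def s'_def t_def by simp
  have 3: "t = (1/9) * (2 * r - s - s') + (5/32) * t"
    using *[of "f (u d)"] unfolding f_prod_a_u[OF assms] r_def s_def s'_def t_def by simp
  have ss: "s = s'" using 1 2 by (simp add: field_simps)
  have tr: "27 * t = (64/9) * (r - s)" using 3 ss by (simp add: field_simps)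
  have sr: "s = 13/256 * r" using 1 tr ss by (simp add: field_simps)
  then show "form (f (a v)) (f (a (v + d))) = 13/256 * form (f (a v)) (f (a v))"
    by (simp add: r_def s_def)
  have "t = 1/4 * r" using tr sr by (simp add: field_simps)
  then show "form (f (a v)) (f (u d)) = 1/4 * form (f (a v)) (f (a v))"
    by (simp add: r_def t_def)
qed

lemma pullback_form_a_const: "form (f (a v)) (f (a v)) = form (f (a w)) (f (a w))"
proof (cases "v = w")
  case False
  then show ?thesis
    using pullback_form_a(1)[of "w - v" v] pullback_form_a(1)[of "v - w" w] form_sym[of "f (a v)" "f (a w)"]
    by simp
qed simp

lemma pullback_form_u:
  assumes "d \<noteq> 0"
  shows "form (f (u d)) (f (u d)) = 8/5 * form (f (a v)) (f (a v))"
proof -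
  define r where "r = form (f (a v)) (f (a v))"
  have t: "form (f (u d)) (f (a w)) = 1/4 * r" for w
    using pullback_form_a(2)[OF assms, of w] pullback_form_a_const[of w v] form_sym[of "f (u d)" "f (a w)"]
    by (simp add: r_def)
  have "1/4 * r = form (f (u d)) (f (a v) \<star> f (u d))"
    using form_frobenius[of "f (u d)" "f (u d)" "f (a v)"] assms t
    by (simp add: f_idem prod_commute[of "f (u d)" "f (a v)"])
  also have "\<dots> = (5/32) * form (f (u d)) (f (u d))"
    unfolding f_prod_a_u[OF assms] by (simp add: t)
  finally show ?thesis by (simp add: r_def)
qed

lemma form_f_f:
  assumes "x \<in> B" "y \<in> B"
  shows "form (f x) (f y) = form x y"
proof -
  define r where "r = form (f (a 0)) (f (a 0))"
  \<comment> \<open>Pairings with \<open>e\<close> suffice, because (x,y) equals (x y, e) on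
    \<open>B\<close>. At \<open>e\<close> itself, fixed by \<open>f\<close> and of positive norm,
    the equation forces \<open>r = 1\<close>.\<close>
  have *: "form (f x) e = r * form x e" if "x \<in> B" for x
    using that
  proof (induction rule: B_induct)
    case (a v c y)
    have "form (f (a v)) e = r"
      using form_prod_e[of "f (a v)" "f (a v)"] pullback_form_a_const[of v 0]
      by (simp add: f_idem r_def f_in_B a_in_B)
    with a show ?case by (simp add: f_linear form_e algebra_simps)
  next
    case (u d c y)
    have "form (f (u d)) e = 8/5 * r"
      using form_prod_e[of "f (u d)" "f (u d)"] pullback_form_u[of d 0] u
      by (simp add: f_idem r_def f_in_B u_in_B)
    with u show ?case by (simp add: f_linear form_e algebra_simps)
  qed (simp add: f_zero)
  have "form e e = 32/5"
  proof -
    have "form ((32/45) *\<^sub>Q (\<Sum>v\<in>UNIV. a v)) e = 32/5"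
      by (simp only: form_left_linear_simps form_e) (simp add: card_F3_plane)
    then show ?thesis by (simp only: e_def[symmetric])
  qed
  then have "r = 1" using *[OF e_in_B] f_e by simp
  then show ?thesis
    using *[OF B_prod[OF assms]] form_prod_e[OF assms] form_prod_e[OF f_in_B[OF assms(1)] f_in_B[OF assms(2)]]
    by (simp add: f_prod assms)
qed

text \<open>As \<open>f\<close> is an isometry of \<open>B\<close> onto itself, it carries the frame
  to another frame with the same weights, which defines the same operator.\<close>

lemma f_casimir:
  assumes "x \<in> B"
  shows "casimir (f x) = f (casimir x)"
proof -
  have "f (casimir x) = (\<Sum>i\<in>frame_index. frame_weight i *\<^sub>Q (f (frame i) \<star> (f (frame i) \<star> f x)))"
    unfolding casimir_frame using assms
    by (simp add: f_sum f_scale f_prod B_linear B_prod frame_in_B)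
  also have "\<dots> = casimir (f x)"
    unfolding casimir_frame
  proof (rule frame_casimir_unique)
    fix i assume i: "i \<in> frame_index"
    show "f (frame i) = (\<Sum>l\<in>frame_index. frame_weight l *\<^sub>Q form (f (frame i)) (frame l) *\<^sub>Q frame l)"
      using frame_expansion f_in_B frame_in_B i by blast
    obtain y where y: "y \<in> B" "frame i = f y" using f_surj frame_in_B[OF i] by blast
    have "f y = f (\<Sum>l\<in>frame_index. frame_weight l *\<^sub>Q form y (frame l) *\<^sub>Q frame l)"
      using frame_expansion[OF y(1)] by simp
    also have "\<dots> = (\<Sum>l\<in>frame_index. frame_weight l *\<^sub>Q form (f y) (f (frame l)) *\<^sub>Q f (frame l))"
      using y by (simp add: f_sum f_scale B_linear frame_in_B form_f_f)
    finally show "frame i = (\<Sum>l\<in>frame_index. frame_weight l *\<^sub>Q form (frame i) (f (frame l)) *\<^sub>Q f (frame l))"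
      using y by simp
  qed
  finally show ?thesis by simp
qed

text \<open>The Casimir equation puts the image into \<open>U\<close>; being idempotent with the
  same pairing with \<open>e\<close>, it has exactly one nonzero coordinate.\<close>

lemma f_u:
  assumes "k \<noteq> 0"
  obtains d where "d \<noteq> 0" "f (u k) = u d"
proof -
  obtain c where c: "casimir (u k) = (55/72) *\<^sub>Q u k + c *\<^sub>Q e" using casimir_u[OF assms] by blast
  have "casimir (f (u k)) = (55/72) *\<^sub>Q f (u k) + c *\<^sub>Q e"
    using f_casimir[of "u k"] assms by (simp add: c u_in_B) (simp add: f_linear f_e)
  then have "f (u k) \<in> U" using casimir_eigenvector_in_U f_in_B u_in_B assms by blast
  moreover have "form (f (u k)) e = 8/5"
    using form_f_f[of "u k" e] assms by (simp add: f_e form_e u_in_B e_in_B)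
  ultimately show ?thesis using U_idempotent[of "f (u k)"] f_idem(2)[OF assms] that by blast
qed

lemma f_u_surj:
  assumes "d \<noteq> 0"
  obtains k where "k \<noteq> 0" "u d = f (u k)"
proof -
  have "f ` (u ` F3_nonzero) \<subseteq> u ` F3_nonzero"
  proof
    fix x assume "x \<in> f ` (u ` F3_nonzero)"
    then obtain k where "k \<noteq> 0" "x = f (u k)" by auto
    moreover obtain d where "d \<noteq> 0" "f (u k) = u d" using f_u[OF \<open>k \<noteq> 0\<close>] by blast
    ultimately show "x \<in> u ` F3_nonzero" by auto
  qed
  moreover have "inj_on f (u ` F3_nonzero)"
    by (rule inj_onI) (use f_inj u_in_B in blast)
  ultimately have "f ` (u ` F3_nonzero) = u ` F3_nonzero"
    by (intro endo_inj_surj) auto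
  then have "u d \<in> f ` (u ` F3_nonzero)" using assms by auto
  then show ?thesis using that by auto
qed

end

text \<open>The equation for a combination of the three parallel \<open>z\<close> to satisfy x x =
  (21/16) x, compared coefficientwise. The condition on the sum eliminates the squares, leaving a
  nonsingular homogeneous linear system in the mixed products, so all of them vanish.\<close>

lemma idempotent_coefficients:
  fixes b c d :: rat
  assumes 1: "(21/16) * (b * b) + (3/32) * (b * c + b * d - c * d) = (21/16) * b"
    and 2: "(21/16) * (c * c) + (3/32) * (b * c + c * d - b * d) = (21/16) * c"
    and 3: "(21/16) * (d * d) + (3/32) * (b * d + c * d - b * c) = (21/16) * d"
    and sum: "b + c + d = 1"
  shows "b = 1 \<and> c = 0 \<and> d = 0 \<or> b = 0 \<and> c = 1 \<and> d = 0 \<or> b = 0 \<and> c = 0 \<and> d = 1"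
proof -
  define r s t where "r = b * c" and "s = b * d" and "t = c * d"
  have "b * b = b - r - s" "c * c = c - r - t" "d * d = d - s - t"
    using arg_cong[OF sum, of "\<lambda>x. b * x"] arg_cong[OF sum, of "\<lambda>x. c * x"] arg_cong[OF sum, of "\<lambda>x. d * x"]
    by (simp_all add: r_def s_def t_def algebra_simps)
  then have "13 * r + 13 * s + t = 0" "13 * r + 13 * t + s = 0" "13 * s + 13 * t + r = 0"
    using 1 2 3 unfolding r_def[symmetric] s_def[symmetric] t_def[symmetric] by (simp_all add: field_simps)
  then have "r = 0" "s = 0" "t = 0" by simp_all
  then show ?thesis using sum by (auto simp: r_def s_def t_def)
qed

context affine_plane_algebra
begin

text \<open>Modulo \<open>u k\<close>, multiplication by \<open>u k\<close> scales the deviation of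
  \<open>a v\<close> from the mean of its line by 1/3, so 3 times this product recovers
  \<open>a v\<close> up to line sums and \<open>U\<close>. Hence an \<open>x\<close> with
  \<open>u k \<star> x\<close> a multiple of \<open>u k\<close> is a sum of line sums and an element
  of \<open>U\<close>.\<close>

lemma line_decomposition:
  assumes "x \<in> B" "k \<noteq> 0"
  shows "\<exists>p\<in>span (range (\<lambda>w. S w k)). \<exists>q\<in>U. x = 3 *\<^sub>Q (u k \<star> x) + p + q"
  using assms(1)
proof (induction rule: B_induct)
  case zero
  show ?case by (intro bexI[of _ 0]) (auto simp: span_zero)
next
  case (a v c y)
  then obtain p q where pq: "p \<in> span (range (\<lambda>w. S w k))" "q \<in> U" "y = 3 *\<^sub>Q (u k \<star> y) + p + q"
    by blast
  have "a v = 3 *\<^sub>Q (u k \<star> a v) + (1/3) *\<^sub>Q S v k - (15/32) *\<^sub>Q u k"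
    by (rule vec_eqI) (simp add: prod_u_a assms(2) lin_simps)
  then have "c *\<^sub>Q a v + y = c *\<^sub>Q (3 *\<^sub>Q (u k \<star> a v) + (1/3) *\<^sub>Q S v k - (15/32) *\<^sub>Q u k) + (3 *\<^sub>Q (u k \<star> y) + p + q)"
    using pq(3) by simp
  also have "\<dots> = 3 *\<^sub>Q (u k \<star> (c *\<^sub>Q a v + y)) + ((c/3) *\<^sub>Q S v k + p) + ((- 15/32 * c) *\<^sub>Q u k + q)"
    by (rule vec_eqI) (simp add: of_rat_mult algebra_simps lin_simps)
  finally have "c *\<^sub>Q a v + y = 3 *\<^sub>Q (u k \<star> (c *\<^sub>Q a v + y)) + ((c/3) *\<^sub>Q S v k + p) + ((- 15/32 * c) *\<^sub>Q u k + q)" .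
  moreover have "(c/3) *\<^sub>Q S v k + p \<in> span (range (\<lambda>w. S w k))"
    by (rule span_add[OF span_scale pq(1)], rule span_base) blast
  moreover have "(- 15/32 * c) *\<^sub>Q u k + q \<in> U"
    using pq(2) assms(2) by (intro span_add[OF span_scale pq(2)] span_base) auto
  ultimately show ?case by blast
next
  case (u d c y)
  then obtain p q where pq: "p \<in> span (range (\<lambda>w. S w k))" "q \<in> U" "y = 3 *\<^sub>Q (u k \<star> y) + p + q"
    by blast
  have ud: "u d \<in> U" using u by (auto intro: span_base)
  have uk: "u k \<in> U" using assms(2) by (auto intro: span_base)
  have "u k \<star> u d \<in> U"
    using U_prod_u[OF uk, of d] u ud by (simp add: span_scale)
  then have "c *\<^sub>Q u d - (3 * c) *\<^sub>Q (u k \<star> u d) + q \<in> U"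
    using pq ud by (intro span_add span_diff span_scale)
  moreover have "c *\<^sub>Q u d + y = 3 *\<^sub>Q (u k \<star> (c *\<^sub>Q u d + y)) + p + (c *\<^sub>Q u d - (3 * c) *\<^sub>Q (u k \<star> u d) + q)"
    using arg_cong[OF pq(3), of "\<lambda>x. c *\<^sub>Q u d + x"] by (simp add: algebra_simps)
  ultimately show ?case using pq(1) by blast
qed

context
  fixes k m :: "3^2"
  assumes k: "k \<noteq> 0" and m: "m \<noteq> 0" and km: "m \<noteq> k" "m \<noteq> - k"
begin

lemma S_cases: "S w k = S 0 k \<or> S w k = S m k \<or> S w k = S (- m) k"
proof -
  have "w \<in> set [0, 0 + k, 0 - k, 0 + m, 0 - m, 0 + (k + m), 0 - (k + m), 0 + (k - m), 0 - (k - m)]"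
    unfolding F3_plane_enum(2)[OF k m km refl refl] by simp
  then consider "w \<in> {0, 0 + k, 0 - k}" | "w \<in> {m, m + k, m - k}" | "w \<in> {- m, - m + k, - m - k}"
    by (auto simp: add.commute)
  then show ?thesis
    using S_shift[of 0 k] S_shift[of m k] S_shift[of "- m" k] by cases (auto simp del: add_0 diff_0 add_uminus_conv_diff)
qed

lemma span_S:
  assumes "x \<in> span (range (\<lambda>w. S w k))"
  shows "\<exists>b c d. x = b *\<^sub>Q S 0 k + c *\<^sub>Q S m k + d *\<^sub>Q S (- m) k"
  using assms
proof (induction rule: span_induct_alt)
  case base
  show ?case by (intro exI[of _ 0]) simp
next
  case (step r x y)
  then obtain b c d where y: "y = b *\<^sub>Q S 0 k + c *\<^sub>Q S m k + d *\<^sub>Q S (- m) k" by blast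
  from step obtain w where "x = S w k" by blast
  then consider "x = S 0 k" | "x = S m k" | "x = S (- m) k" using S_cases by metis
  then show ?case
  proof cases
    case 1
    show ?thesis by (rule exI[of _ "b + r"], rule exI[of _ c], rule exI[of _ d]) (simp add: 1 y algebra_simps)
  next
    case 2
    show ?thesis by (rule exI[of _ b], rule exI[of _ "c + r"], rule exI[of _ d]) (simp add: 2 y algebra_simps)
  next
    case 3
    show ?thesis by (rule exI[of _ b], rule exI[of _ c], rule exI[of _ "d + r"]) (simp add: 3 y algebra_simps)
  qed
qed

lemma z_products:
  "z 0 k \<star> z m k = (3/64) *\<^sub>Q (z 0 k + z m k - z (- m) k)"
  "z 0 k \<star> z (- m) k = (3/64) *\<^sub>Q (z 0 k + z (- m) k - z m k)"
  "z m k \<star> z (- m) k = (3/64) *\<^sub>Q (z m k + z (- m) k - z 0 k)"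
proof -
  have m': "- m \<noteq> 0" "- m \<noteq> k" "- m \<noteq> - k" using m km by (auto simp: minus_equation_iff)
  show "z 0 k \<star> z m k = (3/64) *\<^sub>Q (z 0 k + z m k - z (- m) k)"
    using z_prod_z_parallel[OF k m km refl refl, of 0] by simp
  show "z 0 k \<star> z (- m) k = (3/64) *\<^sub>Q (z 0 k + z (- m) k - z m k)"
    using z_prod_z_parallel[OF k m' refl refl, of 0] by (simp del: prod_right_linear_simps prod_left_linear_simps)
  show "z m k \<star> z (- m) k = (3/64) *\<^sub>Q (z m k + z (- m) k - z 0 k)"
    using z_prod_z_parallel[OF k m km refl refl, of m] by (simp add: F3_vec_double del: prod_right_linear_simps prod_left_linear_simps)
qed

text \<open>Pairings are read off from products through \<open>form_prod_e\<close>: 189/64 on the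
  diagonal and 27/256 off it, a ratio of 28 to 1, so the Gram matrix is nonsingular.\<close>

lemma z_independent:
  assumes "r *\<^sub>Q z 0 k + s *\<^sub>Q z m k + t *\<^sub>Q z (- m) k = 0"
  shows "r = 0" "s = 0" "t = 0"
proof -
  have zB: "z v k \<in> B" for v using k by (intro B_linear S_in_B a_in_B u_in_B)
  have zz: "form (z v k) (z v k) = 189/64" for v
    using form_prod_e[OF zB zB, of v v] unfolding z_prod_z[OF k] form_left_linear_simps(5) form_z_e[OF k] by simp
  have o: "form (z 0 k) (z m k) = 27/256" "form (z 0 k) (z (- m) k) = 27/256" "form (z m k) (z (- m) k) = 27/256"
    by (subst form_prod_e[OF zB zB, symmetric], subst z_products,
        simp add: form_e k)+
  have "form (z v k) (r *\<^sub>Q z 0 k + s *\<^sub>Q z m k + t *\<^sub>Q z (- m) k) = 0" for v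
    unfolding assms by simp
  then have "r * form (z v k) (z 0 k) + s * form (z v k) (z m k) + t * form (z v k) (z (- m) k) = 0" for v
    by (simp only: form_right_linear_simps(1,5))
  from this[of 0] this[of m] this[of "- m"]
  have "28 * r + s + t = 0" "28 * s + r + t = 0" "28 * t + r + s = 0"
    unfolding zz o form_sym[of "z m k" "z 0 k"] form_sym[of "z (- m) k" "z 0 k"] form_sym[of "z (- m) k" "z m k"]
    by (simp_all add: field_simps)
  then show "r = 0" "s = 0" "t = 0" by simp_all
qed

end

end

context affine_plane_automorphism
begin

text \<open>The image satisfies the same equation with \<open>u k'\<close>, which confines it to
  line sums in direction \<open>k'\<close> plus \<open>U\<close>. Pairings with the
  \<open>u d\<close> and \<open>e\<close> reduce it to an affine combination of three parallel line
  sums, and the quadratic relation of \<open>z\<close> selects a single one.\<close>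

lemma f_S:
  assumes k: "k \<noteq> 0" and k': "k' \<noteq> 0" "f (u k) = u k'"
  obtains w where "f (S v k) = S w k'"
proof -
  obtain m where m: "m \<noteq> 0" "m \<noteq> k'" "m \<noteq> - k'" using F3_vec_independent_exists[of k'] by blast
  note ind = k'(1) m
  define y where "y = f (S v k)"
  have yB: "y \<in> B" unfolding y_def by (rule f_in_B[OF S_in_B])
  have uy: "u k' \<star> y = (15/32) *\<^sub>Q u k'"
  proof -
    have "u k' \<star> y = f (u k \<star> S v k)" unfolding y_def k'(2)[symmetric]
      by (rule f_prod[OF u_in_B[OF k] S_in_B, symmetric])
    then show ?thesis unfolding u_prod_S[OF k] using k k'(2) by (simp add: f_scale u_in_B)
  qed
  obtain p q where pq: "p \<in> span (range (\<lambda>w. S w k'))" "q \<in> U" "y = 3 *\<^sub>Q (u k' \<star> y) + p + q"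
    using line_decomposition[OF yB k'(1)] by blast
  obtain b0 b1 b2 where p: "p = b0 *\<^sub>Q S 0 k' + b1 *\<^sub>Q S m k' + b2 *\<^sub>Q S (- m) k'"
    using span_S[OF ind pq(1)] by blast
  define q' where "q' = (45/32) *\<^sub>Q u k' + q"
  have q'U: "q' \<in> U" unfolding q'_def using k' by (intro span_add[OF span_scale pq(2)] span_base) auto
  have y1: "y = p + q'" using pq(3) unfolding uy q'_def by (simp add: algebra_simps)
  \<comment> \<open>\<open>y\<close> pairs to 3/4 with every \<open>u d\<close>, since
    \<open>f\<close> is an isometry permuting them, and so does each line sum. Thus
    \<open>q'\<close> has the same pairing with all \<open>u d\<close> and is a multiple of
    \<open>e\<close>; 5/8 is the inverse of (e, u d).\<close>
  define t where "t = 5/8 * (3/4 - 3/4 * (b0 + b1 + b2))"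
  have q't: "q' = t *\<^sub>Q e"
  proof (rule U_eqI)
    show "q' \<in> U" "t *\<^sub>Q e \<in> U" using q'U e_in_U by (simp_all add: span_scale)
    fix d :: "3^2" assume d: "d \<noteq> 0"
    obtain j where j: "j \<noteq> 0" "u d = f (u j)" using f_u_surj[OF d] by blast
    have "form y (u d) = form (S v k) (u j)"
      unfolding y_def j(2) by (rule form_f_f[OF S_in_B u_in_B[OF j(1)]])
    then have "form y (u d) = 3/4" by (simp only: form_S_u[OF j(1)])
    moreover have "form p (u d) = 3/4 * (b0 + b1 + b2)"
      unfolding p form_left_linear_simps(1,5) using form_S_u[OF d] by (simp add: form_a_u d algebra_simps)
    moreover have "form e (u d) = 8/5" using form_e(2)[OF d] form_sym by metis
    moreover have "form q' (u d) = form y (u d) - form p (u d)" by (simp add: y1)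
    ultimately show "form q' (u d) = form (t *\<^sub>Q e) (u d)"
      by (simp only: form_left_linear_simps(5) t_def) (simp add: field_simps)
  qed
  \<comment> \<open>The multiple of \<open>e\<close> is absorbed, since \<open>e\<close> is 32/45
    times the sum of the three parallel line sums.\<close>
  define c0 c1 c2 where "c0 = b0 + 32/45 * t" and "c1 = b1 + 32/45 * t" and "c2 = b2 + 32/45 * t"
  have y2: "y = c0 *\<^sub>Q S 0 k' + c1 *\<^sub>Q S m k' + c2 *\<^sub>Q S (- m) k'"
  proof -
    have "y = b0 *\<^sub>Q S 0 k' + b1 *\<^sub>Q S m k' + b2 *\<^sub>Q S (- m) k' + t *\<^sub>Q ((32/45) *\<^sub>Q (S 0 k' + S (0 + m) k' + S (0 - m) k'))"
      unfolding y1 p q't e_eq_sum_S[OF ind refl refl, of 0] ..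
    then show ?thesis by (simp add: c0_def c1_def c2_def algebra_simps)
  qed
  have "form y e = 3" using form_f_f[OF S_in_B e_in_B] form_S_e by (simp only: y_def f_e)
  then have c: "c0 + c1 + c2 = 1" unfolding y2 form_left_linear_simps(1,5) form_S_e by (simp add: form_e algebra_simps)
  \<comment> \<open>Because the coefficients sum to 1, subtracting the multiple of
    \<open>u k'\<close> turns the combination of line sums into the same combination of the
    \<open>z\<close>.\<close>
  define x where "x = f (z v k)"
  have zB: "z v k \<in> B" using k by (intro B_linear S_in_B a_in_B u_in_B)
  have "x = y - (15/32) *\<^sub>Q u k'"
    unfolding x_def y_def using k k'(2) by (simp only: f_diff S_in_B B_linear u_in_B f_scale not_False_eq_True)
  also have "\<dots> = y - (c0 + c1 + c2) *\<^sub>Q ((15/32) *\<^sub>Q u k')" by (simp only: c scale_one)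
  also have "\<dots> = c0 *\<^sub>Q z 0 k' + c1 *\<^sub>Q z m k' + c2 *\<^sub>Q z (- m) k'"
    unfolding y2 by (rule vec_eqI) (simp add: of_rat_mult of_rat_add lin_simps algebra_simps)
  finally have x: "x = c0 *\<^sub>Q z 0 k' + c1 *\<^sub>Q z m k' + c2 *\<^sub>Q z (- m) k'" .
  have "x \<star> x = (21/16) *\<^sub>Q x"
    unfolding x_def f_prod[OF zB zB, symmetric] z_prod_z[OF k] by (rule f_scale[OF zB])
  define z0 z1 z2 where "z0 = z 0 k'" and "z1 = z m k'" and "z2 = z (- m) k'"
  have zz: "z0 \<star> z0 = (21/16) *\<^sub>Q z0" "z1 \<star> z1 = (21/16) *\<^sub>Q z1" "z2 \<star> z2 = (21/16) *\<^sub>Q z2"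
    "z0 \<star> z1 = (3/64) *\<^sub>Q (z0 + z1 - z2)" "z0 \<star> z2 = (3/64) *\<^sub>Q (z0 + z2 - z1)" "z1 \<star> z2 = (3/64) *\<^sub>Q (z1 + z2 - z0)"
    "z1 \<star> z0 = (3/64) *\<^sub>Q (z0 + z1 - z2)" "z2 \<star> z0 = (3/64) *\<^sub>Q (z0 + z2 - z1)" "z2 \<star> z1 = (3/64) *\<^sub>Q (z1 + z2 - z0)"
    unfolding z0_def z1_def z2_def
    using z_prod_z[OF k'(1), of 0] z_prod_z[OF k'(1), of m] z_prod_z[OF k'(1), of "- m"] z_products[OF ind]
      prod_commute[of "z m k'" "z 0 k'"] prod_commute[of "z (- m) k'" "z 0 k'"] prod_commute[of "z (- m) k'" "z m k'"]
    by (simp_all only:)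
  \<comment> \<open>The coefficients of \<open>x \<star> x - (21/16) *\<^sub>Q x\<close> at the
    three independent vectors.\<close>
  define r0 r1 r2 where
    "r0 = (21/16) * (c0 * c0) + (3/32) * (c0 * c1 + c0 * c2 - c1 * c2) - (21/16) * c0" and
    "r1 = (21/16) * (c1 * c1) + (3/32) * (c0 * c1 + c1 * c2 - c0 * c2) - (21/16) * c1" and
    "r2 = (21/16) * (c2 * c2) + (3/32) * (c0 * c2 + c1 * c2 - c0 * c1) - (21/16) * c2"
  have "r0 *\<^sub>Q z0 + r1 *\<^sub>Q z1 + r2 *\<^sub>Q z2 = x \<star> x - (21/16) *\<^sub>Q x"
    unfolding x z0_def[symmetric] z1_def[symmetric] z2_def[symmetric]
    by (rule vec_eqI) (simp add: zz r0_def r1_def r2_def of_rat_add of_rat_diff of_rat_mult lin_simps algebra_simps)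
  also have "\<dots> = 0" using \<open>x \<star> x = (21/16) *\<^sub>Q x\<close> by simp
  finally have "r0 = 0" "r1 = 0" "r2 = 0"
    unfolding z0_def z1_def z2_def by (rule z_independent[OF ind])+
  then have "c0 = 1 \<and> c1 = 0 \<and> c2 = 0 \<or> c0 = 0 \<and> c1 = 1 \<and> c2 = 0 \<or> c0 = 0 \<and> c1 = 0 \<and> c2 = 1"
    using c by (intro idempotent_coefficients) (simp_all add: r0_def r1_def r2_def)
  then have "y = S 0 k' \<or> y = S m k' \<or> y = S (- m) k'" unfolding y2 by auto
  then show ?thesis using that unfolding y_def by blast
qed

end

section \<open>Collineations of the plane over the field with three elements\<close>

lemma additive_F3_matrix:
  fixes g :: "3^2 \<Rightarrow> 3^2"
  assumes add: "\<And>x y. g (x + y) = g x + g y"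
  shows "\<exists>A :: 3^2^2. \<forall>x. A *v x = g x"
proof -
  have g0: "g 0 = 0" using add[of 0 0] by simp
  have scale: "g (c *s x) = c *s g x" for c x
  proof -
    have c: "c = 1 \<or> c = 2 \<or> c = 0" using exhaust_3[of c] by auto
    have "(2::3) *s y = y + y" for y :: "3^2" by (simp add: vec_eq_iff)
    then show ?thesis using c g0 add[of x x] by auto
  qed
  define A :: "3^2^2" where "A = (\<chi> i j. g (axis j 1) $ i)"
  have "A *v x = g x" for x
  proof -
    have "x = x $ 1 *s axis 1 1 + x $ 2 *s axis 2 1"
      by (simp add: vec_eq_iff forall_2 axis_def)
    then have "g x = x $ 1 *s g (axis 1 1) + x $ 2 *s g (axis 2 1)"
      by (metis add scale)
    then show ?thesis
      by (simp add: vec_eq_iff forall_2 A_def matrix_vector_mult_def sum_2 mult.commute)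
  qed
  then show ?thesis by blast
qed

text \<open>After 0 is made a fixed point, preserving third points means g (-(x + y)) = -(g x + g
  y); taking y = 0 shows that g is odd, hence additive, and additive maps over a prime field are
  linear.\<close>

lemma collineation_affine:
  fixes \<pi> :: "3^2 \<Rightarrow> 3^2"
  assumes bij: "bij \<pi>" and line: "\<And>x y. x \<noteq> y \<Longrightarrow> \<pi> (- (x + y)) = - (\<pi> x + \<pi> y)"
  shows "\<exists>A b. invertible A \<and> \<pi> = (\<lambda>x. A *v x + b)"
proof -
  have line': "\<pi> (- (x + y)) = - (\<pi> x + \<pi> y)" for x y
  proof (cases "x = y")
    case True
    then show ?thesis by (simp only: F3_vec_double minus_minus)
  qed (rule line)
  define g where "g x = \<pi> x - \<pi> 0" for x
  have third: "g (- (x + y)) = - (g x + g y)" for x y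
  proof -
    have "- (g x + g y) = - (\<pi> x + \<pi> y) + (\<pi> 0 + \<pi> 0)" by (simp add: g_def algebra_simps)
    then show ?thesis by (simp only: F3_vec_double g_def line') simp
  qed
  have "g 0 = 0" by (simp add: g_def)
  then have "g (- x) = - g x" for x using third[of x 0] by simp
  then have add: "g (x + y) = g x + g y" for x y using third[of x y] by (metis minus_minus)
  have bg: "bij g"
  proof -
    have "g = (\<lambda>x. x - \<pi> 0) \<circ> \<pi>" by (auto simp: g_def)
    moreover have "bij (\<lambda>x. x - \<pi> 0)" by (rule bij_betw_byWitness[where f' = "\<lambda>x. x + \<pi> 0"]) auto
    ultimately show ?thesis using bij by (simp add: bij_comp)
  qed
  have inv: "inv_into UNIV g (x + y) = inv_into UNIV g x + inv_into UNIV g y" for x y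
    using bg add by (metis bij_inv_eq_iff)
  obtain A where A: "\<And>x. A *v x = g x" using additive_F3_matrix[OF add] by blast
  obtain A' where A': "\<And>x. A' *v x = inv_into UNIV g x" using additive_F3_matrix[OF inv] by blast
  have "A ** A' = mat 1" "A' ** A = mat 1"
    using bg by (auto simp: matrix_eq matrix_vector_mul_assoc[symmetric] A A' bij_is_inj bij_is_surj surj_f_inv_f)
  then have "invertible A" by (auto simp: invertible_def)
  moreover have "\<pi> = (\<lambda>x. A *v x + \<pi> 0)" by (auto simp: A g_def)
  ultimately show ?thesis by blast
qed

context affine_plane_algebra
begin

lemma a_inj: "a v = a w \<Longrightarrow> v = w"
  using form_a_a[of v w] form_a_self[of v] by force

lemma u_eq_iff: "d \<noteq> 0 \<Longrightarrow> k \<noteq> 0 \<Longrightarrow> u d = u k \<Longrightarrow> k = d \<or> k = - d"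
  using form_u_u[of d k] form_u_self[of d] by force

lemma lines_intersect:
  assumes k: "k \<noteq> 0" and m: "m \<noteq> 0" and km: "m \<noteq> k" "m \<noteq> - k"
  shows "\<exists>p. S w k = S p k \<and> S w' m = S p m"
proof -
  have "w' \<in> set [w, w + k, w - k, w + m, w - m, w + (k + m), w - (k + m), w + (k - m), w - (k - m)]"
    unfolding F3_plane_enum(2)[OF k m km refl refl] by simp
  then consider "w' \<in> {w, w + m, w - m}" | "w' \<in> {w + k, w + k + m, w + k - m}" | "w' \<in> {w - k, w - k + m, w - k - m}"
    by (auto simp: algebra_simps)
  then show ?thesis
  proof cases
    case 1
    then have "S w' m = S w m" using S_shift[of w m] by auto
    then show ?thesis by blast
  next
    case 2
    then have "S w' m = S (w + k) m" using S_shift[of "w + k" m] by auto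
    then show ?thesis using S_shift[of w k] by metis
  next
    case 3
    then have "S w' m = S (w - k) m" using S_shift[of "w - k" m] by auto
    then show ?thesis using S_shift[of w k] by metis
  qed
qed

end

context affine_plane_automorphism
begin

lemma f_a:
  obtains w where "f (a v) = a w"
proof -
  have "axis 1 1 \<noteq> (0 :: 3^2)" by (simp add: axis_eq_0_iff)
  then obtain d :: "3^2" where d: "d \<noteq> 0" by blast
  obtain m where m: "m \<noteq> 0" "m \<noteq> d" "m \<noteq> - d" using F3_vec_independent_exists[of d] by blast
  obtain k1 where k1: "k1 \<noteq> 0" "f (u d) = u k1" using f_u[OF d] by blast
  obtain k2 where k2: "k2 \<noteq> 0" "f (u m) = u k2" using f_u[OF m(1)] by blast
  have "u d \<noteq> u m" using u_eq_iff[OF d m(1)] m by auto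
  then have "u k1 \<noteq> u k2" using f_inj[of "u d" "u m"] k1 k2 d m u_in_B by metis
  then have ne: "k2 \<noteq> k1" "k2 \<noteq> - k1" using u_minus[of k1] by auto
  obtain w1 where w1: "f (S v d) = S w1 k1" using f_S[OF d k1] by blast
  obtain w2 where w2: "f (S v m) = S w2 k2" using f_S[OF m(1) k2] by blast
  obtain p where p: "S w1 k1 = S p k1" "S w2 k2 = S p k2"
    using lines_intersect[OF k1(1) k2(1) ne] by blast
  have "f (S v d \<star> S v m) = S p k1 \<star> S p k2"
    by (simp only: f_prod[OF S_in_B S_in_B] w1 w2 p)
  also have "\<dots> = (27/32) *\<^sub>Q a p + (3/16) *\<^sub>Q (S p k1 + S p k2) - (45/512) *\<^sub>Q e"
    by (rule S_prod_S_crossing[OF k1(1) k2(1) ne refl refl])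
  \<comment> \<open>Apart from \<open>a v\<close> the crossing formula contains only line sums and
    \<open>e\<close>, whose images are known, so it can be solved for
    \<open>f (a v)\<close>.\<close>
  finally have "f ((27/32) *\<^sub>Q a v + (3/16) *\<^sub>Q (S v d + S v m) - (45/512) *\<^sub>Q e) =
      (27/32) *\<^sub>Q a p + (3/16) *\<^sub>Q (S p k1 + S p k2) - (45/512) *\<^sub>Q e"
    by (simp only: S_prod_S_crossing[OF d m refl refl])
  moreover have "f ((27/32) *\<^sub>Q a v + (3/16) *\<^sub>Q (S v d + S v m) - (45/512) *\<^sub>Q e) =
      (27/32) *\<^sub>Q f (a v) + (3/16) *\<^sub>Q (f (S v d) + f (S v m)) - (45/512) *\<^sub>Q e"
    by (simp only: f_add f_scale f_diff f_e B_linear S_in_B a_in_B e_in_B)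
  ultimately have "(27/32) *\<^sub>Q f (a v) = (27/32) *\<^sub>Q a p"
    unfolding w1 w2 p by simp
  then show ?thesis using that by simp
qed

definition perm :: "3^2 \<Rightarrow> 3^2" where
  "perm v = (THE w. f (a v) = a w)"

lemma f_a_perm: "f (a v) = a (perm v)"
  unfolding perm_def by (rule f_a[of v], rule theI2) (auto dest: a_inj)

lemma bij_perm: "bij perm"
proof -
  have "inj perm"
    by (rule injI) (metis f_a_perm f_inj a_in_B a_inj)
  then show ?thesis by (simp add: bij_def finite_UNIV_inj_surj)
qed

text \<open>Two expressions for the product of the images show that a difference \<open>D\<close> of
  two axes is a multiple of a difference of two \<open>u\<close>. Every axis pairs to 1/4 with every
  \<open>u\<close>, so \<open>D\<close> is orthogonal to itself and vanishes.\<close>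

lemma perm_third:
  assumes "x \<noteq> y"
  shows "perm (- (x + y)) = - (perm x + perm y)"
proof -
  define d where "d = y - x"
  have d: "d \<noteq> 0" "y = x + d" using assms by (auto simp: d_def)
  have third: "- (x + y) = x - d" using F3_vec_double[of x] by (simp add: d algebra_simps)
  have ne: "perm x \<noteq> perm y" using bij_perm assms by (auto simp: bij_def inj_def)
  obtain k where k: "k \<noteq> 0" "f (u d) = u k" using f_u[OF d(1)] by blast
  define r where "r = - (perm x + perm y)"
  define D where "D = a (perm (x - d)) - a r"
  have "(1/32) *\<^sub>Q (2 *\<^sub>Q a (perm x) + 2 *\<^sub>Q a (perm y) + a r) - (135/2048) *\<^sub>Q u (perm y - perm x) =
    (1/32) *\<^sub>Q (2 *\<^sub>Q a (perm x) + 2 *\<^sub>Q a (perm y) + a (perm (x - d))) - (135/2048) *\<^sub>Q u k"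
    using f_prod_a_a[OF d(1), of x] prod_a_a_third[OF ne disjI1[OF refl] r_def]
    by (simp add: d(2)[symmetric] f_a_perm k)
  note * = rform_cong[OF this]
  have eq: "(1/32) *\<^sub>Q D = (135/2048) *\<^sub>Q (u k - u (perm y - perm x))"
  proof (rule vec_eqI)
    fix w show "rform w ((1/32) *\<^sub>Q D) = rform w ((135/2048) *\<^sub>Q (u k - u (perm y - perm x)))"
      using *[of w] by (simp add: D_def lin_simps)
  qed
  have "(1/32) * form D D = form D ((1/32) *\<^sub>Q D)" by simp
  also have "\<dots> = 0"
    unfolding eq by (simp add: D_def form_a_u k ne[symmetric])
  finally have "D = 0" using form_eq_0_iff by simp
  then have "perm (x - d) = r" using a_inj by (simp add: D_def)
  then show ?thesis by (simp only: third r_def)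
qed

lemma perm_in_AGL: "perm \<in> carrier AGL_2_3"
  using collineation_affine[OF bij_perm perm_third] by (auto simp: AGL_2_3_def)

end

section \<open>Affine maps induce automorphisms\<close>

context affine_plane_algebra
begin

text \<open>The structure constants depend only on the affine relations between points and
  directions, so multiplicativity on generators is immediate and extends bilinearly.\<close>

lemma frame_map_prod:
  assumes g: "bij g" and h: "bij_betw h F3_nonzero F3_nonzero" and h_minus: "\<And>d. h (- d) = - h d"
    and gh: "\<And>v d. g (v + d) = g v + h d"
    and x: "x \<in> B" and y: "y \<in> B"
  shows "frame_map g h (x \<star> y) = frame_map g h x \<star> frame_map g h y"
proof -
  let ?F = "frame_map g h"
  note gen = frame_map_generators[OF g h h_minus]
  have h0: "h d \<noteq> 0" if "d \<noteq> 0" for d using h that by (auto simp: bij_betw_def)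
  have gh': "g (v - d) = g v - h d" for v d using gh[of v "- d"] by (simp add: h_minus)
  have diff: "?F (x - y) = ?F x - ?F y" for x y
    using frame_map_linear(1)[of g h "x - y" y] by (simp add: algebra_simps)
  have zero: "?F 0 = 0" using diff[of 0 0] by simp
  note lin = frame_map_linear diff zero gen
  have aa: "?F (a v \<star> a w) = ?F (a v) \<star> ?F (a w)" for v w
  proof (cases "v = w")
    case False
    then obtain d where d: "d \<noteq> 0" "w = v + d" by (metis add_diff_cancel_left' diff_add_cancel add.commute right_minus_eq)
    show ?thesis by (simp add: d prod_a_a lin gh gh' h0)
  qed (simp add: a_idem lin)
  have au: "?F (a v \<star> u d) = ?F (a v) \<star> ?F (u d)" if "d \<noteq> 0" for v d
    by (simp add: prod_a_u lin that gh gh' h0)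
  have ua: "?F (u d \<star> a v) = ?F (u d) \<star> ?F (a v)" if "d \<noteq> 0" for v d
    using au[OF that, of v] by (simp add: prod_commute)
  have uu: "?F (u d \<star> u k) = ?F (u d) \<star> ?F (u k)" if "d \<noteq> 0" "k \<noteq> 0" for d k
  proof (cases "k = d \<or> k = - d")
    case True
    then have "u k = u d" by (auto simp: u_minus)
    then show ?thesis using that by (simp add: u_idem lin h0)
  next
    case False
    have "h k \<noteq> h d" "h k \<noteq> h (- d)"
      using h that False by (auto simp: bij_betw_def inj_on_def)
    then show ?thesis using False that by (simp add: u_prod_u lin h0 h_minus)
  qed
  have a: "?F (a v \<star> y) = ?F (a v) \<star> ?F y" for v
    using y by (induction rule: B_induct) (simp_all add: aa au frame_map_linear zero)
  have u: "?F (u d \<star> y) = ?F (u d) \<star> ?F y" if "d \<noteq> 0" for d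
    using y by (induction rule: B_induct) (simp_all add: ua uu that frame_map_linear zero)
  show ?thesis
    using x by (induction rule: B_induct) (simp_all add: a u frame_map_linear zero)
qed

lemma affine_automorphism:
  assumes "g \<in> carrier AGL_2_3"
  shows "\<exists>f\<in>carrier (alg_aut_group B). \<forall>v. f (a v) = a (g v)"
proof -
  obtain A :: "3^2^2" and b where A: "invertible A" "g = (\<lambda>x. A *v x + b)"
    using assms by (auto simp: AGL_2_3_def)
  obtain A' where A': "A ** A' = mat 1" "A' ** A = mat 1" using A by (auto simp: invertible_def)
  have AA: "A *v (A' *v x) = x" "A' *v (A *v x) = x" for x
    by (simp_all add: matrix_vector_mul_assoc A')
  define h where "h = (\<lambda>d. A *v d)"
  define g' where "g' = (\<lambda>x. A' *v (x - b))"
  define h' where "h' = (\<lambda>d. A' *v d)"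
  have mvm: "M *v (- x) = - (M *v x)" for M :: "3^2^2" and x
    using matrix_vector_mult_diff_distrib[of M 0 x] by simp
  have g: "bij g" by (rule bij_betw_byWitness[where f' = g']) (auto simp: A g'_def AA)
  have g': "bij g'" by (rule bij_betw_byWitness[where f' = g]) (auto simp: A g'_def AA)
  have nz: "A *v x = 0 \<longleftrightarrow> x = 0" "A' *v x = 0 \<longleftrightarrow> x = 0" for x
    by (metis AA matrix_vector_mult_0_right)+
  have h: "bij_betw h F3_nonzero F3_nonzero" by (rule bij_betw_byWitness[where f' = h']) (auto simp: h_def h'_def AA nz)
  have h': "bij_betw h' F3_nonzero F3_nonzero" by (rule bij_betw_byWitness[where f' = h]) (auto simp: h_def h'_def AA nz)
  have hm: "h (- d) = - h d" "h' (- d) = - h' d" for d by (simp_all add: h_def h'_def mvm)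
  have gh: "g (v + d) = g v + h d" for v d by (simp add: A h_def matrix_vector_right_distrib)
  have h0: "h d \<noteq> 0" "h' d \<noteq> 0" if "d \<noteq> 0" for d using that by (simp_all add: h_def h'_def nz)
  note gen = frame_map_generators[OF g h hm(1)] and gen' = frame_map_generators[OF g' h' hm(2)]
  have zero: "frame_map g h 0 = 0" for g h by (simp add: frame_map_def)
  have inB: "frame_map g h x \<in> B" if "x \<in> B" for x
    using that by (induction rule: B_induct) (simp_all add: frame_map_linear gen zero B_linear a_in_B u_in_B h0)
  have inB': "frame_map g' h' x \<in> B" if "x \<in> B" for x
    using that by (induction rule: B_induct) (simp_all add: frame_map_linear gen' zero B_linear a_in_B u_in_B h0)
  have inv: "frame_map g' h' (frame_map g h x) = x" if "x \<in> B" for x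
    using that by (induction rule: B_induct)
      (simp_all add: frame_map_linear gen gen' zero h0, simp_all add: A g'_def h_def h'_def AA)
  have inv': "frame_map g h (frame_map g' h' x) = x" if "x \<in> B" for x
    using that by (induction rule: B_induct)
      (simp_all add: frame_map_linear gen gen' zero h0, simp_all add: A g'_def h_def h'_def AA)
  \<comment> \<open>Restriction is needed because the members of \<open>Bij B\<close> are
    extensional.\<close>
  define f where "f = restrict (frame_map g h) B"
  have "bij_betw (frame_map g h) B B"
    by (rule bij_betw_byWitness[where f' = "frame_map g' h'"]) (auto simp: inv inv' inB inB')
  then have "f \<in> Bij B"
    by (auto simp: Bij_def f_def cong: bij_betw_cong)
  then have "f \<in> carrier (alg_aut_group B)"
    by (simp add: alg_aut_group_def f_def B_linear B_prod frame_map_linear frame_map_prod[OF g h hm(1) gh])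
  moreover have "f (a v) = a (g v)" for v by (simp add: f_def a_in_B gen)
  ultimately show ?thesis by blast
qed

lemma automorphism_locale:
  assumes "f \<in> carrier (alg_aut_group B)"
  shows "affine_plane_automorphism scale prod form a u f"
  using assms
  by unfold_locales (auto simp: alg_aut_group_def Bij_def)

theorem alg_aut_group_iso_AGL: "alg_aut_group B \<cong> AGL_2_3"
proof -
  define \<Phi> where "\<Phi> f = affine_plane_automorphism.perm a f" for f
  have \<Phi>: "f (a v) = a (\<Phi> f v)" if "f \<in> carrier (alg_aut_group B)" for f v
    unfolding \<Phi>_def using affine_plane_automorphism.f_a_perm[OF automorphism_locale[OF that]] .
  have in_AGL: "\<Phi> f \<in> carrier AGL_2_3" if "f \<in> carrier (alg_aut_group B)" for f
    unfolding \<Phi>_def using affine_plane_automorphism.perm_in_AGL[OF automorphism_locale[OF that]] .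
  have mult: "f \<otimes>\<^bsub>alg_aut_group B\<^esub> g = compose B f g"
    if "f \<in> carrier (alg_aut_group B)" "g \<in> carrier (alg_aut_group B)" for f g
    using that by (auto simp: alg_aut_group_def BijGroup_def)
  have "\<Phi> \<in> hom (alg_aut_group B) AGL_2_3"
  proof (rule homI)
    fix f g assume fg: "f \<in> carrier (alg_aut_group B)" "g \<in> carrier (alg_aut_group B)"
    interpret f: affine_plane_automorphism scale prod form a u f by (rule automorphism_locale[OF fg(1)])
    interpret g: affine_plane_automorphism scale prod form a u g by (rule automorphism_locale[OF fg(2)])
    have c: "compose B f g \<in> carrier (alg_aut_group B)"
    proof -
      have "compose B f g \<in> Bij B" using fg by (intro compose_Bij) (auto simp: alg_aut_group_def)
      then show ?thesis
        by (simp add: alg_aut_group_def compose_def B_linear B_prod f.f_add f.f_scale f.f_prod g.f_add g.f_scale g.f_prod g.f_in_B)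
    qed
    have "a (\<Phi> (compose B f g) v) = a (\<Phi> f (\<Phi> g v))" for v
      using \<Phi>[OF c, of v] \<Phi>[OF fg(1), of "\<Phi> g v"] \<Phi>[OF fg(2), of v] by (simp add: compose_def a_in_B)
    then have "\<Phi> (compose B f g) v = (\<Phi> f \<circ> \<Phi> g) v" for v using a_inj by (metis comp_apply)
    then have "\<Phi> (compose B f g) = \<Phi> f \<circ> \<Phi> g" by blast
    then show "\<Phi> (f \<otimes>\<^bsub>alg_aut_group B\<^esub> g) = \<Phi> f \<otimes>\<^bsub>AGL_2_3\<^esub> \<Phi> g"
      by (simp add: mult fg AGL_2_3_def)
  qed (rule in_AGL)
  moreover have "inj_on \<Phi> (carrier (alg_aut_group B))"
  proof (rule inj_onI)
    fix f g assume fg: "f \<in> carrier (alg_aut_group B)" "g \<in> carrier (alg_aut_group B)" and eq: "\<Phi> f = \<Phi> g"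
    interpret f: affine_plane_automorphism scale prod form a u f by (rule automorphism_locale[OF fg(1)])
    interpret g: affine_plane_automorphism scale prod form a u g by (rule automorphism_locale[OF fg(2)])
    have a: "f (a v) = g (a v)" for v using \<Phi>[OF fg(1), of v] \<Phi>[OF fg(2), of v] eq by simp
    \<comment> \<open>Each \<open>u d\<close> is expressible by axes and one product of axes, so
      agreement on the axes suffices.\<close>
    have u: "f (u d) = g (u d)" if "d \<noteq> 0" for d
      using f.f_prod_a_a[OF that, of 0] g.f_prod_a_a[OF that, of 0] by (simp add: a)
    have fB: "f x = g x" if "x \<in> B" for x
      using that by (induction rule: B_induct)
        (simp_all add: f.f_zero g.f_zero f.f_add g.f_add f.f_scale g.f_scale a_in_B u_in_B B_linear a u)
    moreover have "f \<in> extensional B" "g \<in> extensional B" using fg by (auto simp: alg_aut_group_def Bij_def)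
    ultimately show "f = g" by (meson extensionalityI)
  qed
  moreover have "\<Phi> ` carrier (alg_aut_group B) = carrier AGL_2_3"
  proof (rule equalityI)
    show "carrier AGL_2_3 \<subseteq> \<Phi> ` carrier (alg_aut_group B)"
    proof
      fix g assume "g \<in> carrier AGL_2_3"
      then obtain f where f: "f \<in> carrier (alg_aut_group B)" "\<And>v. f (a v) = a (g v)"
        using affine_automorphism by blast
      then have "\<Phi> f = g" using \<Phi>[OF f(1)] by (auto intro: a_inj)
      then show "g \<in> \<Phi> ` carrier (alg_aut_group B)" using f by blast
    qed
  qed (use in_AGL in blast)
  ultimately have "\<Phi> \<in> iso (alg_aut_group B) AGL_2_3" by (auto simp: iso_def bij_betw_def)
  then show ?thesis by (auto simp: is_iso_def)
qed

end

context affine_plane_algebra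
begin

text \<open>Nine axes and three of the four \<open>u\<close> form a basis: the fourth is
  \<open>e\<close> minus the others, and \<open>e\<close> is in the span of the axes.\<close>

theorem dim_B: "dim B = 12"
proof -
  have "axis 1 1 \<noteq> (0 :: 3^2)" by (simp add: axis_eq_0_iff)
  then obtain k :: "3^2" where k: "k \<noteq> 0" by blast
  obtain m where m: "m \<noteq> 0" "m \<noteq> k" "m \<noteq> - k" using F3_vec_independent_exists[of k] by blast
  obtain p q where pq: "p = k + m" "q = k - m" by blast
  note E = F3_plane_enum[OF k m pq, of 0]
  have nz: "p \<noteq> 0" "q \<noteq> 0" using E(1) by auto
  have ne: "m \<noteq> k" "m \<noteq> - k" "p \<noteq> k" "p \<noteq> - k" "p \<noteq> m" "p \<noteq> - m" "q \<noteq> k" "q \<noteq> - k" "q \<noteq> m" "q \<noteq> - m" "q \<noteq> p" "q \<noteq> - p"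
    using E(1) by (auto simp: minus_equation_iff)
  define T where "T = {u k, u m, u p}"
  have une: "u k \<noteq> u m" "u k \<noteq> u p" "u m \<noteq> u p"
    using u_eq_iff k m nz ne by blast+
  have uu: "form (u k) (u q) = 0" "form (u m) (u q) = 0" "form (u p) (u q) = 0"
    "form (u k) (u m) = 0" "form (u k) (u p) = 0" "form (u m) (u p) = 0"
    using k m nz ne by (simp_all add: form_u_u)
  have u_ne_a: "u d \<noteq> a v" if "d \<noteq> 0" for v d
    using form_e(1)[of v] form_e(2)[OF that] by auto
  have disj: "range a \<inter> T = {}" using u_ne_a[OF k] u_ne_a[OF m(1)] u_ne_a[OF nz(1)] by (auto simp: T_def)
  have inj: "inj a" by (rule injI) (rule a_inj)
  have card: "card (range a \<union> T) = 12"
  proof -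
    have "card (range a) = 9" by (simp only: card_image[OF inj] card_F3_plane)
    moreover have "card T = 3" "finite T" using une by (simp_all add: T_def)
    ultimately show ?thesis using disj by (simp add: card_Un_disjoint)
  qed
  have "span (range a \<union> T) = B"
  proof
    show "span (range a \<union> T) \<subseteq> B"
      unfolding B_def by (rule span_mono) (use k m nz in \<open>auto simp: T_def\<close>)
    have base: "x \<in> span (range a \<union> T)" if "x \<in> range a \<union> T" for x using that by (rule span_base)
    have e: "e \<in> span (range a \<union> T)"
      unfolding e_def by (intro span_scale span_sum base) auto
    have "e - u k - u m - u p \<in> span (range a \<union> T)"
      by (intro span_diff[OF span_diff[OF span_diff[OF e]]] base) (auto simp: T_def)
    then have uq: "u q \<in> span (range a \<union> T)" by (simp add: e_eq_sum_u[OF k m pq])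
    have "u d \<in> span (range a \<union> T)" if "d \<noteq> 0" for d
    proof -
      have "d \<in> {k, - k, m, - m, p, - p, q, - q}"
        using that E(2) by auto
      then have "u d = u q \<or> u d \<in> T" by (auto simp: T_def u_minus)
      then show ?thesis using uq base by auto
    qed
    then have "range a \<union> u ` F3_nonzero \<subseteq> span (range a \<union> T)"
      using base by auto
    then show "B \<subseteq> span (range a \<union> T)" unfolding B_def by (rule span_minimal) simp
  qed
  moreover have "independent (range a \<union> T)"
  proof -
    have fin: "finite (range a \<union> T)" by (simp add: T_def)
    have "\<forall>x\<in>range a \<union> T. c x = 0" if c: "(\<Sum>x\<in>range a \<union> T. c x *\<^sub>Q x) = 0" for c
    proof -
      have "(\<Sum>x\<in>range a \<union> T. c x *\<^sub>Q x) = (\<Sum>x\<in>range a. c x *\<^sub>Q x) + (\<Sum>x\<in>T. c x *\<^sub>Q x)"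
        by (rule sum.union_disjoint) (use disj in \<open>auto simp: T_def\<close>)
      also have "(\<Sum>x\<in>range a. c x *\<^sub>Q x) = (\<Sum>v\<in>UNIV. c (a v) *\<^sub>Q a v)"
        by (subst sum.reindex[OF inj]) simp
      also have "(\<Sum>x\<in>T. c x *\<^sub>Q x) = c (u k) *\<^sub>Q u k + c (u m) *\<^sub>Q u m + c (u p) *\<^sub>Q u p"
        using une by (simp add: T_def add.assoc)
      finally have "form ((\<Sum>v\<in>UNIV. c (a v) *\<^sub>Q a v) + (c (u k) *\<^sub>Q u k + c (u m) *\<^sub>Q u m + c (u p) *\<^sub>Q u p)) w = 0" for w
        using c by simp
      then have *: "(\<Sum>v\<in>UNIV. c (a v) * form (a v) w) + (c (u k) * form (u k) w + c (u m) * form (u m) w + c (u p) * form (u p) w) = 0" for w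
        by simp
      \<comment> \<open>\<open>u q\<close> is orthogonal to the three chosen \<open>u\<close> and
        pairs to 1/4 with each axis, so it isolates the sum of the axis coefficients. With this sum
        zero, pairing with each chosen \<open>u\<close>, and then with each axis, isolates single
        coefficients.\<close>
      have s: "(\<Sum>v\<in>UNIV. c (a v)) = 0"
        using *[of "u q"] uu nz by (simp add: form_a_u sum_divide_distrib[symmetric])
      have cu: "c (u k) = 0" "c (u m) = 0" "c (u p) = 0"
        using *[of "u k"] *[of "u m"] *[of "u p"] uu nz k m s form_sym[of "u m" "u k"] form_sym[of "u p" "u k"] form_sym[of "u p" "u m"]
        by (simp_all add: form_a_u sum_divide_distrib[symmetric] form_u_self)
      have "c (a w) = 0" for w
      proof -
        have "(\<Sum>v\<in>UNIV. c (a v) * form (a v) (a w)) = 13/256 * (\<Sum>v\<in>UNIV. c (a v)) + 243/256 * c (a w)"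
        proof -
          have "(\<Sum>v\<in>UNIV. c (a v) * form (a v) (a w)) =
              (\<Sum>v\<in>UNIV. 13/256 * c (a v) + (if v = w then 243/256 * c (a v) else 0))"
            by (rule sum.cong) (auto simp: form_a_a_if)
          then show ?thesis by (simp add: sum.distrib sum_distrib_left)
        qed
        then show ?thesis using *[of "a w"] s cu by simp
      qed
      then show ?thesis using cu by (auto simp: T_def)
    qed
    then show ?thesis using dependent_finite[OF fin] by blast
  qed
  ultimately show ?thesis using dim_eq_card[of "range a \<union> T" B] card
    by (metis span_span)
qed

text \<open>The 3A product formula, solved for \<open>u d\<close>, puts it into every subalgebra
  containing the axes.\<close>

lemma alg_generated_a: "alg_generated (range a) = B"
proof -
  have "subalgebra B"
    by (auto simp: subalgebra_def B_prod) (simp add: B_def)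
  moreover have "range a \<subseteq> B" using a_in_B by auto
  moreover have "B \<subseteq> A" if "subalgebra A" "range a \<subseteq> A" for A
  proof -
    have A: "subspace A" "\<And>x y. x \<in> A \<Longrightarrow> y \<in> A \<Longrightarrow> x \<star> y \<in> A" and aA: "a v \<in> A" for v
      using that by (auto simp: subalgebra_def)
    have "u d \<in> A" if "d \<noteq> 0" for d
    proof -
      have "u d = (2048/135) *\<^sub>Q ((1/32) *\<^sub>Q (2 *\<^sub>Q a 0 + 2 *\<^sub>Q a (0 + d) + a (0 - d)) - a 0 \<star> a (0 + d))"
        unfolding prod_a_a[OF that] by (rule vec_eqI) simp
      also have "\<dots> \<in> A" by (intro subspace_scale subspace_diff subspace_add A aA)
      finally show ?thesis .
    qed
    then have "range a \<union> u ` F3_nonzero \<subseteq> A" using aA by auto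
    then show ?thesis unfolding B_def by (rule span_minimal) (rule A)
  qed
  ultimately show ?thesis
    unfolding alg_generated_def by (intro hull_unique) auto
qed

end

section \<open>Miyamoto involutions and dihedral subalgebras\<close>

context comm_rat_algebra
begin

text \<open>\<open>even_poly a\<close> is \<open>L (L - 1) (L - 1/4)\<close> for \<open>L\<close> the multiplication by \<open>a\<close>. It annihilates
  the eigenspaces for \<open>1\<close>, \<open>0\<close>, \<open>1/4\<close> and acts as \<open>217/32768\<close> on the eigenspace for \<open>1/32\<close>, which
  makes the Miyamoto involution polynomial in \<open>L\<close>.\<close>

definition even_poly :: "'a \<Rightarrow> 'a \<Rightarrow> 'a" where
  "even_poly a x = a \<star> (a \<star> (a \<star> x)) - (5/4) *\<^sub>Q (a \<star> (a \<star> x)) + (1/4) *\<^sub>Q (a \<star> x)"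

definition tau :: "'a \<Rightarrow> 'a \<Rightarrow> 'a" where
  "tau a x = x - (65536/217) *\<^sub>Q even_poly a x"

lemma even_poly_linear:
  "even_poly a (x + y) = even_poly a x + even_poly a y"
  "even_poly a (x - y) = even_poly a x - even_poly a y"
  "even_poly a (c *\<^sub>Q x) = c *\<^sub>Q even_poly a x"
  "even_poly a 0 = 0"
  by (simp_all add: even_poly_def algebra_simps)

lemma tau_linear:
  "tau a (x + y) = tau a x + tau a y"
  "tau a (x - y) = tau a x - tau a y"
  "tau a (c *\<^sub>Q x) = c *\<^sub>Q tau a x"
  by (simp_all add: tau_def even_poly_linear algebra_simps)

lemma even_poly_eigenvector:
  assumes "a \<star> x = l *\<^sub>Q x"
  shows "even_poly a x = (l * (l - 1) * (l - 1/4)) *\<^sub>Q x"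
  by (simp add: even_poly_def assms scale_left_distrib[symmetric] scale_left_diff_distrib[symmetric])
     (simp add: field_simps)

lemma tau_eigenvector:
  assumes "a \<star> x = l *\<^sub>Q x" "l \<in> monster_eigenvalues"
  shows "tau a x = (if l = 1/32 then - x else x)"
proof -
  have "even_poly a x = (if l = 1/32 then (217/32768) *\<^sub>Q x else 0)"
  proof (cases "l = 1/32")
    case True
    show ?thesis using even_poly_eigenvector[OF assms(1)] unfolding True by simp
  next
    case False
    then show ?thesis
      using assms(2) by (auto simp: even_poly_eigenvector[OF assms(1)] monster_eigenvalues_def)
  qed
  moreover have "x - 2 *\<^sub>Q x = - x"
    using scale_left_diff_distrib[of 1 2 x] by simp
  ultimately show ?thesis by (simp add: tau_def)
qed

lemma axis_decomposition:
  assumes "primitive_axis a"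
  obtains p r where "even_poly a p = 0" "a \<star> r = (1/32) *\<^sub>Q r" "x = p + r"
    "\<exists>p1 p0 p4. p = p1 + p0 + p4 \<and> a \<star> p1 = p1 \<and> a \<star> p0 = 0 \<and> a \<star> p4 = (1/4) *\<^sub>Q p4"
proof -
  obtain c where c: "c \<in> PiE monster_eigenvalues (eigenspace a)" "x = (\<Sum>l\<in>monster_eigenvalues. c l)"
    using assms unfolding primitive_axis_def by metis
  have ev: "a \<star> c l = l *\<^sub>Q c l" if "l \<in> monster_eigenvalues" for l
    using c(1) that by (auto simp: PiE_def Pi_def eigenspace_def)
  have e: "a \<star> c 1 = c 1" "a \<star> c 0 = 0" "a \<star> c (1/4) = (1/4) *\<^sub>Q c (1/4)" "a \<star> c (1/32) = (1/32) *\<^sub>Q c (1/32)"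
    using ev[of 1] ev[of 0] ev[of "1/4"] ev[of "1/32"] by (simp_all add: monster_eigenvalues_def)
  have "x = (c 1 + c 0 + c (1/4)) + c (1/32)"
    using c(2) by (simp add: monster_eigenvalues_def add.assoc)
  moreover have "even_poly a (c 1 + c 0 + c (1/4)) = 0"
    by (simp add: even_poly_linear even_poly_eigenvector[of a _ 1] even_poly_eigenvector[of a _ 0]
        even_poly_eigenvector[of a _ "1/4"] e)
  ultimately show ?thesis using that[of "c 1 + c 0 + c (1/4)" "c (1/32)"] e by blast
qed

lemma tau_even: "even_poly a p = 0 \<Longrightarrow> tau a p = p"
  by (simp add: tau_def)

lemma tau_odd: "a \<star> r = (1/32) *\<^sub>Q r \<Longrightarrow> tau a r = - r"
  using tau_eigenvector[of a r "1/32"] by (simp add: monster_eigenvalues_def)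

text \<open>A linear map is determined by its values on the eigenspaces, which span; the polynomial
  \<open>tau\<close> has the prescribed ones.\<close>

lemma miyamoto_eq_tau:
  assumes "primitive_axis a"
  shows "miyamoto a = tau a"
  unfolding miyamoto_def
proof (rule the_equality)
  have "Vector_Spaces.linear scale scale (tau a)"
    by unfold_locales (simp_all add: tau_linear)
  then show "Vector_Spaces.linear (*\<^sub>Q) (*\<^sub>Q) (tau a) \<and> (\<forall>u\<in>eigenspace a (1/32). tau a u = - u) \<and>
    (\<forall>l\<in>monster_eigenvalues - {1/32}. \<forall>u\<in>eigenspace a l. tau a u = u)"
    by (auto simp: eigenspace_def tau_odd) (subst tau_eigenvector; force)
next
  fix f
  assume f: "Vector_Spaces.linear (*\<^sub>Q) (*\<^sub>Q) f \<and> (\<forall>u\<in>eigenspace a (1/32). f u = - u) \<and>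
    (\<forall>l\<in>monster_eigenvalues - {1/32}. \<forall>u\<in>eigenspace a l. f u = u)"
  interpret f: Vector_Spaces.linear scale scale f using f by blast
  show "f = tau a"
  proof
    fix x
    obtain p r where pr: "even_poly a p = 0" "a \<star> r = (1/32) *\<^sub>Q r" "x = p + r"
      "\<exists>p1 p0 p4. p = p1 + p0 + p4 \<and> a \<star> p1 = p1 \<and> a \<star> p0 = 0 \<and> a \<star> p4 = (1/4) *\<^sub>Q p4"
      using axis_decomposition[OF assms] by metis
    obtain p1 p0 p4 where p: "p = p1 + p0 + p4" "a \<star> p1 = p1" "a \<star> p0 = 0" "a \<star> p4 = (1/4) *\<^sub>Q p4"
      using pr(4) by blast
    have F: "f w = w" if "a \<star> w = l *\<^sub>Q w" "l \<in> monster_eigenvalues - {1/32}" for l w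
      using f that by (auto simp: eigenspace_def)
    have "f p1 = p1" "f p0 = p0" "f p4 = p4"
      using F[of p1 1] F[of p0 0] F[of p4 "1/4"] p by (simp_all add: monster_eigenvalues_def)
    then have "f p = p" by (simp add: p(1) f.add)
    moreover have "f r = - r" using f pr(2) by (auto simp: eigenspace_def)
    ultimately show "f x = tau a x"
      by (simp add: pr(3) f.add tau_linear tau_even[OF pr(1)] tau_odd[OF pr(2)])
  qed
qed

lemma subspace_even: "subspace {x. even_poly a x = 0}"
  by (rule subspaceI) (auto simp: even_poly_linear)

lemma fusion_even:
  assumes "primitive_axis a" "l \<in> monster_eigenvalues" "m \<in> monster_eigenvalues"
    "a \<star> x = l *\<^sub>Q x" "a \<star> y = m *\<^sub>Q y" "l = 1/32 \<longleftrightarrow> m = 1/32"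
  shows "even_poly a (x \<star> y) = 0"
proof -
  have "monster_fusion l m \<subseteq> {1, 0, 1/4}"
    using assms(2,3,6) by (auto simp: monster_eigenvalues_def monster_fusion_def doubleton_eq_iff)
  then have "(\<Union>n\<in>monster_fusion l m. eigenspace a n) \<subseteq> {x. even_poly a x = 0}"
    using even_poly_eigenvector by (fastforce simp: eigenspace_def)
  then have "span (\<Union>n\<in>monster_fusion l m. eigenspace a n) \<subseteq> {x. even_poly a x = 0}"
    by (rule span_minimal) (rule subspace_even)
  moreover have "x \<star> y \<in> span (\<Union>n\<in>monster_fusion l m. eigenspace a n)"
    using assms unfolding primitive_axis_def eigenspace_def by blast
  ultimately show ?thesis by blast
qed

lemma fusion_odd:
  assumes "primitive_axis a" "l \<in> monster_eigenvalues" "l \<noteq> 1/32" "a \<star> x = l *\<^sub>Q x" "a \<star> y = (1/32) *\<^sub>Q y"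
  shows "a \<star> (x \<star> y) = (1/32) *\<^sub>Q (x \<star> y)"
proof (rule axis_fusion_singleton[OF assms(1,2) _ _ assms(4,5)])
  show "1/32 \<in> monster_eigenvalues" by (simp add: monster_eigenvalues_def)
  show "monster_fusion l (1/32) = {1/32}"
    using assms(2,3) by (auto simp: monster_eigenvalues_def monster_fusion_def doubleton_eq_iff)
qed

text \<open>The fusion law is graded by a group of order 2, with 1/32 as its only odd eigenvalue,
  and \<open>tau\<close> is the sign of this grading.\<close>

lemma tau_prod:
  assumes ax: "primitive_axis a"
  shows "tau a (x \<star> y) = tau a x \<star> tau a y"
proof -
  obtain p r where x: "even_poly a p = 0" "a \<star> r = (1/32) *\<^sub>Q r" "x = p + r"
    "\<exists>p1 p0 p4. p = p1 + p0 + p4 \<and> a \<star> p1 = p1 \<and> a \<star> p0 = 0 \<and> a \<star> p4 = (1/4) *\<^sub>Q p4"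
    using axis_decomposition[OF ax] by metis
  obtain q s where y: "even_poly a q = 0" "a \<star> s = (1/32) *\<^sub>Q s" "y = q + s"
    "\<exists>p1 p0 p4. q = p1 + p0 + p4 \<and> a \<star> p1 = p1 \<and> a \<star> p0 = 0 \<and> a \<star> p4 = (1/4) *\<^sub>Q p4"
    using axis_decomposition[OF ax] by metis
  obtain p1 p0 p4 where p: "p = p1 + p0 + p4" "a \<star> p1 = 1 *\<^sub>Q p1" "a \<star> p0 = 0 *\<^sub>Q p0" "a \<star> p4 = (1/4) *\<^sub>Q p4"
    using x(4) by auto
  obtain q1 q0 q4 where q: "q = q1 + q0 + q4" "a \<star> q1 = 1 *\<^sub>Q q1" "a \<star> q0 = 0 *\<^sub>Q q0" "a \<star> q4 = (1/4) *\<^sub>Q q4"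
    using y(4) by auto
  have ev: "1 \<in> monster_eigenvalues" "0 \<in> monster_eigenvalues" "1/4 \<in> monster_eigenvalues" "1/32 \<in> monster_eigenvalues"
    by (simp_all add: monster_eigenvalues_def)
  note F = fusion_even[OF ax]
  have "even_poly a (p \<star> q) = 0"
    unfolding p(1) q(1)
    using F[OF ev(1,1) p(2) q(2)] F[OF ev(1,2) p(2) q(3)] F[OF ev(1,3) p(2) q(4)]
     F[OF ev(2,1) p(3) q(2)] F[OF ev(2,2) p(3) q(3)] F[OF ev(2,3) p(3) q(4)]
     F[OF ev(3,1) p(4) q(2)] F[OF ev(3,2) p(4) q(3)] F[OF ev(3,3) p(4) q(4)]
    by (simp add: even_poly_linear)
  then have 1: "tau a (p \<star> q) = p \<star> q" by (rule tau_even)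
  have 2: "tau a (r \<star> s) = r \<star> s"
    using F[OF ev(4,4) x(2) y(2)] by (simp add: tau_even)
  note G = fusion_odd[OF ax]
  have 3: "tau a (p \<star> s) = - (p \<star> s)"
    using G[OF ev(1) _ p(2) y(2)] G[OF ev(2) _ p(3) y(2)] G[OF ev(3) _ p(4) y(2)]
    by (simp add: p(1) tau_linear tau_odd)
  have "tau a (q \<star> r) = - (q \<star> r)"
    using G[OF ev(1) _ q(2) x(2)] G[OF ev(2) _ q(3) x(2)] G[OF ev(3) _ q(4) x(2)]
    by (simp add: q(1) tau_linear tau_odd)
  then have 4: "tau a (r \<star> q) = - (r \<star> q)" by (simp add: prod_commute)
  show ?thesis
    by (simp add: x(3) y(3) tau_linear 1 2 3 4 tau_even[OF x(1)] tau_even[OF y(1)] tau_odd[OF x(2)] tau_odd[OF y(2)])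
qed

lemma tau_tau:
  assumes "primitive_axis a"
  shows "tau a (tau a x) = x"
proof -
  obtain p r where x: "even_poly a p = 0" "a \<star> r = (1/32) *\<^sub>Q r" "x = p + r"
    using axis_decomposition[OF assms] by metis
  have "tau a (- r) = r" using tau_odd[OF x(2)] tau_linear(3)[of a "-1" r] by simp
  then show ?thesis
    by (simp add: x(3) tau_linear tau_even[OF x(1)] tau_odd[OF x(2)])
qed

lemma carrier_alg_aut_group_UNIV:
  "f \<in> carrier (alg_aut_group UNIV) \<longleftrightarrow> bij f \<and> (\<forall>u v. f (u + v) = f u + f v) \<and>
    (\<forall>c u. f (c *\<^sub>Q u) = c *\<^sub>Q f u) \<and> (\<forall>u v. f (u \<star> v) = f u \<star> f v)"
  by (auto simp: alg_aut_group_def Bij_def)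

text \<open>The product of \<open>BijGroup\<close> means composition only for bijections; the
  trivial else branch makes the equation unconditional.\<close>

lemma alg_aut_group_UNIV_ops:
  "f \<otimes>\<^bsub>alg_aut_group UNIV\<^esub> g = (if bij f \<and> bij g then f \<circ> g else f \<otimes>\<^bsub>alg_aut_group UNIV\<^esub> g)"
  "\<one>\<^bsub>alg_aut_group UNIV\<^esub> = id"
  by (auto simp: alg_aut_group_def BijGroup_def Bij_def compose_def fun_eq_iff restrict_def)

lemma group_alg_aut_group_UNIV: "group (alg_aut_group UNIV)"
proof (rule groupI)
  fix f g assume "f \<in> carrier (alg_aut_group UNIV)" "g \<in> carrier (alg_aut_group UNIV)"
  then show "f \<otimes>\<^bsub>alg_aut_group UNIV\<^esub> g \<in> carrier (alg_aut_group UNIV)"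
    by (subst alg_aut_group_UNIV_ops) (simp add: carrier_alg_aut_group_UNIV bij_comp)
next
  fix f g h assume "f \<in> carrier (alg_aut_group UNIV)" "g \<in> carrier (alg_aut_group UNIV)" "h \<in> carrier (alg_aut_group UNIV)"
  then have "bij f" "bij g" "bij h" by (simp_all add: carrier_alg_aut_group_UNIV)
  then show "f \<otimes>\<^bsub>alg_aut_group UNIV\<^esub> g \<otimes>\<^bsub>alg_aut_group UNIV\<^esub> h =
      f \<otimes>\<^bsub>alg_aut_group UNIV\<^esub> (g \<otimes>\<^bsub>alg_aut_group UNIV\<^esub> h)"
    by (simp add: alg_aut_group_UNIV_ops(1)[of f g] alg_aut_group_UNIV_ops(1)[of g h]
      alg_aut_group_UNIV_ops(1)[of "f \<circ> g" h] alg_aut_group_UNIV_ops(1)[of f "g \<circ> h"] bij_comp o_assoc)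
next
  show "\<one>\<^bsub>alg_aut_group UNIV\<^esub> \<in> carrier (alg_aut_group UNIV)"
    by (simp add: alg_aut_group_UNIV_ops(2) carrier_alg_aut_group_UNIV)
next
  fix f assume f: "f \<in> carrier (alg_aut_group UNIV)"
  then have "bij f" by (simp add: carrier_alg_aut_group_UNIV)
  then show "\<one>\<^bsub>alg_aut_group UNIV\<^esub> \<otimes>\<^bsub>alg_aut_group UNIV\<^esub> f = f"
    by (simp add: alg_aut_group_UNIV_ops(1)[of id f] alg_aut_group_UNIV_ops(2))
  define g where "g = inv_into UNIV f"
  have g: "bij g" "g \<circ> f = id" "\<And>x. f (g x) = x" "\<And>x. g (f x) = x"
    using \<open>bij f\<close> by (auto simp: g_def bij_imp_bij_inv bij_is_inj bij_is_surj surj_f_inv_f)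
  have "g \<in> carrier (alg_aut_group UNIV)"
    using f g unfolding carrier_alg_aut_group_UNIV by (metis)
  moreover have "g \<otimes>\<^bsub>alg_aut_group UNIV\<^esub> f = \<one>\<^bsub>alg_aut_group UNIV\<^esub>"
    by (simp add: alg_aut_group_UNIV_ops(1)[of g f] alg_aut_group_UNIV_ops(2) g \<open>bij f\<close>)
  ultimately show "\<exists>y\<in>carrier (alg_aut_group UNIV). y \<otimes>\<^bsub>alg_aut_group UNIV\<^esub> f = \<one>\<^bsub>alg_aut_group UNIV\<^esub>"
    by blast
qed

lemma tau_in_alg_aut_group:
  assumes "primitive_axis a"
  shows "tau a \<in> carrier (alg_aut_group UNIV)"
proof -
  have "bij (tau a)" by (rule bij_betw_byWitness[where f' = "tau a"]) (auto simp: tau_tau assms)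
  then show ?thesis by (simp add: carrier_alg_aut_group_UNIV tau_linear tau_prod assms)
qed

text \<open>\<open>tau a\<close> is a polynomial in the multiplication by \<open>a\<close>, and
  automorphisms transport such polynomials.\<close>

lemma tau_equivariant:
  assumes "f \<in> carrier (alg_aut_group UNIV)"
  shows "tau (f a) (f x) = f (tau a x)"
proof -
  have f: "f (u + v) = f u + f v" "f (c *\<^sub>Q u) = c *\<^sub>Q f u" "f (u \<star> v) = f u \<star> f v" for u v c
    using assms by (simp_all add: carrier_alg_aut_group_UNIV)
  have "f (u - v) = f u - f v" for u v using f(1)[of "u - v" v] by (simp add: algebra_simps)
  then show ?thesis by (simp add: tau_def even_poly_def f)
qed

end

context frobenius_algebra
begin

text \<open>The 3A product formula solved for its additional vector, with the third axis written as
  \<open>tau x y\<close>. This turns an existential witness into a function of the two axes, so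
  witnesses from different algebras can be compared.\<close>

definition third_axis_u :: "'a \<Rightarrow> 'a \<Rightarrow> 'a" where
  "third_axis_u x y = (2048/135) *\<^sub>Q ((1/32) *\<^sub>Q (2 *\<^sub>Q x + 2 *\<^sub>Q y + tau x y) - x \<star> y)"

lemma tau_triple:
  assumes "x \<star> x = x" "x \<star> y = (1/32) *\<^sub>Q (2 *\<^sub>Q x + 2 *\<^sub>Q y + y') - (135/2048) *\<^sub>Q u"
    "x \<star> y' = (1/32) *\<^sub>Q (2 *\<^sub>Q x + 2 *\<^sub>Q y' + y) - (135/2048) *\<^sub>Q u"
    "x \<star> u = (1/9) *\<^sub>Q (2 *\<^sub>Q x - y - y') + (5/32) *\<^sub>Q u"
  shows "tau x y = y'"
  unfolding tau_def even_poly_def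
  by (rule vec_eqI) (simp add: assms lin_simps)

lemma third_axis_u_eq:
  assumes "x \<star> y = (1/32) *\<^sub>Q (2 *\<^sub>Q x + 2 *\<^sub>Q y + tau x y) - (135/2048) *\<^sub>Q u"
  shows "third_axis_u x y = u"
  unfolding third_axis_u_def assms by simp

text \<open>\<open>tau\<close> recovers the third axis, hence the additional vector is the same for
  the ordered pairs of axes treated here.\<close>

lemma norton_sakuma_3A_products:
  assumes "norton_sakuma_3A x y"
  defines "y' \<equiv> tau x y" and "u \<equiv> third_axis_u x y"
  shows "tau y x = y'"
    and "x \<star> y = (1/32) *\<^sub>Q (2 *\<^sub>Q x + 2 *\<^sub>Q y + y') - (135/2048) *\<^sub>Q u"
    and "x \<star> u = (1/9) *\<^sub>Q (2 *\<^sub>Q x - y - y') + (5/32) *\<^sub>Q u"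
    and "u \<star> u = u" and "third_axis_u x y' = u" and "third_axis_u y x = u"
proof -
  obtain a :: "int \<Rightarrow> 'a" and w where a: "a 0 = x" "a 1 = y" "\<And>i. a (i + 3) = a i"
    and P: "\<And>i. a i \<star> a i = a i"
      "\<And>i. a i \<star> a (i + 1) = (1/32) *\<^sub>Q (2 *\<^sub>Q a i + 2 *\<^sub>Q a (i + 1) + a (i - 1)) - (135/2048) *\<^sub>Q w"
      "\<And>i. a i \<star> w = (1/9) *\<^sub>Q (2 *\<^sub>Q a i - a (i + 1) - a (i - 1)) + (5/32) *\<^sub>Q w"
    and w: "w \<star> w = w"
    using assms(1) unfolding norton_sakuma_3A_def by blast
  define y'' where "y'' = a (-1)"
  have i: "a (-2) = y" "a 2 = y''" using a(3)[of "-2"] a(3)[of "-1"] a(2) by (simp_all add: y''_def)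
  have 1: "x \<star> x = x" "y \<star> y = y" using P(1)[of 0] P(1)[of 1] a by simp_all
  have 2: "x \<star> y = (1/32) *\<^sub>Q (2 *\<^sub>Q x + 2 *\<^sub>Q y + y'') - (135/2048) *\<^sub>Q w"
    "y'' \<star> x = (1/32) *\<^sub>Q (2 *\<^sub>Q y'' + 2 *\<^sub>Q x + y) - (135/2048) *\<^sub>Q w"
    "y \<star> y'' = (1/32) *\<^sub>Q (2 *\<^sub>Q y + 2 *\<^sub>Q y'' + x) - (135/2048) *\<^sub>Q w"
    using P(2)[of 0] P(2)[of "-1"] P(2)[of 1] a i by (simp_all add: y''_def)
  have 3: "x \<star> w = (1/9) *\<^sub>Q (2 *\<^sub>Q x - y - y'') + (5/32) *\<^sub>Q w"
    "y \<star> w = (1/9) *\<^sub>Q (2 *\<^sub>Q y - y'' - x) + (5/32) *\<^sub>Q w"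
    using P(3)[of 0] P(3)[of 1] a i by (simp_all add: y''_def)
  have t: "tau x y = y''"
    by (rule tau_triple[OF 1(1) 2(1) _ 3(1)]) (use 2(2) in \<open>simp add: prod_commute ac_simps\<close>)
  have t': "tau y x = y''"
    by (rule tau_triple[where u = w]) (use 1 2 3 in \<open>simp_all add: prod_commute ac_simps algebra_simps\<close>)
  have t'': "tau x y'' = y"
    by (rule tau_triple[where u = w]) (use 1 2 3 in \<open>simp_all add: prod_commute ac_simps algebra_simps\<close>)
  have u: "u = w" unfolding u_def by (rule third_axis_u_eq) (simp only: t 2)
  show "tau y x = y'" "x \<star> y = (1/32) *\<^sub>Q (2 *\<^sub>Q x + 2 *\<^sub>Q y + y') - (135/2048) *\<^sub>Q u"
    "x \<star> u = (1/9) *\<^sub>Q (2 *\<^sub>Q x - y - y') + (5/32) *\<^sub>Q u" "u \<star> u = u"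
    by (simp_all only: y'_def t t' u 2 3 w)
  show "third_axis_u x y' = u" unfolding y'_def t u
    by (rule third_axis_u_eq) (use 2(2) in \<open>simp add: t'' prod_commute ac_simps\<close>)
  show "third_axis_u y x = u" unfolding u
    by (rule third_axis_u_eq) (use 2(1) in \<open>simp add: t' prod_commute ac_simps\<close>)
qed

text \<open>The two 3A subalgebras of a 6A algebra share their additional basis vector.\<close>

lemma norton_sakuma_6A_third_axis_u:
  assumes "norton_sakuma_6A x y"
  shows "third_axis_u x (tau y x) = third_axis_u y (tau x y)"
proof -
  obtain a :: "int \<Rightarrow> 'a" and r w where a: "a 0 = x" "a 1 = y" "\<And>i. a (i + 6) = a i"
    and P: "\<And>i. a i \<star> a i = a i"
      "\<And>i. a i \<star> a (i + 1) =
            (1/64) *\<^sub>Q (a i + a (i + 1) - a (i - 2) - a (i - 1) - a (i + 2) - a (i + 3) + r)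
            + (45/2048) *\<^sub>Q w"
      "\<And>i. a i \<star> a (i + 2) =
            (1/32) *\<^sub>Q (2 *\<^sub>Q a i + 2 *\<^sub>Q a (i + 2) + a (i - 2)) - (135/2048) *\<^sub>Q w"
      "\<And>i. a i \<star> a (i + 3) = (1/8) *\<^sub>Q (a i + a (i + 3) - r)"
      "\<And>i. a i \<star> r = (1/8) *\<^sub>Q (a i + r - a (i + 3))"
      "\<And>i. a i \<star> w = (1/9) *\<^sub>Q (2 *\<^sub>Q a i - a (i + 2) - a (i - 2)) + (5/32) *\<^sub>Q w"
    using assms unfolding norton_sakuma_6A_def by blast
  have m: "a (i - 3) = a (i + 3)" "a (i - 4) = a (i + 2)" for i
    using a(3)[of "i - 3"] a(3)[of "i - 4"] by (simp_all add: algebra_simps)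
  have Q: "a i \<star> a (i - 1) = (1/64) *\<^sub>Q (a i + a (i - 1) - a (i + 2) - a (i + 1) - a (i - 2) - a (i + 3) + r)
            + (45/2048) *\<^sub>Q w" for i
    using P(2)[of "i - 1"] m(1)[of i] by (simp add: prod_commute algebra_simps)
  have Q2: "a i \<star> a (i - 2) = (1/32) *\<^sub>Q (2 *\<^sub>Q a i + 2 *\<^sub>Q a (i - 2) + a (i + 2)) - (135/2048) *\<^sub>Q w" for i
    using P(3)[of "i - 2"] m(2)[of i] by (simp add: prod_commute algebra_simps)
  have t1: "tau (a i) (a (i + 1)) = a (i - 1)" "tau (a i) (a (i - 1)) = a (i + 1)" for i
    unfolding tau_def even_poly_def
    by (rule vec_eqI, simp add: P Q Q2 lin_simps)+
  have t2: "tau (a i) (a (i + 2)) = a (i - 2)" "tau (a i) (a (i - 2)) = a (i + 2)" for i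
    by (rule tau_triple[OF P(1) P(3) Q2 P(6)])
       (rule tau_triple[OF P(1) Q2 P(3)], simp add: P(6) algebra_simps)
  \<comment> \<open>The axes with even index and those with odd index form the two 3A triples, and
    both use \<open>w\<close>.\<close>
  have "third_axis_u (a 0) (a (0 + 2)) = w"
    by (rule third_axis_u_eq) (simp only: t2 P(3))
  moreover have "third_axis_u (a 1) (a (1 - 2)) = w"
    by (rule third_axis_u_eq) (simp only: t2 Q2)
  moreover have "tau y x = a 2" "tau x y = a (-1)"
    using t1(2)[of 1] t1(1)[of 0] a by simp_all
  ultimately show ?thesis using a by simp
qed

end

section \<open>The group \<open>U\<^sub>3(2)\<close>\<close>

text \<open>Matrices as plain nine-tuples, so that the finite checks below run by evaluation;
  \<open>to_mat\<close> carries the results back to matrices.\<close>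

datatype m3 = M3 gf4 gf4 gf4 gf4 gf4 gf4 gf4 gf4 gf4

fun mul3 :: "m3 \<Rightarrow> m3 \<Rightarrow> m3" where
  "mul3 (M3 a b c d e f g h i) (M3 a' b' c' d' e' f' g' h' i') =
     M3 (a * a' + b * d' + c * g') (a * b' + b * e' + c * h') (a * c' + b * f' + c * i')
        (d * a' + e * d' + f * g') (d * b' + e * e' + f * h') (d * c' + e * f' + f * i')
        (g * a' + h * d' + i * g') (g * b' + h * e' + i * h') (g * c' + h * f' + i * i')"

fun adj3 :: "m3 \<Rightarrow> m3" where
  "adj3 (M3 a b c d e f g h i) = M3 (a * a) (d * d) (g * g) (b * b) (e * e) (h * h) (c * c) (f * f) (i * i)"

fun det3 :: "m3 \<Rightarrow> gf4" where
  "det3 (M3 a b c d e f g h i) = a * (e * i + f * h) + b * (d * i + f * g) + c * (d * h + e * g)"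

fun tr3 :: "m3 \<Rightarrow> gf4" where
  "tr3 (M3 a b c d e f g h i) = a + e + i"

definition one3 :: m3 where "one3 = M3 1 0 0 0 1 0 0 0 1"

definition gf4s :: "gf4 list" where "gf4s = [Ze, On, Om, Om2]"

text \<open>Conjugation is squaring, so x x x is the norm of x and the condition is hermitian length
  1.\<close>

definition unit_vectors :: "(gf4 \<times> gf4 \<times> gf4) list" where
  "unit_vectors = [(x, y, z). x \<leftarrow> gf4s, y \<leftarrow> gf4s, z \<leftarrow> gf4s, x * x * x + y * y * y + z * z * z = 1]"

definition orthogonal3 :: "gf4 \<times> gf4 \<times> gf4 \<Rightarrow> gf4 \<times> gf4 \<times> gf4 \<Rightarrow> bool" where
  "orthogonal3 v w = (case v of (x, y, z) \<Rightarrow> case w of (x', y', z') \<Rightarrow> x * x * x' + y * y * y' + z * z * z' = 0)"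

definition orthonormal_pairs :: "((gf4 \<times> gf4 \<times> gf4) \<times> (gf4 \<times> gf4 \<times> gf4)) list" where
  "orthonormal_pairs = [(v, w). v \<leftarrow> unit_vectors, w \<leftarrow> unit_vectors, orthogonal3 v w]"

text \<open>The third column of a special unitary matrix is the conjugate of the cross product of the
  first two.\<close>

fun complete3 :: "(gf4 \<times> gf4 \<times> gf4) \<times> (gf4 \<times> gf4 \<times> gf4) \<Rightarrow> m3" where
  "complete3 ((a, d, g), (b, e, h)) =
     M3 a b ((d * h + g * e) * (d * h + g * e)) d e ((g * b + a * h) * (g * b + a * h)) g h ((a * e + d * b) * (a * e + d * b))"

definition su_list :: "m3 list" where
  "su_list = map complete3 orthonormal_pairs"

text \<open>Products of diagonal matrices with powers of a cyclic shift, one for each class modulo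
  scalars: they represent the elementary abelian subgroup of order 9 in
  \<open>U_3_2\<close>.\<close>

definition cyclic_reps :: "m3 list" where
  "cyclic_reps = [M3 On Ze Ze Ze On Ze Ze Ze On, M3 On Ze Ze Ze Om Ze Ze Ze Om2, M3 On Ze Ze Ze Om2 Ze Ze Ze Om,
     M3 Ze On Ze Ze Ze On On Ze Ze, M3 Ze Om Ze Ze Ze Om2 On Ze Ze, M3 Ze Om2 Ze Ze Ze Om On Ze Ze,
     M3 Ze Ze On On Ze Ze Ze On Ze, M3 Ze Ze Om On Ze Ze Ze Om2 Ze, M3 Ze Ze Om2 On Ze Ze Ze Om Ze]"

definition shift3 :: m3 where
  "shift3 = M3 Ze On Ze Ze Ze On On Ze Ze"

text \<open>Witnesses for \<open>cyclic_conjugate\<close>: conjugating \<open>shift3\<close> by them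
  reaches, up to scalars, every nontrivial element represented in
  \<open>cyclic_reps\<close>.\<close>

definition conj_reps :: "m3 list" where
  "conj_reps = [M3 On On On On Om2 Om On Om Om2, M3 On On On On Om Om2 On Om2 Om, M3 Ze On Ze Ze Ze On On Ze Ze,
    M3 On On Om2 On Om Om Om On Om, M3 On On Om On Om2 Om2 Om2 On Om2, M3 Ze Ze On Ze On Ze On Ze Ze,
    M3 On On Om2 On Om2 On Om Om2 Om2, M3 On On Om On Om On Om2 Om Om]"

definition scalars3 :: "m3 list" where
  "scalars3 = map (\<lambda>c. M3 c 0 0 0 c 0 0 0 c) [On, Om, Om2]"

definition is_scalar3 :: "m3 \<Rightarrow> bool" where
  "is_scalar3 s = list_ex (\<lambda>z. s = z) scalars3"

text \<open>Selects one matrix in each class modulo scalars by making the first nonzero entry of the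
  first column equal to 1.\<close>

fun normalized3 :: "m3 \<Rightarrow> bool" where
  "normalized3 (M3 a b c d e f g h i) \<longleftrightarrow> (if a \<noteq> 0 then a = 1 else if d \<noteq> 0 then d = 1 else g = 1)"

definition su_reps :: "m3 list" where
  "su_reps = filter normalized3 su_list"

definition unitary3 :: "m3 \<Rightarrow> bool" where
  "unitary3 s \<longleftrightarrow> mul3 (adj3 s) s = one3 \<and> det3 s = 1"

lemma unitary_lists: "list_all unitary3 su_list" "list_all unitary3 scalars3"
    "list_all unitary3 cyclic_reps" "list_all unitary3 conj_reps"
  by code_simp+

lemma third_column: "list_all (\<lambda>(v, w). list_all (\<lambda>x. orthogonal3 v x \<and> orthogonal3 w x \<longrightarrow>
    (case (v, w, x) of ((a, d, g), (b, e, h), (c, f, i)) \<Rightarrow>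
      det3 (M3 a b c d e f g h i) = 1 \<longrightarrow> M3 a b c d e f g h i = complete3 (v, w))) unit_vectors) orthonormal_pairs"
  by code_simp

lemma scalars3_central: "list_all (\<lambda>s. list_all (\<lambda>z. mul3 z s = mul3 s z) scalars3) su_list"
  by code_simp

lemma central_scalars3:
  "list_all (\<lambda>s. list_all (\<lambda>t. mul3 s t = mul3 t s) cyclic_reps \<longrightarrow> is_scalar3 s) su_list"
  by code_simp

lemma su_normalize: "list_all (\<lambda>s. list_ex (\<lambda>z. normalized3 (mul3 z s)) scalars3) su_list"
  by code_simp

lemma normalized_unique:
  "list_all (\<lambda>s. normalized3 s \<longrightarrow> list_all (\<lambda>z. normalized3 (mul3 z s) \<longrightarrow> mul3 z s = s) scalars3) su_list"
  by code_simp

lemma reps_length: "length su_reps = 72" "length cyclic_reps = 9"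
  by code_simp+

lemma reps_distinct: "distinct su_reps" "distinct cyclic_reps"
  by code_simp+

lemma cyclic_reps_normalized: "list_all normalized3 cyclic_reps"
  by code_simp

text \<open>Identifies the subgroup of order 9 by an equation: modulo scalars it consists of the
  elements with trivial cube.\<close>

lemma cube_scalar_iff_cyclic:
  "list_all (\<lambda>s. is_scalar3 (mul3 (mul3 s s) s) \<longleftrightarrow> list_ex (\<lambda>z. list_ex (\<lambda>r. s = mul3 z r) cyclic_reps) scalars3) su_list"
  by code_simp

lemma cyclic_commute:
  "list_all (\<lambda>s. list_all (\<lambda>t. list_ex (\<lambda>z. mul3 s t = mul3 z (mul3 t s)) scalars3) cyclic_reps) cyclic_reps"
  by code_simp

lemma cyclic_closed:
  "list_all (\<lambda>s. list_all (\<lambda>t. is_scalar3 (mul3 (mul3 (mul3 s t) (mul3 s t)) (mul3 s t))) cyclic_reps) cyclic_reps"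
  by code_simp

lemma cyclic_conjugate:
  "list_all (\<lambda>t. is_scalar3 t \<or>
    list_ex (\<lambda>g. list_ex (\<lambda>z. mul3 g shift3 = mul3 z (mul3 t g)) scalars3) conj_reps) cyclic_reps"
  by code_simp

lemma shift3_cyclic: "list_ex (\<lambda>s. s = shift3) cyclic_reps"
  by code_simp

definition to_mat :: "m3 \<Rightarrow> gf4 ^ 3 ^ 3" where
  "to_mat s = (case s of M3 a b c d e f g h i \<Rightarrow> vector [vector [a, b, c], vector [d, e, f], vector [g, h, i]])"

lemma to_mat_surj: "\<exists>s. A = to_mat s"
  by (rule exI[of _ "M3 (A$1$1) (A$1$2) (A$1$3) (A$2$1) (A$2$2) (A$2$3) (A$3$1) (A$3$2) (A$3$3)"])
     (simp add: to_mat_def vec_eq_iff forall_3 vector_3)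

lemma to_mat_inj: "to_mat s = to_mat t \<longleftrightarrow> s = t"
  by (cases s; cases t) (auto simp: to_mat_def vec_eq_iff forall_3 vector_3)

lemma to_mat_mult: "to_mat s ** to_mat t = to_mat (mul3 s t)"
  by (cases s; cases t) (simp add: to_mat_def vec_eq_iff forall_3 vector_3 matrix_matrix_mult_def sum_3)

lemma to_mat_adjoint: "gf4_adjoint (to_mat s) = to_mat (adj3 s)"
  by (cases s) (simp add: to_mat_def vec_eq_iff forall_3 vector_3 gf4_adjoint_def power2_eq_square)

lemma to_mat_one: "mat 1 = to_mat one3"
  by (simp add: to_mat_def one3_def vec_eq_iff forall_3 vector_3 mat_def)

lemma gf4_minus: "x - y = x + (y :: gf4)" "- x = (x :: gf4)"
  by (simp_all add: minus_gf4_def uminus_gf4_def)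

lemma to_mat_det: "det (to_mat s) = det3 s"
  by (cases s) (simp add: to_mat_def det_3 vector_3 gf4_minus algebra_simps)

lemma SU_carrier_iff: "to_mat s \<in> carrier SU_3_2 \<longleftrightarrow> unitary3 s"
  by (simp add: unitary3_def SU_3_2_def to_mat_adjoint to_mat_mult to_mat_one to_mat_inj to_mat_det)

lemma gf4s_set: "x \<in> set gf4s"
  by (cases x) (auto simp: gf4s_def)

lemma unit_vectors_set: "(x, y, z) \<in> set unit_vectors \<longleftrightarrow> x * x * x + y * y * y + z * z * z = 1"
  using gf4s_set by (auto simp: unit_vectors_def)

lemma SU_carrier: "carrier SU_3_2 = to_mat ` set su_list"
proof
  show "to_mat ` set su_list \<subseteq> carrier SU_3_2"
    using unitary_lists(1) by (auto simp: SU_carrier_iff list_all_iff)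
  show "carrier SU_3_2 \<subseteq> to_mat ` set su_list"
  proof
    fix A assume A: "A \<in> carrier SU_3_2"
    obtain s where s: "A = to_mat s" using to_mat_surj by blast
    obtain a b c d e f g h i where t: "s = M3 a b c d e f g h i" by (cases s)
    have *: "mul3 (adj3 s) s = one3" "det3 s = 1" using A by (simp_all add: s SU_carrier_iff unitary3_def)
    have "(a, d, g) \<in> set unit_vectors" "(b, e, h) \<in> set unit_vectors" "(c, f, i) \<in> set unit_vectors"
      "orthogonal3 (a, d, g) (b, e, h)" "orthogonal3 (a, d, g) (c, f, i)" "orthogonal3 (b, e, h) (c, f, i)"
      using *(1) by (simp_all add: t one3_def unit_vectors_set orthogonal3_def)
    moreover from this have "((a, d, g), (b, e, h)) \<in> set orthonormal_pairs"
      unfolding orthonormal_pairs_def by force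
    ultimately have "s = complete3 ((a, d, g), (b, e, h))"
      using third_column *(2) unfolding list_all_iff t by (fastforce simp del: det3.simps complete3.simps)
    then have "s \<in> set su_list"
      using \<open>((a, d, g), (b, e, h)) \<in> set orthonormal_pairs\<close> by (simp add: su_list_def del: complete3.simps)
    then show "A \<in> to_mat ` set su_list" using s by blast
  qed
qed

lemma gf4_square_add: "(x + y)\<^sup>2 = x\<^sup>2 + (y :: gf4)\<^sup>2"
  by (cases x; cases y) (simp_all add: power2_eq_square plus_gf4_def times_gf4_def)

lemma gf4_power4: "x ^ 4 = (x :: gf4)"
  by (cases x) (simp_all add: power4_eq_xxxx times_gf4_def)

lemma gf4_adjoint_mult: "gf4_adjoint (A ** B) = gf4_adjoint B ** gf4_adjoint A"
  by (simp add: gf4_adjoint_def vec_eq_iff matrix_matrix_mult_def sum_3 gf4_square_add power_mult_distrib mult.commute)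

lemma gf4_adjoint_adjoint: "gf4_adjoint (gf4_adjoint A) = A"
  by (simp add: gf4_adjoint_def vec_eq_iff gf4_power4)

lemma SU_3_2_ops: "A \<otimes>\<^bsub>SU_3_2\<^esub> B = A ** B" "\<one>\<^bsub>SU_3_2\<^esub> = mat 1"
  by (simp_all add: SU_3_2_def)

lemma group_SU_3_2: "group SU_3_2"
proof (rule groupI)
  fix A B assume "A \<in> carrier SU_3_2" "B \<in> carrier SU_3_2"
  then have "gf4_adjoint A ** A = mat 1" "det A = 1" "gf4_adjoint B ** B = mat 1" "det B = 1"
    by (simp_all add: SU_3_2_def)
  moreover have "gf4_adjoint (A ** B) ** (A ** B) = gf4_adjoint B ** ((gf4_adjoint A ** A) ** B)"
    by (simp add: gf4_adjoint_mult matrix_mul_assoc)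
  ultimately show "A \<otimes>\<^bsub>SU_3_2\<^esub> B \<in> carrier SU_3_2"
    by (simp add: SU_3_2_def det_mul)
next
  show "\<one>\<^bsub>SU_3_2\<^esub> \<in> carrier SU_3_2"
    by (simp add: SU_3_2_ops to_mat_one SU_carrier_iff) (simp add: unitary3_def one3_def zero_gf4_def one_gf4_def plus_gf4_def times_gf4_def)
next
  fix A assume A: "A \<in> carrier SU_3_2"
  then have AA: "gf4_adjoint A ** A = mat 1" "det A = 1" by (simp_all add: SU_3_2_def)
  then have "A ** gf4_adjoint A = mat 1" by (simp add: matrix_left_right_inverse)
  moreover have "det (gf4_adjoint A) = 1"
    using AA det_mul[of "gf4_adjoint A" A] by simp
  ultimately have "gf4_adjoint A \<in> carrier SU_3_2"
    by (simp add: SU_3_2_def gf4_adjoint_adjoint)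
  then show "\<exists>B\<in>carrier SU_3_2. B \<otimes>\<^bsub>SU_3_2\<^esub> A = \<one>\<^bsub>SU_3_2\<^esub>"
    using AA by (auto simp: SU_3_2_ops)
qed (simp_all add: SU_3_2_ops matrix_mul_assoc)

lemma group_center_normal:
  fixes G (structure)
  assumes "group G"
  shows "group_center G \<lhd> G"
proof -
  interpret group G by fact
  have sub: "subgroup (group_center G) G"
  proof (rule subgroupI)
    show "group_center G \<subseteq> carrier G" by (auto simp: group_center_def)
    show "group_center G \<noteq> {}" by (auto simp: group_center_def)
  next
    fix z assume z: "z \<in> group_center G"
    then have zG: "z \<in> carrier G" unfolding group_center_def by blast
    have "inv z \<otimes> g = g \<otimes> inv z" if g: "g \<in> carrier G" for g
    proof -
      have "inv z \<otimes> g = inv z \<otimes> (g \<otimes> z) \<otimes> inv z" using g zG by (simp add: m_assoc)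
      also have "g \<otimes> z = z \<otimes> g" using z g unfolding group_center_def by simp
      finally show ?thesis using g zG by (simp add: m_assoc[symmetric])
    qed
    then show "inv z \<in> group_center G" using inv_closed[OF zG] unfolding group_center_def by blast
  next
    fix z w assume z: "z \<in> group_center G" and w: "w \<in> group_center G"
    have "z \<otimes> w \<otimes> g = g \<otimes> (z \<otimes> w)" if g: "g \<in> carrier G" for g
    proof -
      have c: "z \<in> carrier G" "w \<in> carrier G" "z \<otimes> g = g \<otimes> z" "w \<otimes> g = g \<otimes> w"
        using z w g by (auto simp: group_center_def)
      have "z \<otimes> w \<otimes> g = z \<otimes> (g \<otimes> w)" using c g by (simp only: m_assoc)
      also have "\<dots> = g \<otimes> (z \<otimes> w)" using c g by (simp only: m_assoc[symmetric])
      finally show ?thesis .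
    qed
    moreover have "z \<otimes> w \<in> carrier G" using z w m_closed unfolding group_center_def by blast
    ultimately show "z \<otimes> w \<in> group_center G" unfolding group_center_def by blast
  qed
  show ?thesis
  proof (rule normalI[OF sub], rule ballI)
    fix x assume "x \<in> carrier G"
    then show "group_center G #> x = x <# group_center G"
      by (auto simp: r_coset_def l_coset_def group_center_def)
  qed
qed

interpretation SU: group SU_3_2 by (rule group_SU_3_2)

abbreviation SU_center :: "(gf4 ^ 3 ^ 3) set" where
  "SU_center \<equiv> group_center SU_3_2"

interpretation SUZ: normal SU_center SU_3_2
  by (rule group_center_normal[OF group_SU_3_2])

interpretation U32: group U_3_2
  unfolding U_3_2_def by (rule SUZ.factorgroup_is_group)

lemma unitary3_iff: "unitary3 s \<longleftrightarrow> s \<in> set su_list"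
proof -
  have "inj to_mat" by (rule injI) (simp add: to_mat_inj)
  then show ?thesis
    by (simp only: SU_carrier_iff[symmetric] SU_carrier inj_image_mem_iff)
qed

lemma unitary3_reps: "s \<in> set scalars3 \<Longrightarrow> unitary3 s" "s \<in> set cyclic_reps \<Longrightarrow> unitary3 s" "s \<in> set conj_reps \<Longrightarrow> unitary3 s"
  using bspec[OF unitary_lists(2)[unfolded list_all_iff]] bspec[OF unitary_lists(3)[unfolded list_all_iff]]
    bspec[OF unitary_lists(4)[unfolded list_all_iff]] by (simp_all only:)

lemma unitary3_mul3: "unitary3 s \<Longrightarrow> unitary3 t \<Longrightarrow> unitary3 (mul3 s t)"
  using SU.m_closed[of "to_mat s" "to_mat t"] unfolding SU_3_2_ops to_mat_mult SU_carrier_iff by blast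

lemma is_scalar3_iff: "is_scalar3 s \<longleftrightarrow> s \<in> set scalars3"
  by (auto simp: is_scalar3_def list_ex_iff)

lemma SU_center_eq: "SU_center = to_mat ` set scalars3"
proof
  show "to_mat ` set scalars3 \<subseteq> SU_center"
    using scalars3_central unitary3_reps(1)
    by (auto simp: group_center_def SU_carrier_iff SU_3_2_ops SU_carrier to_mat_mult list_all_iff simp flip: unitary3_iff)
  show "SU_center \<subseteq> to_mat ` set scalars3"
  proof
    fix A assume A: "A \<in> SU_center"
    then obtain s where s: "A = to_mat s" "s \<in> set su_list" by (auto simp: group_center_def SU_carrier)
    have "mul3 s t = mul3 t s" if "t \<in> set cyclic_reps" for t
    proof -
      have "to_mat t \<in> carrier SU_3_2" using unitary3_reps(2)[OF that] by (simp only: SU_carrier_iff)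
      then have "to_mat s \<otimes>\<^bsub>SU_3_2\<^esub> to_mat t = to_mat t \<otimes>\<^bsub>SU_3_2\<^esub> to_mat s"
        using A unfolding group_center_def s by blast
      then show ?thesis by (simp only: SU_3_2_ops to_mat_mult to_mat_inj)
    qed
    then show "A \<in> to_mat ` set scalars3"
      using central_scalars3 s unfolding list_all_iff is_scalar3_iff by blast
  qed
qed

definition u32_class :: "m3 \<Rightarrow> (gf4 ^ 3 ^ 3) set" where
  "u32_class s = SU_center #>\<^bsub>SU_3_2\<^esub> to_mat s"

lemma u32_class_carrier: "carrier U_3_2 = u32_class ` {s. unitary3 s}"
  unfolding U_3_2_def FactGroup_def RCOSETS_def u32_class_def
  using SU_carrier unitary3_iff by auto

lemma u32_class_in: "unitary3 s \<Longrightarrow> u32_class s \<in> carrier U_3_2"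
  using u32_class_carrier by blast

lemma u32_class_mult:
  "unitary3 s \<Longrightarrow> unitary3 t \<Longrightarrow> u32_class s \<otimes>\<^bsub>U_3_2\<^esub> u32_class t = u32_class (mul3 s t)"
  unfolding U_3_2_def FactGroup_def u32_class_def
  using SUZ.rcos_sum[of "to_mat s" "to_mat t"] SU_carrier_iff
  by (simp add: SU_3_2_ops to_mat_mult)

lemma u32_class_eq_iff:
  assumes "unitary3 s" "unitary3 t"
  shows "u32_class s = u32_class t \<longleftrightarrow> (\<exists>z\<in>set scalars3. s = mul3 z t)"
proof -
  have c: "to_mat s \<in> carrier SU_3_2" "to_mat t \<in> carrier SU_3_2" using assms by (simp_all only: SU_carrier_iff)
  have "u32_class s = u32_class t \<longleftrightarrow> to_mat s \<in> SU_center #>\<^bsub>SU_3_2\<^esub> to_mat t"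
    unfolding u32_class_def
    using SU.repr_independence[OF _ c(2) SUZ.subgroup_axioms] SU.rcos_self[OF c(1) SUZ.subgroup_axioms] by metis
  also have "\<dots> \<longleftrightarrow> (\<exists>z\<in>set scalars3. s = mul3 z t)"
    by (auto simp: r_coset_def SU_center_eq SU_3_2_ops to_mat_mult to_mat_inj)
  finally show ?thesis .
qed

lemma unitary3_one: "unitary3 one3"
  using SU.one_closed unfolding SU_3_2_ops to_mat_one SU_carrier_iff .

lemma mul3_one: "mul3 s one3 = s"
  by (cases s) (simp add: one3_def)

lemma u32_class_one: "\<one>\<^bsub>U_3_2\<^esub> = u32_class one3"
  unfolding U_3_2_def FactGroup_def u32_class_def
  using SU.coset_mult_one[of SU_center] SUZ.subset by (simp add: to_mat_one[symmetric] SU_3_2_ops)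

lemma u32_class_eq_one: "unitary3 s \<Longrightarrow> u32_class s = \<one>\<^bsub>U_3_2\<^esub> \<longleftrightarrow> s \<in> set scalars3"
  by (simp add: u32_class_one u32_class_eq_iff unitary3_one mul3_one)

text \<open>An equation is invariant under isomorphism and conjugation, so the subgroup can be
  recovered in any group isomorphic to \<open>U_3_2\<close>.\<close>

definition u32_core :: "(gf4 ^ 3 ^ 3) set set" where
  "u32_core = {x \<in> carrier U_3_2. x \<otimes>\<^bsub>U_3_2\<^esub> x \<otimes>\<^bsub>U_3_2\<^esub> x = \<one>\<^bsub>U_3_2\<^esub>}"

lemma u32_core_eq: "u32_core = u32_class ` set cyclic_reps"
proof -
  have "u32_class s \<in> u32_core \<longleftrightarrow> (\<exists>z\<in>set scalars3. \<exists>r\<in>set cyclic_reps. s = mul3 z r)" if s: "unitary3 s" for s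
  proof -
    have "u32_class s \<in> u32_core \<longleftrightarrow> is_scalar3 (mul3 (mul3 s s) s)"
      unfolding u32_core_def is_scalar3_iff
      using u32_class_in[OF s] u32_class_eq_one[OF unitary3_mul3[OF unitary3_mul3[OF s s] s]]
      by (simp only: mem_Collect_eq u32_class_mult[OF s s] u32_class_mult[OF unitary3_mul3[OF s s] s] simp_thms)
    also have "\<dots> \<longleftrightarrow> (\<exists>z\<in>set scalars3. \<exists>r\<in>set cyclic_reps. s = mul3 z r)"
      using cube_scalar_iff_cyclic s unfolding unitary3_iff list_all_iff list_ex_iff by blast
    finally show ?thesis .
  qed
  note * = this
  show ?thesis
  proof
    show "u32_core \<subseteq> u32_class ` set cyclic_reps"
    proof
      fix x assume x: "x \<in> u32_core"
      then have "x \<in> carrier U_3_2" by (simp add: u32_core_def)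
      then obtain s where s: "unitary3 s" "x = u32_class s" using u32_class_carrier by blast
      then obtain z r where zr: "z \<in> set scalars3" "r \<in> set cyclic_reps" "s = mul3 z r"
        using * x by blast
      then have "x = u32_class r"
        using s u32_class_eq_iff[OF s(1) unitary3_reps(2)] by blast
      then show "x \<in> u32_class ` set cyclic_reps" using zr by blast
    qed
    have one: "one3 \<in> set scalars3" "mul3 one3 r = r" for r
      by (simp add: scalars3_def one3_def one_gf4_def) (cases r, simp add: one3_def)
    show "u32_class ` set cyclic_reps \<subseteq> u32_core"
    proof
      fix x assume "x \<in> u32_class ` set cyclic_reps"
      then obtain r where r: "r \<in> set cyclic_reps" "x = u32_class r" by blast
      then show "x \<in> u32_core" using *[OF unitary3_reps(2)[OF r(1)]] one(1) one(2)[of r, symmetric] by blast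
    qed
  qed
qed

lemma normalized_inj:
  assumes "s \<in> set su_list" "t \<in> set su_list" "normalized3 s" "normalized3 t" "u32_class s = u32_class t"
  shows "s = t"
proof -
  obtain z where "z \<in> set scalars3" "s = mul3 z t"
    using assms u32_class_eq_iff unfolding unitary3_iff[symmetric] by blast
  then show ?thesis using normalized_unique assms unfolding list_all_iff by blast
qed

lemma card_u32_core: "card u32_core = 9"
proof -
  have "inj_on u32_class (set cyclic_reps)"
    by (rule inj_onI, rule normalized_inj)
       (use cyclic_reps_normalized unitary3_reps(2) in \<open>simp_all only: list_all_iff unitary3_iff\<close>)
  then show ?thesis
    by (simp only: u32_core_eq card_image distinct_card reps_distinct reps_length)
qed

lemma card_U_3_2: "card (carrier U_3_2) = 72"
proof -
  have "carrier U_3_2 = u32_class ` set su_reps"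
  proof -
    have "\<exists>r\<in>set su_reps. u32_class s = u32_class r" if s: "s \<in> set su_list" for s
    proof -
      obtain z where z: "z \<in> set scalars3" "normalized3 (mul3 z s)"
        using bspec[OF su_normalize[unfolded list_all_iff] s] unfolding list_ex_iff by blast
      have us: "unitary3 s" using s by (simp only: unitary3_iff)
      have u: "unitary3 (mul3 z s)" by (rule unitary3_mul3[OF unitary3_reps(1)[OF z(1)] us])
      then have "mul3 z s \<in> set su_reps" using z(2) by (simp add: su_reps_def unitary3_iff)
      moreover have "u32_class (mul3 z s) = u32_class s"
        using u32_class_eq_iff[OF u us] z(1) by blast
      ultimately show ?thesis by metis
    qed
    then have "u32_class ` set su_list \<subseteq> u32_class ` set su_reps" by blast
    moreover have "u32_class ` set su_reps \<subseteq> u32_class ` set su_list"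
      by (rule image_mono) (auto simp: su_reps_def)
    ultimately show ?thesis unfolding u32_class_carrier unitary3_iff by auto
  qed
  moreover have "inj_on u32_class (set su_reps)"
    by (rule inj_onI, rule normalized_inj) (simp_all add: su_reps_def)
  ultimately show ?thesis
    by (simp only: card_image distinct_card reps_distinct reps_length)
qed

lemma u32_core_mult:
  assumes "x \<in> u32_core" "y \<in> u32_core"
  shows "x \<otimes>\<^bsub>U_3_2\<^esub> y \<in> u32_core" "x \<otimes>\<^bsub>U_3_2\<^esub> y = y \<otimes>\<^bsub>U_3_2\<^esub> x"
proof -
  obtain s t where s: "s \<in> set cyclic_reps" "x = u32_class s" and t: "t \<in> set cyclic_reps" "y = u32_class t"
    using assms by (auto simp: u32_core_eq)
  note us = unitary3_reps(2)[OF s(1)] and ut = unitary3_reps(2)[OF t(1)]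
  note ust = unitary3_mul3[OF us ut] and uts = unitary3_mul3[OF ut us]
  have "is_scalar3 (mul3 (mul3 (mul3 s t) (mul3 s t)) (mul3 s t))"
    using cyclic_closed s t unfolding list_all_iff by blast
  then show "x \<otimes>\<^bsub>U_3_2\<^esub> y \<in> u32_core"
    using u32_class_eq_one[OF unitary3_mul3[OF unitary3_mul3[OF ust ust] ust]] u32_class_in[OF ust]
    unfolding u32_core_def s t is_scalar3_iff u32_class_mult[OF us ut]
    by (simp only: mem_Collect_eq u32_class_mult[OF ust ust] u32_class_mult[OF unitary3_mul3[OF ust ust] ust] simp_thms)
  show "x \<otimes>\<^bsub>U_3_2\<^esub> y = y \<otimes>\<^bsub>U_3_2\<^esub> x"
    unfolding s t u32_class_mult[OF us ut] u32_class_mult[OF ut us] u32_class_eq_iff[OF ust uts]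
    using cyclic_commute s t unfolding list_all_iff list_ex_iff by blast
qed

text \<open>Both elements are reached from the class of \<open>shift3\<close>; one conjugator
  composed with the inverse of the other connects them.\<close>

lemma u32_core_transitive:
  assumes "x \<in> u32_core" "y \<in> u32_core" "x \<noteq> \<one>\<^bsub>U_3_2\<^esub>" "y \<noteq> \<one>\<^bsub>U_3_2\<^esub>"
  shows "\<exists>g\<in>carrier U_3_2. g \<otimes>\<^bsub>U_3_2\<^esub> x = y \<otimes>\<^bsub>U_3_2\<^esub> g"
proof -
  have sh: "shift3 \<in> set cyclic_reps" using shift3_cyclic by (auto simp: list_ex_iff)
  define c where "c = u32_class shift3"
  have cU: "c \<in> carrier U_3_2" unfolding c_def by (rule u32_class_in[OF unitary3_reps(2)[OF sh]])
  have *: "\<exists>g\<in>carrier U_3_2. g \<otimes>\<^bsub>U_3_2\<^esub> c = y \<otimes>\<^bsub>U_3_2\<^esub> g" if y: "y \<in> u32_core" "y \<noteq> \<one>\<^bsub>U_3_2\<^esub>" for y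
  proof -
    obtain t where t: "t \<in> set cyclic_reps" "y = u32_class t" using y by (auto simp: u32_core_eq)
    note ut = unitary3_reps(2)[OF t(1)]
    have "\<not> is_scalar3 t" using y u32_class_eq_one[OF ut] by (simp add: t is_scalar3_iff)
    then obtain g z where g: "g \<in> set conj_reps" "z \<in> set scalars3" "mul3 g shift3 = mul3 z (mul3 t g)"
      using bspec[OF cyclic_conjugate[unfolded list_all_iff list_ex_iff] t(1)] by blast
    note ug = unitary3_reps(3)[OF g(1)]
    have "u32_class g \<otimes>\<^bsub>U_3_2\<^esub> c = y \<otimes>\<^bsub>U_3_2\<^esub> u32_class g"
      unfolding c_def t u32_class_mult[OF ug unitary3_reps(2)[OF sh]] u32_class_mult[OF ut ug]
        u32_class_eq_iff[OF unitary3_mul3[OF ug unitary3_reps(2)[OF sh]] unitary3_mul3[OF ut ug]]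
      using g by blast
    then show ?thesis using u32_class_in[OF ug] by blast
  qed
  obtain g where g: "g \<in> carrier U_3_2" "g \<otimes>\<^bsub>U_3_2\<^esub> c = x \<otimes>\<^bsub>U_3_2\<^esub> g" using *[OF assms(1,3)] by blast
  obtain h where h: "h \<in> carrier U_3_2" "h \<otimes>\<^bsub>U_3_2\<^esub> c = y \<otimes>\<^bsub>U_3_2\<^esub> h" using *[OF assms(2,4)] by blast
  have xy: "x \<in> carrier U_3_2" "y \<in> carrier U_3_2" using assms by (auto simp: u32_core_def)
  let ?k = "h \<otimes>\<^bsub>U_3_2\<^esub> inv\<^bsub>U_3_2\<^esub> g"
  have gi: "inv\<^bsub>U_3_2\<^esub> g \<in> carrier U_3_2" using g by simp
  have "inv\<^bsub>U_3_2\<^esub> g \<otimes>\<^bsub>U_3_2\<^esub> x = inv\<^bsub>U_3_2\<^esub> g \<otimes>\<^bsub>U_3_2\<^esub> (x \<otimes>\<^bsub>U_3_2\<^esub> g) \<otimes>\<^bsub>U_3_2\<^esub> inv\<^bsub>U_3_2\<^esub> g"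
    using g(1) xy gi by (simp add: U32.m_assoc)
  also have "\<dots> = c \<otimes>\<^bsub>U_3_2\<^esub> inv\<^bsub>U_3_2\<^esub> g"
    using g(1) cU gi by (simp add: g(2)[symmetric] U32.m_assoc[symmetric])
  finally have "?k \<otimes>\<^bsub>U_3_2\<^esub> x = (h \<otimes>\<^bsub>U_3_2\<^esub> c) \<otimes>\<^bsub>U_3_2\<^esub> inv\<^bsub>U_3_2\<^esub> g"
    using h(1) gi xy cU by (simp add: U32.m_assoc)
  also have "\<dots> = y \<otimes>\<^bsub>U_3_2\<^esub> ?k"
    using h gi xy by (simp add: U32.m_assoc)
  finally have "?k \<otimes>\<^bsub>U_3_2\<^esub> x = y \<otimes>\<^bsub>U_3_2\<^esub> ?k" .
  then show ?thesis using gi h(1) by blast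
qed

section \<open>Groups with the structure \<open>3\<^sup>2:Q\<^sub>8:2\<close>\<close>

lemma even_card_moved:
  assumes "finite S" "\<And>x. x \<in> S \<Longrightarrow> h x \<in> S" "\<And>x. x \<in> S \<Longrightarrow> h (h x) = x" "\<And>x. x \<in> S \<Longrightarrow> h x \<noteq> x"
  shows "even (card S)"
proof -
  have S: "S = \<Union>((\<lambda>x. {x, h x}) ` S)" using assms(2) by auto
  have "2 dvd card (\<Union>((\<lambda>x. {x, h x}) ` S))"
  proof (rule dvd_partition)
    show "finite (\<Union>((\<lambda>x. {x, h x}) ` S))" using assms(1) by auto
    show "\<forall>c\<in>(\<lambda>x. {x, h x}) ` S. 2 dvd card c"
    proof
      fix c assume "c \<in> (\<lambda>x. {x, h x}) ` S"
      then obtain x where x: "x \<in> S" "c = {x, h x}" by auto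
      have "x \<noteq> h x" using assms(4)[OF x(1)] by metis
      then show "2 dvd card c" using x(2) by simp
    qed
    show "\<forall>c\<in>(\<lambda>x. {x, h x}) ` S. \<forall>d\<in>(\<lambda>x. {x, h x}) ` S. c \<noteq> d \<longrightarrow> c \<inter> d = {}"
      using assms(3) by auto (metis assms(3))+
  qed
  then show ?thesis using S by simp
qed

lemma even_card_fixed_points:
  assumes "finite S" "\<And>x. x \<in> S \<Longrightarrow> h x \<in> S" "\<And>x. x \<in> S \<Longrightarrow> h (h x) = x"
  shows "even (card S) \<longleftrightarrow> even (card {x \<in> S. h x = x})"
proof -
  have "even (card {x \<in> S. h x \<noteq> x})"
  proof (rule even_card_moved[of _ h])
    show "finite {x \<in> S. h x \<noteq> x}" using assms(1) by simp
    fix x assume "x \<in> {x \<in> S. h x \<noteq> x}"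
    then have x: "x \<in> S" "h x \<noteq> x" by auto
    then show "h (h x) = x" "h x \<noteq> x" using assms(3) by auto
    then show "h x \<in> {x \<in> S. h x \<noteq> x}" using assms(2)[OF x(1)] by auto
  qed
  moreover have "card S = card {x \<in> S. h x = x} + card {x \<in> S. h x \<noteq> x}"
    by (subst card_Un_disjoint[symmetric]) (use assms(1) in \<open>auto intro: arg_cong[where f = card]\<close>)
  ultimately show ?thesis by simp
qed

lemma three_dvd_card:
  assumes "finite S" "\<And>x. x \<in> S \<Longrightarrow> h x \<in> S" "\<And>x. x \<in> S \<Longrightarrow> h (h (h x)) = x" "\<And>x. x \<in> S \<Longrightarrow> h x \<noteq> x"
  shows "3 dvd card S"
proof -
  let ?o = "\<lambda>x. {x, h x, h (h x)}"
  have S: "S = \<Union>(?o ` S)" using assms(2) by auto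
  have "3 dvd card (\<Union>(?o ` S))"
  proof (rule dvd_partition)
    show "finite (\<Union>(?o ` S))" using assms(1) by auto
    show "\<forall>c\<in>?o ` S. 3 dvd card c"
    proof
      fix c assume "c \<in> ?o ` S"
      then obtain x where x: "x \<in> S" "c = ?o x" by auto
      have "h x \<noteq> x" "h (h x) \<noteq> h x" "h (h x) \<noteq> x"
        using assms(2-4) x by metis+
      then have "card c = 3" using x by simp
      then show "3 dvd card c" by simp
    qed
    have o: "?o x = ?o y" if "x \<in> S" "y \<in> ?o x" for x y
      using that assms(3)[OF that(1)] by auto
    show "\<forall>c\<in>?o ` S. \<forall>d\<in>?o ` S. c \<noteq> d \<longrightarrow> c \<inter> d = {}"
    proof (intro ballI impI)
      fix c d assume "c \<in> ?o ` S" "d \<in> ?o ` S" and ne: "c \<noteq> d"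
      then obtain x y where xy: "x \<in> S" "y \<in> S" "c = ?o x" "d = ?o y" by blast
      show "c \<inter> d = {}"
      proof (rule ccontr)
        assume "c \<inter> d \<noteq> {}"
        then obtain w where "w \<in> ?o x" "w \<in> ?o y" using xy by blast
        then have "?o x = ?o w" "?o y = ?o w" using o xy by blast+
        then show False using ne xy by simp
      qed
    qed
  qed
  then show ?thesis using S by simp
qed

text \<open>What is retained of the structure of \<open>H\<close>, free of matrices: a normal
  elementary abelian subgroup of order 9 whose nontrivial elements are all conjugate.\<close>

locale affine_core = group G for G (structure) +
  fixes P
  assumes P_subset: "P \<subseteq> carrier G"
    and P_one: "\<one> \<in> P"
    and P_mult: "x \<in> P \<Longrightarrow> y \<in> P \<Longrightarrow> x \<otimes> y \<in> P"
    and P_comm: "x \<in> P \<Longrightarrow> y \<in> P \<Longrightarrow> x \<otimes> y = y \<otimes> x"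
    and P_cube: "x \<in> P \<Longrightarrow> x \<otimes> x \<otimes> x = \<one>"
    and P_conj: "g \<in> carrier G \<Longrightarrow> x \<in> P \<Longrightarrow> g \<otimes> x \<otimes> inv g \<in> P"
    and P_trans: "x \<in> P \<Longrightarrow> y \<in> P \<Longrightarrow> x \<noteq> \<one> \<Longrightarrow> y \<noteq> \<one> \<Longrightarrow> \<exists>g\<in>carrier G. g \<otimes> x \<otimes> inv g = y"
    and card_P: "card P = 9"
    and order_G: "card (carrier G) = 144"
begin

lemma P_carrier: "x \<in> P \<Longrightarrow> x \<in> carrier G"
  using P_subset by blast

lemma finite_G: "finite (carrier G)"
  using order_G by (metis card.infinite zero_neq_numeral)

lemma P_inv: "x \<in> P \<Longrightarrow> inv x = x \<otimes> x"
  using P_cube P_carrier by (intro inv_equality) auto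

lemma P_inv_in: "x \<in> P \<Longrightarrow> inv x \<in> P"
  by (simp add: P_inv P_mult)

lemma card_conj_class:
  assumes "x \<in> carrier G"
  shows "card (conj_class G x) * card {g \<in> carrier G. g \<otimes> x = x \<otimes> g} = 144"
proof -
  interpret A: group_action G "carrier G" "\<lambda>g. (\<lambda>h \<in> carrier G. g \<otimes> h \<otimes> (inv g))"
    by (rule action_by_conjugation)
  have "orbit G (\<lambda>g. (\<lambda>h \<in> carrier G. g \<otimes> h \<otimes> (inv g))) x = conj_class G x"
    using assms by (auto simp: orbit_def conj_class_def)
  moreover have "stabilizer G (\<lambda>g. (\<lambda>h \<in> carrier G. g \<otimes> h \<otimes> (inv g))) x = {g \<in> carrier G. g \<otimes> x = x \<otimes> g}"
    using assms inv_solve_right[of x "_ \<otimes> x"] by (auto simp: stabilizer_def eq_commute[of x])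
  ultimately show ?thesis
    using A.orbit_stabilizer_theorem[OF assms] by (simp add: order_def order_G)
qed

text \<open>The class of \<open>x\<close> has 8 elements, so its centralizer has order 144/8 = 18.
  Inversion fixes an even number of elements of it, hence one besides the identity.\<close>

lemma centralizer_P_even:
  assumes "x \<in> P" "x \<noteq> \<one>"
  obtains s where "s \<in> carrier G" "s \<noteq> \<one>" "s \<otimes> s = \<one>" "s \<otimes> x = x \<otimes> s"
proof -
  have "conj_class G x = P - {\<one>}"
  proof
    show "conj_class G x \<subseteq> P - {\<one>}"
    proof
      fix y assume "y \<in> conj_class G x"
      then obtain g where g: "g \<in> carrier G" "y = g \<otimes> x \<otimes> inv g" by (auto simp: conj_class_def)
      have "y \<noteq> \<one>"
      proof
        assume "y = \<one>"
        then have "g \<otimes> x = g" using g P_carrier[OF assms(1)] inv_solve_right[of \<one> "g \<otimes> x" g] by simp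
        then have "g \<otimes> x = g \<otimes> \<one>" using g by simp
        then show False using l_cancel[OF _ P_carrier[OF assms(1)] one_closed g(1)] assms(2) by blast
      qed
      then show "y \<in> P - {\<one>}" using P_conj g assms by blast
    qed
    show "P - {\<one>} \<subseteq> conj_class G x"
      using P_trans[OF assms(1) _ assms(2)] by (fastforce simp: conj_class_def)
  qed
  then have "card (conj_class G x) = 8" using card_P P_one by (simp add: card_Diff_singleton)
  then have c: "card {g \<in> carrier G. g \<otimes> x = x \<otimes> g} = 18" (is "card ?C = 18")
    using card_conj_class[OF P_carrier[OF assms(1)]] by simp
  have x: "x \<in> carrier G" using assms P_carrier by blast
  have "even (card {g \<in> ?C. inv g = g})"
  proof -
    have "inv g \<otimes> x = x \<otimes> inv g" if "g \<in> carrier G" "g \<otimes> x = x \<otimes> g" for g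
      using that x by (metis inv_closed inv_solve_left inv_solve_right m_assoc m_closed)
    then have "even (card ?C) = even (card {g \<in> ?C. inv g = g})"
      using finite_G by (intro even_card_fixed_points) auto
    then show ?thesis using c by simp
  qed
  moreover have "\<one> \<in> {g \<in> ?C. inv g = g}" using x by simp
  ultimately have "{g \<in> ?C. inv g = g} \<noteq> {\<one>}" by (metis card_1_singleton_iff odd_one One_nat_def)
  then obtain s where s: "s \<in> carrier G" "s \<otimes> x = x \<otimes> s" "inv s = s" "s \<noteq> \<one>"
    using \<open>\<one> \<in> {g \<in> ?C. inv g = g}\<close> by blast
  then have "s \<otimes> s = \<one>" by (metis r_inv)
  then show ?thesis using s that by blast
qed

context
  fixes t C
  assumes t: "t \<in> carrier G" "t \<noteq> \<one>" "t \<otimes> t = \<one>" and C: "C = conj_class G t" "card C = 9"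
begin

lemma t_inv: "inv t = t"
  using t by (intro inv_equality) auto

text \<open>The centralizer of \<open>t\<close> has order 144/9 = 16. A nontrivial \<open>x\<close>
  in it would split it into orbits of length 3 under multiplication.\<close>

lemma t_fixed_point_free:
  assumes "x \<in> P" "t \<otimes> x = x \<otimes> t"
  shows "x = \<one>"
proof (rule ccontr)
  assume ne: "x \<noteq> \<one>"
  have x: "x \<in> carrier G" using assms P_carrier by blast
  have "card {g \<in> carrier G. g \<otimes> t = t \<otimes> g} = 16" (is "card ?C = 16")
    using card_conj_class[OF t(1)] C by simp
  moreover have "3 dvd card ?C"
  proof (rule three_dvd_card[of _ "\<lambda>g. x \<otimes> g"])
    show "finite ?C" using finite_G by simp
  next
    fix g assume g: "g \<in> ?C"
    have "x \<otimes> g \<otimes> t = t \<otimes> (x \<otimes> g)" using g assms(2) x t by (simp add: m_assoc) (simp add: assms(2)[symmetric] m_assoc[symmetric])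
    then show "x \<otimes> g \<in> ?C" using g x by simp
    show "x \<otimes> (x \<otimes> (x \<otimes> g)) = g" using g x P_cube[OF assms(1)] by (simp add: m_assoc[symmetric])
    show "x \<otimes> g \<noteq> g" using g x ne by (auto simp: l_cancel_one)
  qed
  ultimately show False by simp
qed

text \<open>The product of \<open>x\<close> with its conjugate under \<open>t\<close> is fixed by
  \<open>t\<close>, because \<open>P\<close> is abelian, and therefore trivial.\<close>

lemma t_inverts:
  assumes x: "x \<in> P"
  shows "t \<otimes> x \<otimes> t = inv x"
proof -
  define y where "y = t \<otimes> x \<otimes> t"
  have xG: "x \<in> carrier G" and yP: "y \<in> P"
    using x P_carrier P_conj[OF t(1) x] by (auto simp: y_def t_inv)
  have yG: "y \<in> carrier G" using yP P_carrier by blast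
  have "t \<otimes> y = x \<otimes> t"
    unfolding y_def using t xG by (simp add: m_assoc[symmetric])
  moreover have "t \<otimes> x = y \<otimes> t"
    unfolding y_def using t xG by (simp add: m_assoc)
  ultimately have "t \<otimes> (x \<otimes> y) = (y \<otimes> x) \<otimes> t"
    using t xG yG by (simp add: m_assoc) (metis m_assoc)
  then have "x \<otimes> y = \<one>"
    using t_fixed_point_free[OF P_mult[OF x yP]] P_comm[OF x yP] by simp
  then have "inv x = y" using xG yG by (metis inv_comm inv_equality)
  then show ?thesis by (simp add: y_def)
qed

text \<open>Conjugating \<open>t\<close> by \<open>x\<close> multiplies it by the inverse square of
  \<open>x\<close>, which is \<open>x\<close> because cubes in \<open>P\<close> are trivial. This
  gives nine elements of the class, hence all.\<close>

lemma C_eq: "C = (\<lambda>x. t \<otimes> x) ` P"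
proof -
  have "(\<lambda>x. t \<otimes> x) ` P \<subseteq> C"
  proof
    fix c assume "c \<in> (\<lambda>x. t \<otimes> x) ` P"
    then obtain x where x: "x \<in> P" "c = t \<otimes> x" by blast
    have xG: "x \<in> carrier G" using x P_carrier by blast
    have "x \<otimes> t = t \<otimes> (t \<otimes> x \<otimes> t)" using t xG by (simp add: m_assoc[symmetric])
    then have "x \<otimes> t \<otimes> inv x = t \<otimes> (inv x \<otimes> inv x)"
      using t xG t_inverts[OF x(1)] by (simp add: m_assoc)
    also have "inv x \<otimes> inv x = inv (inv x)"
      using P_inv[OF P_inv_in[OF x(1)]] by simp
    finally have "c = x \<otimes> t \<otimes> inv x" using x xG by simp
    then show "c \<in> C" using xG C by (auto simp: conj_class_def)
  qed
  moreover have "card ((\<lambda>x. t \<otimes> x) ` P) = 9"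
    using card_image[of "\<lambda>x. t \<otimes> x" P] card_P t P_carrier by (auto simp: inj_on_def)
  moreover have "finite C" using C(2) by (metis card.infinite zero_neq_numeral)
  ultimately show ?thesis using C(2) by (metis card_subset_eq)
qed

text \<open>An involution centralizing \<open>m \<in> P\<close> but not \<open>P\<close> inverts some \<open>r \<in> P\<close>; transitivity
  moves \<open>r\<close> to any given element.\<close>

lemma reflection_exists:
  assumes no_central: "\<And>z. z \<in> carrier G \<Longrightarrow> z \<noteq> \<one> \<Longrightarrow> z \<otimes> z = \<one> \<Longrightarrow> \<exists>x\<in>P. z \<otimes> x \<noteq> x \<otimes> z"
    and r: "r \<in> P" "r \<noteq> \<one>"
  obtains s m c where "s \<in> carrier G" "s \<noteq> \<one>" "s \<otimes> s = \<one>" "s \<otimes> r \<otimes> s = inv r"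
    "m \<in> P" "s \<otimes> m = m \<otimes> s" "m \<noteq> \<one>" "m \<noteq> r" "m \<noteq> inv r" "c \<in> P" "s \<otimes> (t \<otimes> c) = t \<otimes> c \<otimes> s"
proof -
  obtain s m where s: "s \<in> carrier G" "s \<noteq> \<one>" "s \<otimes> s = \<one>" and m: "m \<in> P" "m \<noteq> \<one>" "s \<otimes> m = m \<otimes> s"
    using centralizer_P_even[OF r] r by metis
  have s_inv: "inv s = s" using s by (intro inv_equality) auto
  obtain y where y: "y \<in> P" "s \<otimes> y \<noteq> y \<otimes> s" using no_central s by blast
  define y' where "y' = s \<otimes> y \<otimes> s"
  have yG: "y \<in> carrier G" and y'P: "y' \<in> P"
    using y P_carrier P_conj[OF s(1) y(1)] by (auto simp: y'_def s_inv)
  have y'G: "y' \<in> carrier G" using y'P P_carrier by blast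
  have sy': "s \<otimes> y' \<otimes> s = y"
    unfolding y'_def using s yG by (simp add: m_assoc) (simp add: m_assoc[symmetric] s)
  \<comment> \<open>A quotient of \<open>y\<close> and its conjugate under \<open>s\<close> is
    inverted by \<open>s\<close>, and it is nontrivial because \<open>s\<close> does not commute
    with \<open>y\<close>.\<close>
  define q where "q = inv y \<otimes> y'"
  have qP: "q \<in> P" unfolding q_def using y y'P by (simp add: P_mult P_inv_in)
  have qG: "q \<in> carrier G" using qP P_carrier by blast
  have siy: "s \<otimes> inv y \<otimes> s = inv y'"
    unfolding y'_def using s yG by (simp add: inv_mult_group s_inv m_assoc)
  have q_inv: "s \<otimes> q \<otimes> s = inv q"
  proof -
    have "s \<otimes> q \<otimes> s = (s \<otimes> inv y \<otimes> s) \<otimes> (s \<otimes> y' \<otimes> s)"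
      unfolding q_def using s yG y'G by (simp add: m_assoc) (simp add: m_assoc[symmetric] s)
    also have "\<dots> = inv q" unfolding siy sy' q_def using yG y'G by (simp add: inv_mult_group)
    finally show ?thesis .
  qed
  have q1: "q \<noteq> \<one>"
  proof
    assume "q = \<one>"
    then have "y' = y" unfolding q_def using yG y'G by (metis inv_solve_left' r_one one_closed)
    then have "s \<otimes> y \<otimes> s = y" by (simp add: y'_def)
    then have "s \<otimes> y = y \<otimes> s" using s yG by (metis inv_solve_right' m_closed s_inv)
    then show False using y by simp
  qed
  have q_not: "s \<otimes> q \<noteq> q \<otimes> s"
  proof
    assume "s \<otimes> q = q \<otimes> s"
    then have "s \<otimes> q \<otimes> s = q" using s qG by (simp add: m_assoc)
    then have "q = q \<otimes> q" using q_inv P_inv[OF qP] by simp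
    then show False using q1 qG by (metis l_cancel_one')
  qed
  have mG: "m \<in> carrier G" using m P_carrier by blast
  have mq: "m \<noteq> q" "m \<noteq> inv q"
  proof -
    show "m \<noteq> q" using m q_not by blast
    have "s \<otimes> inv m = inv m \<otimes> s" using m(3) s mG by (metis inv_closed inv_solve_left inv_solve_right m_assoc m_closed)
    then show "m \<noteq> inv q" using q_not qG by auto
  qed
  obtain g where g: "g \<in> carrier G" "g \<otimes> q \<otimes> inv g = r" using P_trans[OF qP r(1) q1 r(2)] by blast
  define k where "k x = g \<otimes> x \<otimes> inv g" for x
  have kG: "k x \<in> carrier G" if "x \<in> carrier G" for x using that g by (simp add: k_def)
  have k_mult: "k (x \<otimes> w) = k x \<otimes> k w" if "x \<in> carrier G" "w \<in> carrier G" for x w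
  proof -
    have "k x \<otimes> k w = g \<otimes> x \<otimes> (inv g \<otimes> g) \<otimes> w \<otimes> inv g"
      using that g(1) unfolding k_def by (simp only: m_assoc inv_closed m_closed)
    then show ?thesis using that g(1) by (simp add: k_def m_assoc)
  qed
  have k_one: "k \<one> = \<one>" using g by (simp add: k_def)
  have k_inj: "k x = k w \<Longrightarrow> x = w" if "x \<in> carrier G" "w \<in> carrier G" for x w
    using that g by (simp add: k_def)
  have k_inv: "k (inv x) = inv (k x)" if "x \<in> carrier G" for x
    using that g by (simp add: k_def inv_mult_group m_assoc)
  have kq: "k q = r" using g by (simp add: k_def)
  have ks: "k s \<otimes> k s = \<one>" using k_mult[OF s(1) s(1)] s k_one by simp
  have ks_inv: "inv (k s) = k s" using k_inv[OF s(1)] s_inv by simp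
  \<comment> \<open>The conjugated involution permutes the class of odd size 9, so it fixes a
    member.\<close>
  have Cs: "{c \<in> C. k s \<otimes> c \<otimes> k s = c} \<noteq> {}"
  proof
    assume emp: "{c \<in> C. k s \<otimes> c \<otimes> k s = c} = {}"
    have CG: "C \<subseteq> carrier G" using C t by (auto simp: conj_class_def)
    have "k s \<otimes> c \<otimes> k s \<in> C" if cC: "c \<in> C" for c
    proof -
      obtain h where h: "h \<in> carrier G" "c = h \<otimes> t \<otimes> inv h"
        using cC unfolding C(1) conj_class_def by blast
      have "k s \<otimes> c \<otimes> inv (k s) = (k s \<otimes> h) \<otimes> t \<otimes> inv (k s \<otimes> h)"
        using h t kG[OF s(1)] by (simp add: inv_mult_group m_assoc)
      then show ?thesis using C h kG[OF s(1)] by (auto simp: conj_class_def ks_inv)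
    qed
    moreover have "k s \<otimes> (k s \<otimes> c \<otimes> k s) \<otimes> k s = c" if "c \<in> C" for c
      using that CG kG[OF s(1)] ks by (auto simp: m_assoc subset_iff) (metis m_assoc l_one subsetD)
    moreover have "finite C" using C(2) by (metis card.infinite zero_neq_numeral)
    ultimately have "even (card C) = even (card {c \<in> C. k s \<otimes> c \<otimes> k s = c})"
      by (intro even_card_fixed_points)
    then show False unfolding emp C(2) by simp
  qed
  then obtain c where c: "c \<in> P" "k s \<otimes> (t \<otimes> c) \<otimes> k s = t \<otimes> c"
    unfolding C_eq by blast
  show ?thesis
  proof (rule that[of "k s" "k m" c])
    show "k s \<in> carrier G" "k s \<otimes> k s = \<one>" using kG s ks by auto
    show "k s \<noteq> \<one>" using k_inj[OF s(1) one_closed] s k_one by auto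
    show "k s \<otimes> r \<otimes> k s = inv r"
      using arg_cong[OF q_inv, of k] s qG by (simp add: k_mult k_inv kq)
    show "k m \<in> P" using P_conj[OF g(1) m(1)] by (simp add: k_def)
    show "k s \<otimes> k m = k m \<otimes> k s"
      using arg_cong[OF m(3), of k] s mG by (simp add: k_mult)
    show "k m \<noteq> \<one>" using k_inj[OF mG one_closed] m k_one by auto
    show "k m \<noteq> r" using k_inj[OF mG qG] mq kq by auto
    show "k m \<noteq> inv r" using k_inj[OF mG inv_closed[OF qG]] mq kq k_inv[OF qG] by auto
    show "c \<in> P" by (rule c)
    have "t \<otimes> c \<in> carrier G" using c t P_carrier by auto
    then show "k s \<otimes> (t \<otimes> c) = t \<otimes> c \<otimes> k s"
      using c(2) kG[OF s(1)] by (metis inv_solve_right' ks_inv m_closed)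
  qed
qed

end

end

text \<open>The elements of \<open>N\<close> with trivial cube correspond to
  \<open>u32_core\<close>; they are invariant under all of \<open>G\<close> because \<open>N\<close>
  is normal, and the complement of order 2 doubles 72 to 144.\<close>

lemma split_affine_core:
  fixes G (structure)
  assumes "is_U_3_2_split_2 G"
  shows "\<exists>P. affine_core G P"
proof -
  interpret group G using assms by (simp add: is_U_3_2_split_2_def)
  obtain N K where N: "N \<lhd> G" "G\<lparr>carrier := N\<rparr> \<cong> U_3_2" and K: "subgroup K G" "card K = 2"
    and NK: "N \<inter> K = {\<one>}" "N <#> K = carrier G"
    using assms unfolding is_U_3_2_split_2_def by blast
  have Nsub: "subgroup N G" using N(1) by (rule normal_imp_subgroup)
  have Nin: "x \<in> carrier G" if "x \<in> N" for x using Nsub that by (rule subgroup.mem_carrier)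
  have Kin: "x \<in> carrier G" if "x \<in> K" for x using K(1) that by (rule subgroup.mem_carrier)
  note Nmult = subgroup.m_closed[OF Nsub] and Ninv = subgroup.m_inv_closed[OF Nsub] and None = subgroup.one_closed[OF Nsub]
  obtain \<phi> where "\<phi> \<in> iso (G\<lparr>carrier := N\<rparr>) U_3_2" using N(2) unfolding is_iso_def by blast
  then have hom: "\<And>x y. x \<in> N \<Longrightarrow> y \<in> N \<Longrightarrow> \<phi> (x \<otimes> y) = \<phi> x \<otimes>\<^bsub>U_3_2\<^esub> \<phi> y"
    and bij: "bij_betw \<phi> N (carrier U_3_2)"
    by (auto simp: iso_def hom_def)
  have \<phi>_in: "\<phi> x \<in> carrier U_3_2" if "x \<in> N" for x using bij that by (auto simp: bij_betw_def)
  have \<phi>_inj: "x = y" if "\<phi> x = \<phi> y" "x \<in> N" "y \<in> N" for x y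
    using bij that by (auto simp: bij_betw_def inj_on_def)
  have \<phi>_one: "\<phi> \<one> = \<one>\<^bsub>U_3_2\<^esub>"
    using hom[OF None None] \<phi>_in[OF None] U32.l_cancel_one'[of "\<phi> \<one>" "\<phi> \<one>"] by simp
  define P where "P = {x \<in> N. x \<otimes> x \<otimes> x = \<one>}"
  have P_iff: "x \<in> P \<longleftrightarrow> \<phi> x \<in> u32_core" if x: "x \<in> N" for x
  proof -
    have "\<phi> (x \<otimes> x \<otimes> x) = \<phi> x \<otimes>\<^bsub>U_3_2\<^esub> \<phi> x \<otimes>\<^bsub>U_3_2\<^esub> \<phi> x"
      using x by (simp add: hom Nmult)
    moreover have "x \<otimes> x \<otimes> x = \<one> \<longleftrightarrow> \<phi> (x \<otimes> x \<otimes> x) = \<phi> \<one>"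
      using \<phi>_inj[OF _ Nmult[OF Nmult[OF x x] x] None] by auto
    ultimately show ?thesis using x \<phi>_in[OF x] by (simp add: P_def u32_core_def \<phi>_one)
  qed
  have PN: "P \<subseteq> N" by (auto simp: P_def)
  have \<phi>P: "\<phi> ` P = u32_core"
  proof
    show "\<phi> ` P \<subseteq> u32_core" using P_iff PN by blast
    show "u32_core \<subseteq> \<phi> ` P"
    proof
      fix y assume y: "y \<in> u32_core"
      then have "y \<in> carrier U_3_2" by (simp add: u32_core_def)
      then obtain x where "x \<in> N" "y = \<phi> x" using bij by (auto simp: bij_betw_def)
      then show "y \<in> \<phi> ` P" using P_iff y by blast
    qed
  qed
  show ?thesis
  proof (intro exI affine_core.intro affine_core_axioms.intro)
    show "group G" by (rule is_group)
    show "P \<subseteq> carrier G" using PN Nin by blast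
    show "\<one> \<in> P" using None by (simp add: P_def)
    have "inj_on \<phi> P" using bij PN by (auto simp: bij_betw_def intro: inj_on_subset)
    then show "card P = 9" using card_image[of \<phi> P] \<phi>P card_u32_core by simp
    have "card N = 72" using bij_betw_same_card[OF bij] card_U_3_2 by simp
    moreover have "inj_on (\<lambda>(n, k). n \<otimes> k) (N \<times> K)"
    proof (rule inj_onI, clarify)
      fix n k n' k' assume nk: "n \<in> N" "k \<in> K" "n' \<in> N" "k' \<in> K" "n \<otimes> k = n' \<otimes> k'"
      note c = Nin[OF nk(1)] Kin[OF nk(2)] Nin[OF nk(3)] Kin[OF nk(4)]
      have "inv n' \<otimes> n = inv n' \<otimes> (n \<otimes> k) \<otimes> inv k" using c by (simp add: m_assoc)
      also have "\<dots> = k' \<otimes> inv k" unfolding nk(5) using c by (simp add: m_assoc[symmetric])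
      finally have e: "inv n' \<otimes> n = k' \<otimes> inv k" .
      moreover have "inv n' \<otimes> n \<in> N" using nk by (simp add: Nmult Ninv)
      moreover have "k' \<otimes> inv k \<in> K"
        using nk subgroup.m_closed[OF K(1)] subgroup.m_inv_closed[OF K(1)] by blast
      ultimately have "inv n' \<otimes> n = \<one>" "k' \<otimes> inv k = \<one>" using NK(1) by auto
      then show "n = n' \<and> k = k'"
        using c inv_equality[of "inv n'" n] inv_equality[of k' "inv k"] by (metis inv_closed inv_inv)
    qed
    moreover have "(\<lambda>(n, k). n \<otimes> k) ` (N \<times> K) = carrier G"
      unfolding NK(2)[symmetric] set_mult_def by force
    ultimately show "card (carrier G) = 144"
      using card_image[of "\<lambda>(n, k). n \<otimes> k" "N \<times> K"] K(2) by (simp add: card_cartesian_product)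
  next
    fix x y assume xy: "x \<in> P" "y \<in> P"
    have xyN: "x \<in> N" "y \<in> N" using xy PN by auto
    have u: "\<phi> x \<in> u32_core" "\<phi> y \<in> u32_core" using xy xyN P_iff by auto
    show "x \<otimes> y \<in> P"
      using u32_core_mult(1)[OF u] P_iff[OF Nmult[OF xyN]] by (simp add: hom xyN)
    show "x \<otimes> y = y \<otimes> x"
      by (rule \<phi>_inj) (use u32_core_mult(2)[OF u] xyN in \<open>simp_all add: hom Nmult\<close>)
    assume ne: "x \<noteq> \<one>" "y \<noteq> \<one>"
    have "\<phi> x \<noteq> \<one>\<^bsub>U_3_2\<^esub>" "\<phi> y \<noteq> \<one>\<^bsub>U_3_2\<^esub>"
      using ne \<phi>_inj[OF _ _ None] xyN \<phi>_one by auto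
    then obtain h where h: "h \<in> carrier U_3_2" "h \<otimes>\<^bsub>U_3_2\<^esub> \<phi> x = \<phi> y \<otimes>\<^bsub>U_3_2\<^esub> h"
      using u32_core_transitive[OF u] by blast
    then have "h \<in> \<phi> ` N" using bij by (simp add: bij_betw_def)
    then obtain g where g: "g \<in> N" "h = \<phi> g" by blast
    have "g \<otimes> x = y \<otimes> g"
      by (rule \<phi>_inj) (use h g xyN in \<open>simp_all add: hom Nmult\<close>)
    then have "g \<otimes> x \<otimes> inv g = y"
      using Nin[OF g(1)] Nin[OF xyN(2)] by (simp add: m_assoc)
    then show "\<exists>g\<in>carrier G. g \<otimes> x \<otimes> inv g = y" using Nin[OF g(1)] by blast
  next
    fix x assume "x \<in> P"
    then show "x \<otimes> x \<otimes> x = \<one>" by (simp add: P_def)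
  next
    fix g x assume g: "g \<in> carrier G" and x: "x \<in> P"
    have xG: "x \<in> carrier G" using x PN Nin by blast
    have n: "g \<otimes> x \<otimes> inv g \<in> N" using normal.inv_op_closed2[OF N(1) g] x PN by blast
    have "(g \<otimes> x \<otimes> inv g) \<otimes> (g \<otimes> x \<otimes> inv g) = g \<otimes> (x \<otimes> x) \<otimes> inv g"
      using g xG by (simp add: m_assoc) (simp add: m_assoc[symmetric])
    then have "(g \<otimes> x \<otimes> inv g) \<otimes> (g \<otimes> x \<otimes> inv g) \<otimes> (g \<otimes> x \<otimes> inv g) = g \<otimes> (x \<otimes> x \<otimes> x) \<otimes> inv g"
      using g xG by (simp add: m_assoc)
    then show "g \<otimes> x \<otimes> inv g \<in> P" using n x g by (simp add: P_def)
  qed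
qed

section \<open>The group of order 9 as a plane and its action on eleven points\<close>

context affine_core
begin

definition F3_power :: "'a \<Rightarrow> 3 \<Rightarrow> 'a" where
  "F3_power x i = (if i = 0 then \<one> else if i = 1 then x else x \<otimes> x)"

lemma F3_power_add:
  assumes "x \<in> P"
  shows "F3_power x (i + j) = F3_power x i \<otimes> F3_power x j"
proof -
  have x: "x \<in> carrier G" "x \<otimes> (x \<otimes> x) = \<one>" "x \<otimes> (x \<otimes> (x \<otimes> x)) = x"
    using assms P_carrier P_cube by (auto simp: m_assoc)
  show ?thesis
    using exhaust_3[of i] exhaust_3[of j] x by (auto simp: F3_power_def m_assoc)
qed

lemma F3_power_in: "x \<in> P \<Longrightarrow> F3_power x i \<in> P"
  by (simp add: F3_power_def P_one P_mult)

lemma P_parametrization: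
  obtains p :: "3^2 \<Rightarrow> 'a" where "\<And>v w. p (v + w) = p v \<otimes> p w" "inj p" "range p = P"
proof -
  have "\<exists>r\<in>P. r \<noteq> \<one>"
  proof (rule ccontr)
    assume "\<not> ?thesis"
    then have "P \<subseteq> {\<one>}" by blast
    then show False using card_mono[of "{\<one>}" P] card_P by simp
  qed
  then obtain r where r: "r \<in> P" "r \<noteq> \<one>" by blast
  have "\<exists>m\<in>P. m \<notin> {\<one>, r, r \<otimes> r}"
  proof (rule ccontr)
    assume "\<not> ?thesis"
    then have "P \<subseteq> {\<one>, r, r \<otimes> r}" by blast
    then have "card P \<le> card {\<one>, r, r \<otimes> r}" by (intro card_mono) auto
    also have "\<dots> \<le> 3" by (simp add: card_insert_le_m1)
    finally show False using card_P by simp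
  qed
  then obtain m where m: "m \<in> P" "m \<noteq> \<one>" "m \<noteq> r" "m \<noteq> r \<otimes> r" by blast
  define p :: "3^2 \<Rightarrow> 'a" where "p v = F3_power r (v $ 1) \<otimes> F3_power m (v $ 2)" for v
  have pP: "p v \<in> P" for v by (simp add: p_def P_mult F3_power_in r m)
  have add: "p (v + w) = p v \<otimes> p w" for v w
  proof -
    define x x' y y' where d: "x = F3_power r (v $ 1)" "x' = F3_power r (w $ 1)" "y = F3_power m (v $ 2)" "y' = F3_power m (w $ 2)"
    have c: "x \<in> P" "x' \<in> P" "y \<in> P" "y' \<in> P" by (simp_all add: d F3_power_in r m)
    note cG = c[THEN P_carrier]
    have "x \<otimes> x' \<otimes> (y \<otimes> y') = x \<otimes> (x' \<otimes> y) \<otimes> y'" using cG by (simp add: m_assoc)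
    also have "x' \<otimes> y = y \<otimes> x'" using c by (simp add: P_comm)
    also have "x \<otimes> (y \<otimes> x') \<otimes> y' = x \<otimes> y \<otimes> (x' \<otimes> y')" using cG by (simp add: m_assoc)
    finally show ?thesis
      by (simp add: p_def F3_power_add r m d)
  qed
  have rG: "r \<in> carrier G" and mG: "m \<in> carrier G" using r m P_carrier by auto
  have ker: "v = 0" if v: "p v = \<one>" for v
  proof -
    have "F3_power r (v $ 1) = inv (F3_power m (v $ 2))"
      using v F3_power_in[OF r(1)] F3_power_in[OF m(1)] P_carrier inv_equality unfolding p_def by metis
    moreover have "inv (F3_power m (v $ 2)) = F3_power m (- (v $ 2))"
    proof (rule inv_equality)
      show "F3_power m (- (v $ 2)) \<otimes> F3_power m (v $ 2) = \<one>"
        using F3_power_add[OF m(1), of "- (v $ 2)" "v $ 2"] by (simp add: F3_power_def)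
    qed (use F3_power_in[OF m(1)] P_carrier in auto)
    ultimately have e: "F3_power r (v $ 1) = F3_power m (- (v $ 2))" by simp
    have r2: "r \<otimes> r \<noteq> \<one>" "m \<otimes> m \<noteq> \<one>" "r \<otimes> r \<otimes> (r \<otimes> r) = r" "m \<otimes> m \<otimes> (m \<otimes> m) = m"
      using r m rG mG P_cube[OF r(1)] P_cube[OF m(1)] by (auto simp: m_assoc)
    have "m \<otimes> m \<noteq> r" "m \<otimes> m \<noteq> r \<otimes> r"
      using m r2 by auto
    then have "v $ 1 = 0 \<and> v $ 2 = 0"
      using e exhaust_3[of "v $ 1"] exhaust_3[of "v $ 2"] r m r2
      by (auto simp: F3_power_def split: if_splits)
    then show ?thesis by (simp add: vec_eq_iff forall_2)
  qed
  have p0: "p 0 = \<one>" by (simp add: p_def F3_power_def)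
  have "inj p"
  proof (rule injI)
    fix v w assume e: "p v = p w"
    have "p (v - w) \<otimes> p w = p w" using add[of "v - w" w] e by simp
    then have "p (v - w) = \<one>" using pP[THEN P_carrier] by (metis l_one one_closed right_cancel)
    then show "v = w" using ker[of "v - w"] by simp
  qed
  moreover have "range p = P"
  proof (rule card_subset_eq)
    show "finite P" using finite_G P_subset finite_subset by blast
    show "range p \<subseteq> P" using pP by blast
    show "card (range p) = card P" by (simp only: card_image[OF \<open>inj p\<close>] card_F3_plane card_P)
  qed
  ultimately show ?thesis using that add by blast
qed

text \<open>\<open>P\<close> has an orbit of length 9 on the 11 points, since otherwise each point is fixed by one of
  the four conjugate subgroups of order 3, which forces \<open>12\<close> to divide the number of points moved
  by \<open>P\<close>. An involution centralizing \<open>P\<close> fixes that orbit pointwise, hence is a transposition.\<close>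

lemma no_central_involution:
  fixes \<psi> :: "'a \<Rightarrow> nat \<Rightarrow> nat"
  assumes hom: "\<And>g h. g \<in> carrier G \<Longrightarrow> h \<in> carrier G \<Longrightarrow> \<psi> (g \<otimes> h) = \<psi> g \<circ> \<psi> h"
    and inj: "inj_on \<psi> (carrier G)"
    and perm: "\<And>g. g \<in> carrier G \<Longrightarrow> \<psi> g permutes {1..11}"
    and even: "\<And>g. g \<in> carrier G \<Longrightarrow> evenperm (\<psi> g)"
    and z: "z \<in> carrier G" "z \<noteq> \<one>" "z \<otimes> z = \<one>" "\<And>x. x \<in> P \<Longrightarrow> z \<otimes> x = x \<otimes> z"
  shows False
proof -
  let ?\<Omega> = "{1..11::nat}"
  obtain p :: "3^2 \<Rightarrow> 'a" where p: "\<And>v w. p (v + w) = p v \<otimes> p w" "inj p" "range p = P"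
    using P_parametrization by blast
  have pP: "p v \<in> P" for v using p(3) by blast
  have pG: "p v \<in> carrier G" for v using pP P_carrier by blast
  have p0: "p 0 = \<one>" using p(1)[of 0 0] pG[of 0] l_cancel_one'[of "p 0" "p 0"] by simp
  have \<psi>1: "\<psi> \<one> = id"
  proof -
    have "\<psi> \<one> (\<psi> \<one> x) = \<psi> \<one> x" for x using hom[of \<one> \<one>] by (simp add: fun_eq_iff)
    then show ?thesis using permutes_inj[OF perm[OF one_closed]] by (auto simp: inj_def fun_eq_iff)
  qed
  define act where "act v x = \<psi> (p v) x" for v x
  have act_add: "act (v + w) x = act v (act w x)" for v w x
    using hom[OF pG pG, of v w] by (simp add: act_def p)
  have act_0: "act 0 x = x" for x by (simp add: act_def p0 \<psi>1)
  have act_comm: "act v (act w x) = act w (act v x)" for v w x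
    by (simp add: act_add[symmetric] add.commute)
  have act_in: "act v x \<in> ?\<Omega>" if "x \<in> ?\<Omega>" for v x
    using permutes_in_image[OF perm[OF pG[of v]], of x] that by (simp add: act_def)
  have act_neg: "act (- v) x = x" if "act v x = x" for v x
    using act_add[of "- v" v x] that by (simp add: act_0)
  \<comment> \<open>The common fixed points of \<open>P\<close>; by \<open>F0I\<close>, being fixed
    by two independent directions is enough.\<close>
  define F0 where "F0 = {x \<in> ?\<Omega>. \<forall>v. act v x = x}"
  have F0I: "x \<in> F0" if x: "x \<in> ?\<Omega>" "act k x = x" "act m x = x"
    and ind: "k \<noteq> 0" "m \<noteq> 0" "m \<noteq> k" "m \<noteq> - k" for x k m
  proof -
    have "act v x = x" for v
    proof -
      have "v \<in> set [0, 0 + k, 0 - k, 0 + m, 0 - m, 0 + (k + m), 0 - (k + m), 0 + (k - m), 0 - (k - m)]"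
        unfolding F3_plane_enum(2)[OF ind refl refl] by simp
      moreover have "act (k + m) x = x" "act (k + - m) x = x"
        using x act_neg[of m x] by (simp_all only: act_add)
      moreover from this have "act (- (k + m)) x = x" "act (- (k - m)) x = x"
        using act_neg[of "k + m" x] act_neg[of "k - m" x] by simp_all
      ultimately show ?thesis using x act_neg[of k x] act_neg[of m x] act_0 by auto
    qed
    then show ?thesis using x by (simp add: F0_def)
  qed
  \<comment> \<open>Points whose stabilizer is exactly the subgroup of order 3 generated by
    \<open>d\<close>. Conjugation in \<open>G\<close> makes these sets equally large for all
    directions.\<close>
  define D where "D d = {x \<in> ?\<Omega>. act d x = x} - F0" for d
  have finD: "finite (D d)" for d by (simp add: D_def)
  have card_le: "card (D d) \<le> card (D d')" if d: "d \<noteq> 0" "d' \<noteq> 0" for d d'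
  proof -
    have "p d \<noteq> \<one>" "p d' \<noteq> \<one>" using d p(2) p0 by (metis inj_eq)+
    then obtain g where g: "g \<in> carrier G" "g \<otimes> p d \<otimes> inv g = p d'"
      using P_trans[OF pP pP] by metis
    have g': "p d' \<otimes> g = g \<otimes> p d" using g pG[of d] by (simp add: g(2)[symmetric] m_assoc)
    have bij: "bij (\<psi> g)" using perm[OF g(1)] by (rule permutes_bij)
    have "\<psi> g x \<in> D d'" if "x \<in> D d" for x
    proof -
      have x: "x \<in> ?\<Omega>" "act d x = x" "x \<notin> F0" using that by (auto simp: D_def)
      have "act d' (\<psi> g x) = \<psi> g (act d x)"
        using hom[OF pG g(1), of d'] hom[OF g(1) pG, of d] g' by (metis act_def comp_apply)
      moreover have "\<psi> g x \<notin> F0"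
      proof
        assume a: "\<psi> g x \<in> F0"
        have "act v x = x" for v
        proof -
          obtain w where w: "g \<otimes> p v \<otimes> inv g = p w" using P_conj[OF g(1) pP[of v]] p(3) by blast
          then have "p w \<otimes> g = g \<otimes> p v" using g(1) pG[of v] by (simp add: w[symmetric] m_assoc)
          then have "\<psi> g (act v x) = act w (\<psi> g x)"
            using hom[OF pG g(1), of w] hom[OF g(1) pG, of v] by (metis act_def comp_apply)
          also have "\<dots> = \<psi> g x" using a by (simp add: F0_def)
          finally show ?thesis using bij by (simp add: bij_def inj_eq)
        qed
        then show False using x by (simp add: F0_def)
      qed
      moreover have "\<psi> g x \<in> ?\<Omega>" using permutes_in_image[OF perm[OF g(1)]] x(1) by blast
      ultimately show ?thesis using x by (simp add: D_def)
    qed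
    then have "\<psi> g ` D d \<subseteq> D d'" by blast
    then show ?thesis using card_mono[OF finD] card_image[of "\<psi> g" "D d"] bij
      by (metis bij_is_inj inj_on_subset subset_UNIV)
  qed
  have "axis 1 1 \<noteq> (0 :: 3^2)" by (simp add: axis_eq_0_iff)
  then obtain k :: "3^2" where k: "k \<noteq> 0" by blast
  have "card {0, k, - k} \<le> 3" by (simp add: card_insert_le_m1)
  then have "{0, k, - k} \<noteq> UNIV" using card_F3_plane(1) by force
  then obtain m where m: "m \<noteq> 0" "m \<noteq> k" "m \<noteq> - k" by blast
  note E = F3_plane_enum[OF k m refl refl, of 0]
  obtain a b where ab: "a = k + m" "b = k - m" by blast
  have "a \<noteq> 0" "b \<noteq> 0" "a \<noteq> k" "a \<noteq> - k" "a \<noteq> m" "a \<noteq> - m"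
    "b \<noteq> k" "b \<noteq> - k" "b \<noteq> m" "b \<noteq> - m" "b \<noteq> a" "b \<noteq> - a"
    using F3_plane_enum(1)[OF k m ab, of 0] by (auto simp: minus_equation_iff)
  note ne = this[unfolded ab]
  have "\<exists>x\<in>?\<Omega>. \<forall>d. d \<noteq> 0 \<longrightarrow> act d x \<noteq> x"
  proof (rule ccontr)
    assume no: "\<not> ?thesis"
    have "?\<Omega> - F0 \<subseteq> D k \<union> D m \<union> D (k + m) \<union> D (k - m)"
    proof
      fix x assume x: "x \<in> ?\<Omega> - F0"
      then obtain d where d: "d \<noteq> 0" "act d x = x" using no by blast
      have "d \<in> set [0, 0 + k, 0 - k, 0 + m, 0 - m, 0 + (k + m), 0 - (k + m), 0 + (k - m), 0 - (k - m)]"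
        unfolding E(2) by simp
      then have "d \<in> {k, m, k + m, k - m} \<or> - d \<in> {k, m, k + m, k - m}" using d(1) by auto
      moreover have "x \<in> D d" "x \<in> D (- d)" using x d act_neg by (auto simp: D_def)
      ultimately show "x \<in> D k \<union> D m \<union> D (k + m) \<union> D (k - m)" by auto
    qed
    then have U: "?\<Omega> - F0 = D k \<union> D m \<union> D (k + m) \<union> D (k - m)" by (auto simp: D_def)
    have disj: "D d \<inter> D d' = {}" if "d \<noteq> 0" "d' \<noteq> 0" "d' \<noteq> d" "d' \<noteq> - d" for d d'
      using F0I that by (auto simp: D_def)
    have "card (?\<Omega> - F0) = card (D k) + card (D m) + card (D (k + m)) + card (D (k - m))"
    proof -
      have "card (D k \<union> D m) = card (D k) + card (D m)"
        by (rule card_Un_disjoint) (use finD disj k m in auto)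
      moreover have "card (D k \<union> D m \<union> D (k + m)) = card (D k \<union> D m) + card (D (k + m))"
        by (rule card_Un_disjoint) (use finD disj[OF k ne(1) ne(3,4)] disj[OF m(1) ne(1) ne(5,6)] in auto)
      moreover have "card (D k \<union> D m \<union> D (k + m) \<union> D (k - m)) = card (D k \<union> D m \<union> D (k + m)) + card (D (k - m))"
        by (rule card_Un_disjoint)
          (use finD disj[OF k ne(2) ne(7,8)] disj[OF m(1) ne(2) ne(9,10)] disj[OF ne(1,2,11,12)] in auto)
      ultimately show ?thesis unfolding U by simp
    qed
    moreover have "card (D m) = card (D k)" "card (D (k + m)) = card (D k)" "card (D (k - m)) = card (D k)"
      using card_le k m ne by (meson order_antisym)+
    ultimately have c4: "card (?\<Omega> - F0) = 4 * card (D k)" by simp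
    have "3 dvd card (D k)"
    proof (rule three_dvd_card[of _ "act m"])
      fix x assume "x \<in> D k"
      then have x: "x \<in> ?\<Omega>" "act k x = x" "x \<notin> F0" by (auto simp: D_def)
      show mx: "act m x \<noteq> x" using F0I[OF x(1,2) _ k m] x(3) by blast
      have "m + (m + m) = 0" using F3_vec_double[of m] by simp
      then show "act m (act m (act m x)) = x" by (simp only: act_add[symmetric] act_0)
      have "act m x \<notin> F0"
      proof
        assume a: "act m x \<in> F0"
        then have "act (- m) (act m x) = act m x" unfolding F0_def by blast
        then have "x = act m x" using act_add[of "- m" m x] by (simp add: act_0)
        then show False using mx by simp
      qed
      then show "act m x \<in> D k" using act_in[OF x(1)] act_comm[of k m x] x(2) by (simp add: D_def)
    qed (rule finD)
    then obtain c where c: "card (D k) = 3 * c" by blast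
    have "card (?\<Omega> - F0) \<le> card ?\<Omega>" by (rule card_mono) auto
    then have "c = 0" unfolding c4 c by simp
    then have "?\<Omega> - F0 = {}" using c4 c by simp
    then have "act k x = x" for x
      using permutes_not_in[OF perm[OF pG[of k]], of x] by (cases "x \<in> ?\<Omega>") (auto simp: F0_def act_def)
    then have "\<psi> (p k) = \<psi> \<one>" by (simp add: \<psi>1 act_def fun_eq_iff)
    then have "p k = p 0" using inj pG p0 by (metis inj_on_def one_closed)
    then show False using p(2) k by (simp add: inj_eq)
  qed
  then obtain x where x: "x \<in> ?\<Omega>" "\<And>d. d \<noteq> 0 \<Longrightarrow> act d x \<noteq> x" by blast
  define O' where "O' = (\<lambda>v. act v x) ` UNIV"
  have injO: "v = w" if "act v x = act w x" for v w
  proof -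
    have "act (- w) (act v x) = x" unfolding that using act_add[of "- w" w x] by (simp add: act_0)
    then have "act (- w + v) x = x" by (simp only: act_add)
    then have "- w + v = 0" using x(2) by blast
    then show ?thesis by (simp add: algebra_simps)
  qed
  have cardO: "card O' = 9"
  proof -
    have "inj (\<lambda>v. act v x)" using injO by (auto simp: inj_def)
    then show ?thesis unfolding O'_def by (simp only: card_image card_F3_plane)
  qed
  have O\<Omega>: "O' \<subseteq> ?\<Omega>" using act_in x(1) by (auto simp: O'_def)
  have zact: "\<psi> z (act v y) = act v (\<psi> z y)" for v y
    using hom[OF z(1) pG[of v]] hom[OF pG[of v] z(1)] z(4)[OF pP[of v]] by (metis act_def comp_apply)
  have zz: "\<psi> z (\<psi> z y) = y" for y using hom[OF z(1) z(1)] z(3) by (simp add: \<psi>1 fun_eq_iff)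
  have zinj: "inj (\<psi> z)" by (rule permutes_inj[OF perm[OF z(1)]])
  \<comment> \<open>Commuting with \<open>P\<close>, \<open>z\<close> maps the orbit to an orbit of
    the same length 9, and two disjoint ones do not fit into eleven points. On the orbit
    \<open>z\<close> then acts as a translation by \<open>w\<close> with \<open>w + w = 0\<close>,
    so trivially.\<close>
  have "\<psi> z x \<in> O'"
  proof (rule ccontr)
    assume not: "\<psi> z x \<notin> O'"
    have "\<psi> z ` O' \<inter> O' = {}"
    proof (rule ccontr)
      assume "\<psi> z ` O' \<inter> O' \<noteq> {}"
      then obtain v w where "\<psi> z (act v x) = act w x" by (auto simp: O'_def)
      then have "act (- v) (act v (\<psi> z x)) = act (- v) (act w x)" by (simp add: zact)
      then have "\<psi> z x = act (- v + w) x" by (simp only: act_add[symmetric]) (simp add: act_0)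
      then show False using not by (auto simp: O'_def)
    qed
    moreover have "card (\<psi> z ` O') = 9" using card_image[of "\<psi> z" O'] zinj cardO by (metis inj_on_subset subset_UNIV)
    moreover have fin: "finite O'" using O\<Omega> finite_subset by blast
    ultimately have "card (\<psi> z ` O' \<union> O') = 18" using cardO by (simp add: card_Un_disjoint)
    moreover have "\<psi> z ` O' \<union> O' \<subseteq> ?\<Omega>" using O\<Omega> permutes_in_image[OF perm[OF z(1)]] by blast
    ultimately show False using card_mono[of ?\<Omega> "\<psi> z ` O' \<union> O'"] by simp
  qed
  then obtain w where w: "\<psi> z x = act w x" by (auto simp: O'_def)
  have "act w (act w x) = x" using zz[of x] by (simp add: w zact)
  then have "act (w + w) x = act 0 x" by (simp only: act_add act_0)
  then have "w + w = 0" by (rule injO)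
  then have "w = 0" using F3_vec_double[of w] by simp
  then have zx: "\<psi> z x = x" using w act_0 by simp
  then have zO: "\<psi> z y = y" if "y \<in> O'" for y using that zact by (auto simp: O'_def)
  have "card (?\<Omega> - O') = 2"
    using card_Diff_subset[OF finite_subset[OF O\<Omega>] O\<Omega>] cardO by simp
  then obtain b c where bc: "?\<Omega> - O' = {b, c}" "b \<noteq> c" by (auto simp: card_2_iff)
  have out: "\<psi> z y = y" if "y \<noteq> b" "y \<noteq> c" for y
    using that bc zO permutes_not_in[OF perm[OF z(1)], of y] by (cases "y \<in> ?\<Omega>") blast+
  have zb: "\<psi> z b \<in> {b, c}"
    using out[of "\<psi> z b"] zz[of b] by auto
  have "\<psi> z \<noteq> id"
    using inj z \<psi>1 by (metis inj_on_def one_closed)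
  have "\<psi> z = Transposition.transpose b c"
  proof (cases "\<psi> z b = b")
    case True
    then have "\<psi> z c = c" using out[of "\<psi> z c"] zz[of c] zinj bc(2) by (metis inj_eq)
    then have "\<psi> z = id" using True out by (metis eq_id_iff)
    then show ?thesis using \<open>\<psi> z \<noteq> id\<close> by simp
  next
    case False
    then have b: "\<psi> z b = c" using zb by simp
    then have c: "\<psi> z c = b" using zz[of b] by simp
    show ?thesis by (rule ext) (use b c out in \<open>auto simp: Transposition.transpose_def\<close>)
  qed
  then have "\<not> evenperm (\<psi> z)" using bc(2) by (simp add: evenperm_swap)
  then show False using even z(1) by blast
qed

end

text \<open>The generators are an 11-cycle and a product of two 4-cycles, both even, so the group
  lies in the alternating group.\<close>

lemma mathieu_11_even:
  assumes "g \<in> carrier mathieu_11"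
  shows "g permutes {1..11}" "evenperm g"
proof -
  interpret S: group "sym_group 11" by (rule sym_group_is_group)
  have perm_gen: "cycle_of_list [1,2,3,4,5,6,7,8,9,10,11::nat] permutes {1..11}"
    "cycle_of_list [3,7,11,8::nat] permutes {1..11}" "cycle_of_list [4,10,5,6::nat] permutes {1..11}"
    by (rule permutes_subset[OF cycle_permutes]; force)+
  have "evenperm (cycle_of_list [1,2,3,4,5,6,7,8,9,10,11::nat])"
    "evenperm (cycle_of_list [3,7,11,8::nat] \<circ> cycle_of_list [4,10,5,6::nat])"
    by (simp_all add: evenperm_comp evenperm_swap permutation_swap_id permutation_compose)
  then have "{cycle_of_list [1,2,3,4,5,6,7,8,9,10,11],
         cycle_of_list [3,7,11,8] \<circ> cycle_of_list [4,10,5,6]} \<subseteq> carrier (alt_group 11)"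
    using perm_gen by (auto simp: alt_group_def intro: permutes_compose)
  then have "generate (sym_group 11) {cycle_of_list [1,2,3,4,5,6,7,8,9,10,11],
         cycle_of_list [3,7,11,8] \<circ> cycle_of_list [4,10,5,6]} \<subseteq> carrier (alt_group 11)"
    by (rule S.generate_subgroup_incl) (rule alt_group_is_subgroup)
  then show "g permutes {1..11}" "evenperm g"
    using assms by (auto simp: mathieu_11_def alt_group_def)
qed

section \<open>The class of nine axes\<close>

lemma (in group) ord_eq_2_iff:
  assumes "x \<in> carrier G"
  shows "ord x = 2 \<longleftrightarrow> x \<noteq> \<one> \<and> x \<otimes> x = \<one>"
proof
  assume o: "ord x = 2"
  then have "x [^] (2::nat) = \<one>" using pow_ord_eq_1[OF assms] by simp
  then show "x \<noteq> \<one> \<and> x \<otimes> x = \<one>" using o assms by (auto simp: numeral_2_eq_2)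
next
  assume x: "x \<noteq> \<one> \<and> x \<otimes> x = \<one>"
  then have "x [^] (2::nat) = \<one>" using assms by (simp add: numeral_2_eq_2)
  then have "ord x dvd 2" using pow_eq_id[OF assms] by blast
  then have "ord x = 1 \<or> ord x = 2" using two_is_prime_nat by (simp add: prime_nat_iff)
  then show "ord x = 2" using x ord_eq_1[OF assms] by auto
qed

lemma (in group) ord_eq_3I:
  assumes "x \<in> carrier G" "x \<noteq> \<one>" "x \<otimes> x \<otimes> x = \<one>"
  shows "ord x = 3"
proof -
  have "x [^] (3::nat) = \<one>" using assms by (simp add: numeral_3_eq_3)
  then have d: "ord x dvd 3" using pow_eq_id[OF assms(1)] by blast
  then have "ord x \<le> 3" by (rule dvd_imp_le) simp
  moreover have "ord x \<noteq> 0" using d by (metis dvd_0_left_iff zero_neq_numeral)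
  moreover have "ord x \<noteq> 2" using d by auto
  ultimately have "ord x = 1 \<or> ord x = 3" by auto
  then show ?thesis using assms(2) ord_eq_1[OF assms(1)] by auto
qed

lemma (in group) ord_eq_6I:
  assumes x: "x \<in> carrier G" and y: "y \<in> carrier G" and xy: "x \<otimes> y = y \<otimes> x"
    and x2: "x \<noteq> \<one>" "x \<otimes> x = \<one>" and y3: "y \<noteq> \<one>" "y \<otimes> y \<otimes> y = \<one>"
  shows "ord (x \<otimes> y) = 6"
proof -
  let ?z = "x \<otimes> y"
  have z: "?z \<in> carrier G" using x y by simp
  have pow: "?z [^] n = x [^] n \<otimes> y [^] n" for n :: nat
    using pow_mult_distrib[OF xy x y] .
  have p: "x [^] (2::nat) = \<one>" "y [^] (3::nat) = \<one>"
    using x y x2 y3 by (simp_all add: numeral_2_eq_2 numeral_3_eq_3)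
  have "x [^] (6::nat) = \<one>" "y [^] (6::nat) = \<one>" "x [^] (3::nat) = x" "y [^] (2::nat) \<noteq> \<one>"
  proof -
    show "x [^] (6::nat) = \<one>" using nat_pow_pow[OF x, of 2 3] p by simp
    show "y [^] (6::nat) = \<one>" using nat_pow_pow[OF y, of 3 2] p by simp
    show "x [^] (3::nat) = x" using x x2 by (simp add: numeral_3_eq_3)
    show "y [^] (2::nat) \<noteq> \<one>" using y y3 by (auto simp: numeral_2_eq_2)
  qed
  then have "?z [^] (6::nat) = \<one>" "?z [^] (2::nat) \<noteq> \<one>" "?z [^] (3::nat) \<noteq> \<one>"
    using x y x2 p by (simp_all add: pow)
  then have d: "ord ?z dvd 6" "\<not> ord ?z dvd 2" "\<not> ord ?z dvd 3"
    using pow_eq_id[OF z] by auto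
  have "ord ?z \<le> 6" using d(1) by (rule dvd_imp_le) simp
  moreover have "ord ?z \<noteq> 0" using d(1) by (metis dvd_0_left_iff zero_neq_numeral)
  ultimately have "ord ?z \<in> {1, 2, 3, 4, 5, 6}" by auto
  then show ?thesis using d by auto
qed

context affine_core
begin

lemma class_parametrization:
  assumes t: "t \<in> carrier G" "t \<noteq> \<one>" "t \<otimes> t = \<one>" and C: "C = conj_class G t" "card C = 9"
    and no_central: "\<And>z. z \<in> carrier G \<Longrightarrow> z \<noteq> \<one> \<Longrightarrow> z \<otimes> z = \<one> \<Longrightarrow> \<exists>x\<in>P. z \<otimes> x \<noteq> x \<otimes> z"
  obtains p :: "3^2 \<Rightarrow> 'a" where "\<And>v w. p (v + w) = p v \<otimes> p w" "inj p" "\<And>v. p v \<in> carrier G"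
    "C = range (\<lambda>v. t \<otimes> p v)" "\<And>v. t \<otimes> p v \<otimes> t = p (- v)" "\<And>v. t \<otimes> p v \<noteq> \<one>" "p 0 = \<one>"
    "\<And>d. d \<noteq> 0 \<Longrightarrow> \<exists>s m x. s \<in> carrier G \<and> s \<noteq> \<one> \<and> s \<otimes> s = \<one> \<and> s \<otimes> p d \<otimes> s = p (- d) \<and>
       s \<otimes> p m = p m \<otimes> s \<and> m \<noteq> 0 \<and> m \<noteq> d \<and> m \<noteq> - d \<and> s \<otimes> (t \<otimes> p x) = t \<otimes> p x \<otimes> s"
proof -
  obtain p :: "3^2 \<Rightarrow> 'a" where p: "\<And>v w. p (v + w) = p v \<otimes> p w" "inj p" "range p = P"
    using P_parametrization by blast
  have pP: "p v \<in> P" for v using p(3) by blast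
  have pG: "p v \<in> carrier G" for v using pP P_carrier by blast
  have p0: "p 0 = \<one>" using p(1)[of 0 0] pG[of 0] l_cancel_one'[of "p 0" "p 0"] by simp
  have p_neg: "p (- v) = inv (p v)" for v
    using p(1)[of "- v" v] pG p0 inv_equality by simp
  show ?thesis
  proof (rule that[of p])
    show "p v \<in> carrier G" "p 0 = \<one>" for v by (rule pG p0)+
    show "C = range (\<lambda>v. t \<otimes> p v)" unfolding C_eq[OF t C] p(3)[symmetric] by auto
    show "t \<otimes> p v \<otimes> t = p (- v)" for v using t_inverts[OF t C pP] by (simp add: p_neg)
    show "t \<otimes> p v \<noteq> \<one>" for v
    proof
      assume "t \<otimes> p v = \<one>"
      then have "t = inv (p v)" using inv_equality[of t "p v"] t pG by simp
      then have "t \<in> P" using P_inv_in[OF pP] by simp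
      then have "t \<otimes> t \<otimes> t = \<one>" by (rule P_cube)
      then show False using t by simp
    qed
    fix d :: "3^2" assume d: "d \<noteq> 0"
    then have "p d \<noteq> \<one>" using p(2) p0 by (metis inj_eq)
    from reflection_exists[OF t C no_central pP this]
    obtain s m' c where s: "s \<in> carrier G" "s \<noteq> \<one>" "s \<otimes> s = \<one>" "s \<otimes> p d \<otimes> s = inv (p d)"
      "m' \<in> P" "s \<otimes> m' = m' \<otimes> s" "m' \<noteq> \<one>" "m' \<noteq> p d" "m' \<noteq> inv (p d)" "c \<in> P" "s \<otimes> (t \<otimes> c) = t \<otimes> c \<otimes> s"
      by blast
    moreover obtain m where m: "m' = p m" using s(5) p(3) by blast
    moreover obtain x where "c = p x" using s(10) p(3) by blast
    moreover have "m \<noteq> 0" "m \<noteq> d" "m \<noteq> - d" using s(7-9) m p0 p_neg by auto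
    ultimately show "\<exists>s m x. s \<in> carrier G \<and> s \<noteq> \<one> \<and> s \<otimes> s = \<one> \<and> s \<otimes> p d \<otimes> s = p (- d) \<and>
       s \<otimes> p m = p m \<otimes> s \<and> m \<noteq> 0 \<and> m \<noteq> d \<and> m \<noteq> - d \<and> s \<otimes> (t \<otimes> p x) = t \<otimes> p x \<otimes> s"
      by (metis p_neg)
  qed (use p in auto)
qed

end

section \<open>From the Miyamoto group to the plane of axes\<close>

context A286
begin

sublocale frobenius_algebra
  by (intro frobenius_algebra.intro frobenius_algebra_axioms.intro comm_rat_algebra_axioms
      form_sym form_linear form_pos_def form_frobenius)

abbreviation M where "M \<equiv> miyamoto_group Axs"

abbreviation M_prod (infixl "\<cdot>" 70) where "g \<cdot> h \<equiv> g \<otimes>\<^bsub>M\<^esub> h"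

abbreviation M_unit ("\<one>\<^sub>M") where "\<one>\<^sub>M \<equiv> \<one>\<^bsub>M\<^esub>"

lemma miyamoto_tau: "a \<in> Axs \<Longrightarrow> miyamoto a = tau a"
  using miyamoto_eq_tau X_axes by blast

lemma miyamoto_subgroup:
  "subgroup (generate (alg_aut_group UNIV) (miyamoto ` Axs)) (alg_aut_group UNIV)"
  by (rule group.generate_is_subgroup[OF group_alg_aut_group_UNIV])
     (use miyamoto_tau tau_in_alg_aut_group X_axes in auto)

lemma group_M: "group M"
  unfolding miyamoto_group_def
  by (rule subgroup.subgroup_is_group[OF miyamoto_subgroup group_alg_aut_group_UNIV])

lemma M_aut: "g \<in> carrier M \<Longrightarrow> g \<in> carrier (alg_aut_group UNIV)"
  using subgroup.subset[OF miyamoto_subgroup] by (auto simp: miyamoto_group_def)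

lemma M_one: "\<one>\<^sub>M = id"
  using alg_aut_group_UNIV_ops(2) by (simp add: miyamoto_group_def)

lemma M_mult: "g \<in> carrier M \<Longrightarrow> h \<in> carrier M \<Longrightarrow> g \<cdot> h = g \<circ> h"
  using alg_aut_group_UNIV_ops(1)[of g h] M_aut[of g] M_aut[of h]
  by (simp add: miyamoto_group_def carrier_alg_aut_group_UNIV)

definition axis_of :: "('a \<Rightarrow> 'a) \<Rightarrow> 'a" where
  "axis_of g = inv_into Axs miyamoto g"

lemma axis_of:
  assumes "g \<in> involutions M"
  shows "axis_of g \<in> Axs" "miyamoto (axis_of g) = g"
  using assms miyamoto_bij inv_into_into[of g miyamoto Axs] f_inv_into_f[of g miyamoto Axs]
  by (auto simp: axis_of_def bij_betw_def)

lemma axis_of_miyamoto: "b \<in> Axs \<Longrightarrow> axis_of (miyamoto b) = b"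
  using miyamoto_bij by (auto simp: axis_of_def bij_betw_def)

lemma involution_iff: "g \<in> involutions M \<longleftrightarrow> g \<in> carrier M \<and> g \<noteq> \<one>\<^sub>M \<and> g \<cdot> g = \<one>\<^sub>M"
  using group.ord_eq_2_iff[OF group_M] by (auto simp: involutions_def)

text \<open>An automorphism carries an axis to the axis of the conjugated involution; here the
  conjugating involution is its own inverse.\<close>

lemma tau_axis_of:
  assumes g: "g \<in> involutions M" and h: "h \<in> involutions M"
  shows "tau (axis_of g) (axis_of h) = axis_of (g \<cdot> h \<cdot> g)"
proof -
  interpret M: group M by (rule group_M)
  have gM: "g \<in> carrier M" "h \<in> carrier M" "g \<cdot> g = \<one>\<^sub>M" using g h by (auto simp: involution_iff)
  have gg: "g (g x) = x" for x using M_mult[OF gM(1,1)] gM(3) M_one by (simp add: fun_eq_iff)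
  have tg: "tau (axis_of g) = g" and th: "tau (axis_of h) = h"
    using axis_of[OF g] axis_of[OF h] miyamoto_tau by auto
  have ga: "g (axis_of h) \<in> Axs" using X_invariant[OF gM(1)] axis_of(1)[OF h] by blast
  have "miyamoto (g (axis_of h)) x = g (h (g x))" for x
    using tau_equivariant[OF M_aut[OF gM(1)], of "axis_of h" "g x"] by (simp add: miyamoto_tau[OF ga] gg th)
  then have "miyamoto (g (axis_of h)) = g \<cdot> h \<cdot> g"
    by (subst M_mult[OF M.m_closed[OF gM(1,2)] gM(1)]) (simp add: M_mult[OF gM(1,2)] fun_eq_iff)
  then show ?thesis using axis_of_miyamoto[OF ga] tg by simp
qed

lemma dihedral_3A_of_order_3:
  assumes g: "g \<in> involutions M" and h: "h \<in> involutions M"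
    and gh: "g \<cdot> h \<noteq> \<one>\<^sub>M"
      "g \<cdot> h \<cdot> (g \<cdot> h) \<cdot> (g \<cdot> h) = \<one>\<^sub>M"
  shows "form (axis_of g) (axis_of h) = 13/256" "norton_sakuma_3A (axis_of g) (axis_of h)"
proof -
  interpret M: group M by (rule group_M)
  have c: "g \<in> carrier M" "h \<in> carrier M" using g h by (auto simp: involution_iff)
  have "M.ord (g \<cdot> h) = 3" by (rule M.ord_eq_3I) (use c gh in auto)
  moreover have "axis_of g \<noteq> axis_of h"
    using axis_of[OF g] axis_of[OF h] gh(1) g involution_iff by metis
  ultimately show "form (axis_of g) (axis_of h) = 13/256" "norton_sakuma_3A (axis_of g) (axis_of h)"
    using dihedral_3[OF axis_of(1)[OF g] axis_of(1)[OF h]] axis_of(2)[OF g] axis_of(2)[OF h] by auto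
qed

lemma dihedral_6A_of_order_6:
  assumes g: "g \<in> involutions M" and h: "h \<in> involutions M"
    and gh: "g \<noteq> h" "group.ord M (g \<cdot> h) = 6"
  shows "norton_sakuma_6A (axis_of g) (axis_of h)"
  using dihedral_6[OF axis_of(1)[OF g] axis_of(1)[OF h]] axis_of(2)[OF g] axis_of(2)[OF h] gh by metis

theorem affine_plane_of_class:
  assumes H: "subgroup H M" and GH: "is_U_3_2_split_2 (M\<lparr>carrier := H\<rparr>)"
    and C: "t \<in> involutions (M\<lparr>carrier := H\<rparr>)" "C = conj_class (M\<lparr>carrier := H\<rparr>) t" "card C = 9"
  shows "\<exists>a u. affine_plane_algebra scale prod form a u \<and> range a = {b \<in> Axs. miyamoto b \<in> C}"
proof -
  interpret M: group M by (rule group_M)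
  obtain P where "affine_core (M\<lparr>carrier := H\<rparr>) P" using split_affine_core[OF GH] by blast
  then interpret G: affine_core "M\<lparr>carrier := H\<rparr>" P .
  have HM: "x \<in> carrier M" if "x \<in> H" for x using subgroup.mem_carrier[OF H that] .
  have t: "t \<in> H" "t \<noteq> \<one>\<^sub>M" "t \<cdot> t = \<one>\<^sub>M"
    using C(1) G.ord_eq_2_iff[of t] by (auto simp: involutions_def)
  obtain \<psi> where \<psi>: "\<psi> \<in> iso M mathieu_11" using miyamoto_group_iso unfolding is_iso_def by blast
  have no_central: "\<exists>x\<in>P. z \<cdot> x \<noteq> x \<cdot> z"
    if z: "z \<in> H" "z \<noteq> \<one>\<^sub>M" "z \<cdot> z = \<one>\<^sub>M" for z
  proof (rule ccontr)
    assume no: "\<not> ?thesis"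
    have m11: "\<psi> g \<in> carrier mathieu_11" if "g \<in> H" for g
      using \<psi> HM[OF that] by (auto simp: iso_def hom_def)
    have mult: "x \<otimes>\<^bsub>mathieu_11\<^esub> y = x \<circ> y" for x y by (simp add: mathieu_11_def sym_group_mult)
    show False
    proof (rule G.no_central_involution[of \<psi> z])
      show "\<psi> (g \<otimes>\<^bsub>M\<lparr>carrier := H\<rparr>\<^esub> h) = \<psi> g \<circ> \<psi> h"
        if "g \<in> carrier (M\<lparr>carrier := H\<rparr>)" "h \<in> carrier (M\<lparr>carrier := H\<rparr>)" for g h
        using \<psi> HM that mult by (auto simp: iso_def hom_def)
      have "inj_on \<psi> (carrier M)" using \<psi> by (auto simp: iso_def bij_betw_def)
      then show "inj_on \<psi> (carrier (M\<lparr>carrier := H\<rparr>))" using HM by (auto intro: inj_on_subset)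
      show "\<psi> g permutes {1..11}" "evenperm (\<psi> g)" if "g \<in> carrier (M\<lparr>carrier := H\<rparr>)" for g
        using mathieu_11_even[OF m11[of g]] that by auto
    qed (use z no in auto)
  qed
  obtain p :: "3^2 \<Rightarrow> 'a \<Rightarrow> 'a" where p_add: "\<And>v w. p (v + w) = p v \<cdot> p w" and p_inj: "inj p"
    and pH: "\<And>v. p v \<in> H" and C_p: "C = range (\<lambda>v. t \<cdot> p v)"
    and t_p: "\<And>v. t \<cdot> p v \<cdot> t = p (- v)" and tp_ne: "\<And>v. t \<cdot> p v \<noteq> \<one>\<^sub>M"
    and p0: "p 0 = \<one>\<^sub>M"
    and reflection: "\<And>d. d \<noteq> 0 \<Longrightarrow> \<exists>s m x. s \<in> H \<and> s \<noteq> \<one>\<^sub>M \<and> s \<cdot> s = \<one>\<^sub>M \<and>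
       s \<cdot> p d \<cdot> s = p (- d) \<and> s \<cdot> p m = p m \<cdot> s \<and>
       m \<noteq> 0 \<and> m \<noteq> d \<and> m \<noteq> - d \<and> s \<cdot> (t \<cdot> p x) = t \<cdot> p x \<cdot> s"
    using G.class_parametrization[of t C] t C(2,3) no_central by auto
  have pM: "p v \<in> carrier M" for v using pH HM by blast
  have tM: "t \<in> carrier M" using t HM by blast
  define T where "T v = t \<cdot> p v" for v
  have TM: "T v \<in> carrier M" for v using tM pM by (simp add: T_def)
  have TT: "T v \<cdot> T w = p (w - v)" for v w
  proof -
    have "T v \<cdot> T w = t \<cdot> p v \<cdot> t \<cdot> p w" using tM pM by (simp add: T_def M.m_assoc)
    then show ?thesis by (simp add: t_p p_add[symmetric])
  qed
  have Tp: "T v \<cdot> p w = T (v + w)" for v w using tM pM by (simp add: T_def M.m_assoc p_add)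
  have pT: "p w \<cdot> T v = T (v - w)" for v w
  proof -
    have "p w \<cdot> t = t \<cdot> (t \<cdot> p w \<cdot> t)"
      using tM pM t(3) by (simp add: M.m_assoc[symmetric])
    then have "p w \<cdot> t = t \<cdot> p (- w)" by (simp only: t_p)
    then have "p w \<cdot> T v = t \<cdot> p (- w) \<cdot> p v"
      using tM pM by (simp add: T_def M.m_assoc[symmetric])
    then show ?thesis using tM pM by (simp add: M.m_assoc p_add[symmetric] T_def)
  qed
  have T_inv: "T v \<in> involutions M" for v
    using TT[of v v] TM tp_ne[of v] by (simp add: involution_iff p0 T_def[symmetric])
  define a where "a v = axis_of (T v)" for v
  have a_tau: "tau (a v) (a w) = a (- (v + w))" for v w
  proof -
    have "T v \<cdot> T w \<cdot> T v = T (v - (w - v))" by (simp only: TT pT)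
    moreover have "v - (w - v) = - (v + w)"
      using F3_vec_double[of v] by (simp add: algebra_simps)
    ultimately show ?thesis unfolding a_def tau_axis_of[OF T_inv T_inv] by simp
  qed
  have p_ne: "p d \<noteq> \<one>\<^sub>M" if "d \<noteq> 0" for d using that p_inj p0 by (metis inj_eq)
  have p3: "p d \<cdot> p d \<cdot> p d = \<one>\<^sub>M" for d
    by (simp only: p_add[symmetric] F3_vec_double) (simp add: p0)
  have a3: "form (a v) (a w) = 13/256" "norton_sakuma_3A (a v) (a w)" if "v \<noteq> w" for v w
    unfolding a_def
    by (rule dihedral_3A_of_order_3[OF T_inv T_inv]; use p_ne[of "w - v"] p3[of "w - v"] that in \<open>simp add: TT\<close>)+
  \<comment> \<open>The additional vector of the line through \<open>v\<close> in direction
    \<open>d\<close>; its independence of \<open>v\<close> is the point of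
    \<open>L_const\<close>.\<close>
  define L where "L v d = third_axis_u (a v) (a (v + d))" for v d
  have third: "- (v + (v + d)) = v - d" for v d :: "3^2"
    using F3_vec_double[of v] by (simp add: algebra_simps)
  note A3 = norton_sakuma_3A_products[OF a3(2)]
  have L_minus: "L v (- d) = L v d" if "d \<noteq> 0" for v d
  proof -
    have "v \<noteq> v + d" using that by simp
    from A3(5)[OF this] show ?thesis by (simp only: L_def a_tau third add_uminus_conv_diff)
  qed
  have L_shift: "L (v + d) d = L v d" if "d \<noteq> 0" for v d
    using A3(6)[of v "v + d"] L_minus[of d "v + d"] that by (simp add: L_def)
  have L_shift': "L (v - d) d = L v d" if "d \<noteq> 0" for v d
    using L_shift[of d "v - d"] that by simp
  have L_const: "L v d = L 0 d" if d: "d \<noteq> 0" for v d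
  proof -
    obtain s m x where s: "s \<in> H" "s \<noteq> \<one>\<^sub>M" "s \<cdot> s = \<one>\<^sub>M"
      and sd: "s \<cdot> p d \<cdot> s = p (- d)" and sm: "s \<cdot> p m = p m \<cdot> s"
      and m: "m \<noteq> 0" "m \<noteq> d" "m \<noteq> - d" and sx: "s \<cdot> T x = T x \<cdot> s"
      using reflection[OF d] unfolding T_def by blast
    have sM: "s \<in> carrier M" using s HM by blast
    have s_inv: "s \<in> involutions M" using s sM by (simp add: involution_iff)
    have spd: "s \<cdot> p d = p (- d) \<cdot> s"
    proof -
      have "p (- d) \<cdot> s = s \<cdot> p d \<cdot> (s \<cdot> s)"
        using sM pM by (simp only: sd[symmetric] M.m_assoc M.m_closed)
      then show ?thesis using sM pM s(3) by simp
    qed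
    have spd': "s \<cdot> p (- d) = p d \<cdot> s"
    proof -
      have "s \<cdot> p (- d) = (s \<cdot> s) \<cdot> p d \<cdot> s"
        using sM pM by (simp only: sd[symmetric] M.m_assoc M.m_closed)
      then show ?thesis using sM pM s(3) by simp
    qed
    \<comment> \<open>Both \<open>s\<close> and \<open>T y\<close> invert \<open>p d\<close>, so the
      involution \<open>s \<cdot> T y\<close> commutes with it and
      \<open>s \<cdot> T (y + d)\<close> has order 6. In the resulting 6A algebra one 3A triple is
      the line through \<open>y\<close>, while the other contains the axes of \<open>s\<close> and
      \<open>s \<cdot> p (- d)\<close> and does not depend on \<open>y\<close>.\<close>
    have key: "third_axis_u (axis_of s) (axis_of (s \<cdot> p (- d))) = L y d"
      if sy: "s \<cdot> T y = T y \<cdot> s" for y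
    proof -
      let ?e = "s \<cdot> T y"
      \<comment> \<open>\<open>s\<close> centralizes the nontrivial \<open>p m\<close>, whereas
        every \<open>T w\<close> inverts it.\<close>
      have s_ne: "s \<noteq> T w" for w
      proof
        assume "s = T w"
        then have "T (w + m) = T (w - m)" using sm by (simp add: Tp pT)
        then have "p (w + m) = p (w - m)" using tM pM by (simp add: T_def)
        then have "w + m = w - m" using p_inj by (simp add: inj_eq)
        then show False using F3_vec_distinct(3)[OF m(1)] by blast
      qed
      have e: "?e \<noteq> \<one>\<^sub>M" "?e \<cdot> ?e = \<one>\<^sub>M"
      proof -
        show "?e \<noteq> \<one>\<^sub>M"
        proof
          assume "?e = \<one>\<^sub>M"
          then have "s = s \<cdot> (T y \<cdot> T y)" using sM by (simp add: TT p0)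
          also have "\<dots> = T y" using sM TM \<open>?e = \<one>\<^sub>M\<close> by (simp add: M.m_assoc[symmetric])
          finally show False using s_ne by blast
        qed
        have "?e \<cdot> ?e = s \<cdot> (T y \<cdot> s) \<cdot> T y" using sM TM by (simp add: M.m_assoc)
        also have "\<dots> = (s \<cdot> s) \<cdot> (T y \<cdot> T y)" unfolding sy[symmetric] using sM TM by (simp add: M.m_assoc)
        finally show "?e \<cdot> ?e = \<one>\<^sub>M" by (simp add: s(3) TT p0)
      qed
      have ed: "?e \<cdot> p d = p d \<cdot> ?e"
      proof -
        have "?e \<cdot> p d = s \<cdot> (p (- d) \<cdot> T y)" using sM TM pM by (simp add: M.m_assoc Tp pT)
        also have "\<dots> = p d \<cdot> ?e" using sM TM pM by (simp add: M.m_assoc[symmetric] spd')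
        finally show ?thesis .
      qed
      have "M.ord (?e \<cdot> p d) = 6"
        by (rule M.ord_eq_6I) (use sM TM pM ed e p_ne[OF d] p3 in auto)
      moreover have "?e \<cdot> p d = s \<cdot> T (y + d)" using sM TM pM by (simp add: M.m_assoc Tp)
      ultimately have "norton_sakuma_6A (axis_of s) (a (y + d))"
        unfolding a_def using dihedral_6A_of_order_6[OF s_inv T_inv s_ne] by simp
      then have "third_axis_u (axis_of s) (tau (a (y + d)) (axis_of s)) =
          third_axis_u (a (y + d)) (tau (axis_of s) (a (y + d)))"
        by (rule norton_sakuma_6A_third_axis_u)
      moreover have "tau (a (y + d)) (axis_of s) = axis_of (s \<cdot> p (- d))"
      proof -
        have "T (y + d) \<cdot> s = T y \<cdot> (p d \<cdot> s)" using sM TM pM by (simp add: Tp[symmetric] M.m_assoc)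
        also have "\<dots> = s \<cdot> T (y - d)"
          unfolding spd'[symmetric] using sM TM pM by (simp add: M.m_assoc[symmetric] sy[symmetric]) (simp add: M.m_assoc Tp)
        finally have "T (y + d) \<cdot> s \<cdot> T (y + d) = s \<cdot> p (d + d)"
          using sM TM by (simp add: M.m_assoc TT)
        then show ?thesis unfolding a_def tau_axis_of[OF T_inv s_inv] F3_vec_double by simp
      qed
      moreover have "tau (axis_of s) (a (y + d)) = a (y - d)"
      proof -
        have "s \<cdot> T (y + d) \<cdot> s = T y \<cdot> (s \<cdot> p d \<cdot> s)"
          using sM TM pM by (simp add: Tp[symmetric] M.m_assoc[symmetric] sy)
        also have "\<dots> = T (y - d)" by (simp add: sd Tp)
        finally show ?thesis unfolding a_def tau_axis_of[OF s_inv T_inv] by simp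
      qed
      moreover have "third_axis_u (a (y + d)) (a (y - d)) = L (y + d) d"
        by (simp add: L_def F3_vec_add_add)
      ultimately show ?thesis using L_shift[OF d] by simp
    qed
    have sp: "s \<cdot> p (- m) = p (- m) \<cdot> s"
    proof -
      have "p (- m) = p m \<cdot> p m" by (simp only: p_add[symmetric] F3_vec_double)
      then show ?thesis using sM pM sm by (metis M.m_assoc)
    qed
    have sx': "s \<cdot> T (x + j) = T (x + j) \<cdot> s" if "s \<cdot> p j = p j \<cdot> s" for j
    proof -
      have "s \<cdot> T (x + j) = T x \<cdot> (s \<cdot> p j)"
        using sM TM pM by (simp add: Tp[symmetric] M.m_assoc[symmetric] sx)
      then show ?thesis unfolding that using sM TM pM by (simp add: Tp[symmetric] M.m_assoc)
    qed
    \<comment> \<open>\<open>s\<close> commutes with \<open>T x\<close> and with \<open>p m\<close>,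
      so \<open>key\<close> applies at \<open>x\<close>, \<open>x + m\<close> and
      \<open>x - m\<close>, which meet all three lines in direction \<open>d\<close>.\<close>
    have K: "L (x + m) d = L x d" "L (x - m) d = L x d"
      using key[OF sx] key[OF sx'[OF sm]] key[OF sx'[OF sp]] by simp_all
    have all: "L w d = L x d" for w
    proof -
      have "w \<in> set [x, x + d, x - d, x + m, x - m, x + (d + m), x - (d + m), x + (d - m), x - (d - m)]"
        unfolding F3_plane_enum(2)[OF d m refl refl] by simp
      moreover have "x + (d + m) = x + m + d" "x - (d + m) = x - m - d" "x + (d - m) = x - m + d" "x - (d - m) = x + m - d"
        by simp_all
      ultimately show ?thesis using K L_shift[OF d] L_shift'[OF d] by (auto simp del: diff_diff_eq)
    qed
    show ?thesis using all[of v] all[of 0] by simp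
  qed
  define u where "u d = L 0 d" for d
  have uL: "third_axis_u (a v) (a (v + d)) = u d" if "d \<noteq> 0" for v d
    using L_const[OF that, of v] by (simp add: L_def u_def)
  have aX: "a v \<in> Axs" for v unfolding a_def by (rule axis_of(1)[OF T_inv])
  have "affine_plane_algebra scale prod form a u"
  proof (intro affine_plane_algebra.intro affine_plane_algebra_axioms.intro)
    show "frobenius_algebra scale prod form" by (rule frobenius_algebra_axioms)
    show "primitive_axis (a v)" for v by (rule X_axes[OF aX])
    show "form (a v) (a v) = 1" for v by (rule form_axis[OF aX])
    show "form (a v) (a w) = 13/256" if "v \<noteq> w" for v w by (rule a3(1)[OF that])
    fix d :: "3^2" assume d: "d \<noteq> 0"
    have ne: "v \<noteq> v + d" for v using d by simp
    show "a v \<star> a (v + d) = (1/32) *\<^sub>Q (2 *\<^sub>Q a v + 2 *\<^sub>Q a (v + d) + a (v - d)) - (135/2048) *\<^sub>Q u d" for v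
      using A3(2)[OF ne] by (simp only: a_tau third uL[OF d])
    show "a v \<star> u d = (1/9) *\<^sub>Q (2 *\<^sub>Q a v - a (v + d) - a (v - d)) + (5/32) *\<^sub>Q u d" for v
      using A3(3)[OF ne] by (simp only: a_tau third uL[OF d])
    show "u d \<star> u d = u d"
      using A3(4)[OF ne] by (simp only: uL[OF d])
  next
    show "u (- d) = u d" for d
      using L_minus[of d 0] by (cases "d = 0") (auto simp: u_def)
  qed
  moreover have "range a = {b \<in> Axs. miyamoto b \<in> C}"
  proof
    show "range a \<subseteq> {b \<in> Axs. miyamoto b \<in> C}"
      using aX axis_of(2)[OF T_inv] by (auto simp: C_p a_def T_def)
    show "{b \<in> Axs. miyamoto b \<in> C} \<subseteq> range a"
    proof
      fix b assume b: "b \<in> {b \<in> Axs. miyamoto b \<in> C}"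
      then obtain v where "miyamoto b = T v" by (auto simp: C_p T_def)
      then have "b = a v" using axis_of_miyamoto[of b] b by (simp add: a_def)
      then show "b \<in> range a" by blast
    qed
  qed
  ultimately show ?thesis by blast
qed

end

theorem mainTheorem6:
  fixes scale :: "rat \<Rightarrow> 'a::ab_group_add \<Rightarrow> 'a"
    and prod :: "'a \<Rightarrow> 'a \<Rightarrow> 'a"
    and Axs :: "'a set"
    and form :: "'a \<Rightarrow> 'a \<Rightarrow> rat"
    and H C :: "('a \<Rightarrow> 'a) set"
    and GH :: "('a \<Rightarrow> 'a) monoid"
    and A12 :: "'a set"
  assumes "A286 scale prod Axs form"
    and "maximal_subgroup H (comm_rat_algebra.miyamoto_group scale prod Axs)"
    and "GH = (comm_rat_algebra.miyamoto_group scale prod Axs)\<lparr>carrier := H\<rparr>"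
    and "is_U_3_2_split_2 GH"
    and "\<exists>t\<in>involutions GH. C = conj_class GH t"
    and "card C = 9"
    and "A12 = comm_rat_algebra.alg_generated scale prod
                 {a \<in> Axs. comm_rat_algebra.miyamoto scale prod a \<in> C}"
  shows "vector_space.dim scale A12 = 12 \<and>
         comm_rat_algebra.alg_aut_group scale prod A12 \<cong> AGL_2_3"
proof -
  interpret A286 scale prod Axs form by (rule assms(1))
  have H: "subgroup H M" using assms(2) by (simp add: maximal_subgroup_def)
  obtain t where t: "t \<in> involutions (M\<lparr>carrier := H\<rparr>)" "C = conj_class (M\<lparr>carrier := H\<rparr>) t"
    using assms(3,5) by blast
  obtain a u where au: "affine_plane_algebra scale prod form a u" "range a = {b \<in> Axs. miyamoto b \<in> C}"
    using affine_plane_of_class[OF H _ t assms(6)] assms(3,4) by blast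
  interpret affine_plane_algebra scale prod form a u by (rule au(1))
  have "A12 = B" using assms(7) alg_generated_a unfolding au(2) by simp
  then show ?thesis using dim_B alg_aut_group_iso_AGL by simp
qed

end
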